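(* Let $\lambda$ and $\kappa$ be (infinite) regular cardinals with $\kappa<\lambda$, and let $I_{0}$ and $I_{1}$ be $\lambda^{+},\kappa+1$-trees. Assume that $t$ is a $\lambda,\kappa$-large $\lambda^{+},\lambda$-tree of cardinality $\lambda$. Then $$I_{0}\equiv^{\lambda}_{t}I_{1}\quad\Longleftrightarrow\quad I_{0}\cong I_{1}.$$
   Context: Trees. A tree is a partial order $(t,<)$ such that for each $x\in t$ the set $\mathrm{pred}(x)=\{y\in t : y<x\}$ is well-ordered by $<$. Trees are regarded as structures in the language $\{<\}$. Write $x\sim y$ if $\mathrm{pred}(x)=\mathrm{pred}(y)$, and let $[x]$ be the $\sim$-class of $x$. A $\lambda^{+},\lambda$-tree is a tree $t$ such that: (i) $|[x]|<\lambda^{+}$ for every $x\in t$; (ii) there are no branches of length $\ge\lambda$ in $t$; (iii) $t$ has a unique root; (iv) if $x,y\in t$ have no immediate predecessors and $x\sim y$, then $x=y$. A $\lambda^{+},\kappa+1$-tree is defined in the same way, with (ii) replaced by: for every element $x$ the order type of $\mathrm{pred}(x)$ is at most $\kappa$ (so levels $0,1,\dots,\kappa$ may be nonempty, and there are no higher levels). Game. Let $t$ be a tree, $\lambda$ a cardinal and $\mathcal A,\mathcal B$ structures in the same relational language. In the Ehrenfeucht-Fraisse game $G^{\lambda}_{t}(\mathcal A,\mathcal B)$, at each move $\alpha$ player $\forall$ chooses $x_\alpha\in t$, some $\lambda_\alpha<\lambda$ and either elements $a_\alpha^\beta\in\mathcal A$ ($\beta<\lambda_\alpha$) or elements $b_\alpha^\beta\in\mathcal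 B$ ($\beta<\lambda_\alpha$); then player $\exists$ answers with $b_\alpha^\beta\in\mathcal B$ ($\beta<\lambda_\alpha$) in the first case and with $a_\alpha^\beta\in\mathcal A$ ($\beta<\lambda_\alpha$) in the second. Player $\forall$ must move so that $(x_\beta)_{\beta\le\alpha}$ is strictly increasing in $t$; player $\exists$ must move so that $\{(a_\gamma^\beta,b_\gamma^\beta):\gamma\le\alpha,\ \beta<\lambda_\gamma\}$ is a partial isomorphism from $\mathcal A$ to $\mathcal B$. The player who first has to break the rules loses. $\mathcal A\equiv^{\lambda}_{t}\mathcal B$ means that $\exists$ has a winning strategy in $G^{\lambda}_{t}(\mathcal A,\mathcal B)$. The ideal $I[\lambda]$. For a regular cardinal $\lambda$, $I[\lambda]$ is the set of all $A\subseteq\lambda$ for which there exist a cub $E\subseteq\lambda$ and $\{P_\alpha:\alpha<\lambda\}$ such that (1) each $P_\alpha$ is a set of subsets of $\alpha$ with $|P_\alpha|<\lambda$; (2) for every limit $\delta\in A\cap E$ with $\mathrm{cf}(\delta)<\delta$ there is $C\subseteq\delta$ such that the order type of $C$ is $<\delta$, $\sup C=\delta$, and $C\cap\alpha\in\bigcup_{\beta<\delta}P_\beta$ for all $\alpha<\delta$. The set $S[t']$. For a $\lambda^{+},\lambda$-tree $t$ of cardinality $\lambda$ fix an enumeration $\{x_i:i<\lambda\}$ of $t$ such that $x_i<x_j$ implies $i<j$. For a subtree $t'$ of $t$, $S[t']$ is the set of limit ordinals $\delta<\lambda$ such that $\{x_i\in t': i<\delta\}$ contains a branch of length $\delta$.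 Largeness. A $\lambda^{+},\lambda$-tree $t$ of cardinality $\lambda$ (with such a fixed enumeration) is $\lambda,\kappa$-large if there are sets $E_\xi$, $\xi\le\kappa$, with $E_0\neq\emptyset$, such that: (i) $E_\xi\subseteq t$, and $E_\xi\cap E_{\xi'}=\emptyset$ if $\xi\ne\xi'$; (ii) for $\xi<\delta\ (\le\kappa)$ and $x\in E_\delta$ there is a unique $y\in E_\xi$ with $y<x$; (iii) if $\delta\le\kappa$ is limit, $x_\xi\in E_\xi$ for all $\xi<\delta$ and $(x_\xi)_{\xi<\delta}$ is increasing, then there is $y\in E_\delta$ with $x_\xi<y$ for all $\xi<\delta$; (iv) for $\xi<\kappa$ and $x\in E_\xi$, writing $t_x=\{y\in t: x\le y\text{ and there is }z\in E_{\xi+1}\text{ such that }y<z\}$, there exists a set $\Theta$ of regular cardinals $<\lambda$ such that (a) $S[t_x]\cup\{\delta<\lambda:\mathrm{cf}(\delta)<\delta,\ \mathrm{cf}(\delta)\in\Theta\}$ contains a cub subset of $\lambda$; (b) $\{\delta<\lambda:\mathrm{cf}(\delta)<\delta,\ \mathrm{cf}(\delta)\in\Theta,\ \delta\notin S[t_x]\}\in I[\lambda]$; (c) for every $\delta\in\Theta$ there is $y\in t_x$ such that the order type of $\{z: x\le z<y\}$ is $\delta$; (v) if $\gamma=\beta+1<\kappa$, $(x_\xi)_{\xi<\delta}$ is an increasing sequence in $t$, $x_0\in E_\beta$, and for all $\xi<\delta$ there is $y_\xi\in E_\gamma$ with $x_\xi<y_\xi$, then there is $y\in E_\gamma$ with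 $x_\xi<y$ for all $\xi<\delta$. *)

theory Defs
  imports Main "HOL-Library.FuncSet"
begin

unbundle cardinal_syntax

section \<open>Ordinals\<close>

text \<open>
  Ordinals are the elements of an arbitrary type \<open>'o\<close> of class \<^class>\<open>wellorder\<close>; the ordinal
  \<open>\<alpha>\<close> is identified with the set \<open>{..<\<alpha>}\<close> of its predecessors.  Subsets of \<open>'o\<close> are turned into
  well-orders in the sense of the library by \<open>ord_rel\<close>, so that order types are compared by
  \<open><o\<close>, \<open>\<le>o\<close> and \<open>=o\<close>; cardinalities are compared in the same way, using \<open>|A|\<close>.
  The cardinal \<open>\<lambda>\<close> is written \<open>lam\<close> in formulas.
\<close>

definition ord_rel :: "'o::wellorder set \<Rightarrow> 'o rel" where
  "ord_rel A = {(\<alpha>, \<beta>). \<alpha> \<in> A \<and> \<beta> \<in> A \<and> \<alpha> \<le> \<beta>}"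

definition ord_zero :: "'o::wellorder" where
  "ord_zero = (LEAST \<alpha>. True)"

text \<open>Meaningful only if \<open>\<alpha>\<close> is not the greatest element of \<open>'o\<close>.\<close>

definition ord_suc :: "'o::wellorder \<Rightarrow> 'o" where
  "ord_suc \<alpha> = (LEAST \<beta>. \<alpha> < \<beta>)"

text \<open>The supremum of \<open>C\<close> as an ordinal, for \<open>C\<close> bounded in \<open>'o\<close>.\<close>

definition ord_sup :: "'o::wellorder set \<Rightarrow> 'o" where
  "ord_sup C = (LEAST \<beta>. \<forall>\<gamma>\<in>C. \<gamma> \<le> \<beta>)"

definition limit_ord :: "'o::wellorder \<Rightarrow> bool" where
  "limit_ord \<delta> \<longleftrightarrow> (\<exists>\<alpha>. \<alpha> < \<delta>) \<and> (\<forall>\<alpha><\<delta>. \<exists>\<beta><\<delta>. \<alpha> < \<beta>)"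

definition regular_cardinal :: "'o::wellorder \<Rightarrow> bool" where
  "regular_cardinal \<kappa> \<longleftrightarrow> Cinfinite (ord_rel {..<\<kappa>}) \<and> regularCard (ord_rel {..<\<kappa>})"

definition cf :: "'o::wellorder \<Rightarrow> 'o" where
  "cf \<delta> = (LEAST \<gamma>. \<exists>f. f ` {..<\<gamma>} \<subseteq> {..<\<delta>} \<and> (\<forall>\<alpha><\<delta>. \<exists>\<beta><\<gamma>. \<alpha> \<le> f \<beta>))"

definition cub :: "'o::wellorder \<Rightarrow> 'o set \<Rightarrow> bool" where
  "cub lam C \<longleftrightarrow> C \<subseteq> {..<lam} \<and> (\<forall>\<alpha><lam. \<exists>\<beta>\<in>C. \<alpha> < \<beta>) \<and>
     (\<forall>\<delta><lam. limit_ord \<delta> \<longrightarrow> (\<forall>\<alpha><\<delta>. \<exists>\<beta>\<in>C. \<alpha> < \<beta> \<and> \<beta> < \<delta>) \<longrightarrow> \<delta> \<in> C)"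

definition I_ideal :: "'o::wellorder \<Rightarrow> 'o set set" where
  "I_ideal lam = {A. A \<subseteq> {..<lam} \<and>
     (\<exists>E P. cub lam E \<and>
        (\<forall>\<alpha><lam. P \<alpha> \<subseteq> Pow {..<\<alpha>} \<and> |P \<alpha>| <o |{..<lam}| ) \<and>
        (\<forall>\<delta>\<in>A \<inter> E. limit_ord \<delta> \<and> cf \<delta> < \<delta> \<longrightarrow>
           (\<exists>C\<subseteq>{..<\<delta>}. ord_rel C <o ord_rel {..<\<delta>} \<and> ord_sup C = \<delta> \<and>
              (\<forall>\<alpha><\<delta>. C \<inter> {..<\<alpha>} \<in> (\<Union>\<beta>\<in>{..<\<delta>}. P \<beta>)))))}"


section \<open>Trees\<close>

record 'a tree =
  nodes :: "'a set"
  lt :: "'a \<Rightarrow> 'a \<Rightarrow> bool"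

definition preds :: "'a tree \<Rightarrow> 'a \<Rightarrow> 'a set" where
  "preds t x = {y \<in> nodes t. lt t y x}"

definition tree_rel :: "'a tree \<Rightarrow> 'a set \<Rightarrow> 'a rel" where
  "tree_rel t A = {(x, y). x \<in> A \<and> y \<in> A \<and> (x = y \<or> lt t x y)}"

definition is_tree :: "'a tree \<Rightarrow> bool" where
  "is_tree t \<longleftrightarrow>
     (\<forall>x\<in>nodes t. \<not> lt t x x) \<and>
     (\<forall>x\<in>nodes t. \<forall>y\<in>nodes t. \<forall>z\<in>nodes t. lt t x y \<longrightarrow> lt t y z \<longrightarrow> lt t x z) \<and>
     (\<forall>x\<in>nodes t. well_order_on (preds t x) (tree_rel t (preds t x)))"

definition tree_sim :: "'a tree \<Rightarrow> 'a \<Rightarrow> 'a \<Rightarrow> bool" where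
  "tree_sim t x y \<longleftrightarrow> preds t x = preds t y"

definition sim_class :: "'a tree \<Rightarrow> 'a \<Rightarrow> 'a set" where
  "sim_class t x = {y \<in> nodes t. tree_sim t x y}"

definition has_immediate_pred :: "'a tree \<Rightarrow> 'a \<Rightarrow> bool" where
  "has_immediate_pred t x \<longleftrightarrow> (\<exists>y\<in>preds t x. \<not> (\<exists>z\<in>nodes t. lt t y z \<and> lt t z x))"

text \<open>A branch of a set \<open>A\<close> of nodes is a maximal linearly ordered subset of \<open>A\<close>; its length is the
  order type of \<open>tree_rel t B\<close>.\<close>

definition branch_of :: "'a tree \<Rightarrow> 'a set \<Rightarrow> 'a set \<Rightarrow> bool" where
  "branch_of t A B \<longleftrightarrow> pred_on.maxchain A (lt t) B"

text \<open>The requirements common to \<open>\<lambda>\<^sup>+,\<lambda>\<close>-trees and \<open>\<lambda>\<^sup>+,\<kappa>+1\<close>-trees.\<close>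

definition succ_card_tree :: "'o::wellorder \<Rightarrow> 'a tree \<Rightarrow> bool" where
  "succ_card_tree lam t \<longleftrightarrow> is_tree t \<and>
     (\<forall>x\<in>nodes t. |sim_class t x| <o cardSuc |{..<lam}| ) \<and>
     (\<exists>!x. x \<in> nodes t \<and> preds t x = {}) \<and>
     (\<forall>x\<in>nodes t. \<forall>y\<in>nodes t.
        \<not> has_immediate_pred t x \<and> \<not> has_immediate_pred t y \<and> tree_sim t x y \<longrightarrow> x = y)"

text \<open>\<open>\<lambda>\<^sup>+,\<lambda>\<close>-trees.\<close>

definition short_branch_tree :: "'o::wellorder \<Rightarrow> 'a tree \<Rightarrow> bool" where
  "short_branch_tree lam t \<longleftrightarrow> succ_card_tree lam t \<and>
     (\<forall>B. branch_of t (nodes t) B \<longrightarrow> \<not> ord_rel {..<lam} \<le>o tree_rel t B)"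

text \<open>\<open>\<lambda>\<^sup>+,\<kappa>+1\<close>-trees.\<close>

definition bounded_height_tree :: "'o::wellorder \<Rightarrow> 'o \<Rightarrow> 'a tree \<Rightarrow> bool" where
  "bounded_height_tree lam \<kappa> t \<longleftrightarrow> succ_card_tree lam t \<and>
     (\<forall>x\<in>nodes t. tree_rel t (preds t x) \<le>o ord_rel {..<\<kappa>})"


section \<open>Relational structures and the Ehrenfeucht-Fraisse game\<close>

text \<open>Relation symbols are the elements of \<open>'r\<close>; a relation is a predicate on lists, false on lists
  of the wrong length.\<close>

record ('r, 'a) rel_structure =
  univ :: "'a set"
  interp :: "'r \<Rightarrow> 'a list \<Rightarrow> bool"

definition partial_iso ::
    "('r, 'a) rel_structure \<Rightarrow> ('r, 'b) rel_structure \<Rightarrow> ('a \<times> 'b) set \<Rightarrow> bool" where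
  "partial_iso A B p \<longleftrightarrow> p \<subseteq> univ A \<times> univ B \<and> single_valued p \<and> single_valued (p\<inverse>) \<and>
     (\<forall>R ps. set ps \<subseteq> p \<longrightarrow> interp A R (map fst ps) = interp B R (map snd ps))"

definition isomorphic :: "('r, 'a) rel_structure \<Rightarrow> ('r, 'b) rel_structure \<Rightarrow> bool" where
  "isomorphic A B \<longleftrightarrow> (\<exists>f. bij_betw f (univ A) (univ B) \<and>
     (\<forall>R xs. set xs \<subseteq> univ A \<longrightarrow> interp A R xs = interp B R (map f xs)))"

datatype tree_language = Less_Symbol

definition tree_structure :: "'a tree \<Rightarrow> (tree_language, 'a) rel_structure" where
  "tree_structure t = \<lparr>univ = nodes t,
     interp = (\<lambda>_ xs. \<exists>x\<in>nodes t. \<exists>y\<in>nodes t. xs = [x, y] \<and> lt t x y)\<rparr>"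

text \<open>
  A move of the player \<open>\<forall>\<close>, apart from the node of \<open>t\<close>: the length \<open>\<lambda>\<^sub>\<alpha>\<close> and a sequence of that
  length of elements of the first or of the second structure.
\<close>

datatype ('o, 'a, 'b) move = In_Left 'o "'o \<Rightarrow> 'a" | In_Right 'o "'o \<Rightarrow> 'b"

text \<open>
  The moves of \<open>\<forall>\<close> up to stage \<open>\<alpha>\<close>.  As the nodes \<open>x\<^sub>\<beta>\<close> (\<open>\<beta> \<le> \<alpha>\<close>) have to be strictly increasing,
  this sequence is determined by its range, which is a chain with last element \<open>x\<^sub>\<alpha>\<close>, and
  conversely every chain of \<open>t\<close> with a last element is well-ordered and arises in this way.  So
  the moves are recorded as a partial function that sends \<open>x\<^sub>\<beta>\<close> to the rest of move \<open>\<beta>\<close>.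
  No bound on the length of plays is built in.
\<close>

type_synonym ('t, 'o, 'a, 'b) history = "'t \<Rightarrow> ('o, 'a, 'b) move option"

fun legal_move :: "'o::wellorder \<Rightarrow> ('r, 'a) rel_structure \<Rightarrow> ('r, 'b) rel_structure \<Rightarrow>
    ('o, 'a, 'b) move \<Rightarrow> bool" where
  "legal_move lam A B (In_Left l a) = (l < lam \<and> a \<in> {..<l} \<rightarrow>\<^sub>E univ A)"
| "legal_move lam A B (In_Right l b) = (l < lam \<and> b \<in> {..<l} \<rightarrow>\<^sub>E univ B)"

definition legal_history :: "'o::wellorder \<Rightarrow> 't tree \<Rightarrow> ('r, 'a) rel_structure \<Rightarrow>
    ('r, 'b) rel_structure \<Rightarrow> ('t, 'o, 'a, 'b) history \<Rightarrow> bool" where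
  "legal_history lam t A B h \<longleftrightarrow>
     pred_on.chain (nodes t) (lt t) (dom h) \<and>
     (\<exists>x\<in>dom h. \<forall>y\<in>dom h. y = x \<or> lt t y x) \<and>
     (\<forall>m\<in>ran h. legal_move lam A B m)"

definition history_upto :: "'t tree \<Rightarrow> ('t, 'o, 'a, 'b) history \<Rightarrow> 't \<Rightarrow>
    ('t, 'o, 'a, 'b) history" where
  "history_upto t h x = h |` {y. y = x \<or> lt t y x}"

text \<open>
  A strategy of \<open>\<exists>\<close> is a pair \<open>(sa, sb)\<close>: given the moves of \<open>\<forall>\<close> up to and including the current
  one, \<open>sb\<close> is the answer if \<open>\<forall>\<close> played in the first structure, \<open>sa\<close> if in the second.
  \<open>round_pairs sa sb t h x\<close> is the set of pairs contributed by the move at node \<open>x\<close>.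
\<close>

definition round_pairs :: "(('t, 'o::wellorder, 'a, 'b) history \<Rightarrow> 'o \<Rightarrow> 'a) \<Rightarrow>
    (('t, 'o, 'a, 'b) history \<Rightarrow> 'o \<Rightarrow> 'b) \<Rightarrow> 't tree \<Rightarrow> ('t, 'o, 'a, 'b) history \<Rightarrow> 't \<Rightarrow>
    ('a \<times> 'b) set" where
  "round_pairs sa sb t h x = (case h x of
       None \<Rightarrow> {}
     | Some (In_Left l a) \<Rightarrow> {(a \<beta>, sb (history_upto t h x) \<beta>) |\<beta>. \<beta> < l}
     | Some (In_Right l b) \<Rightarrow> {(sa (history_upto t h x) \<beta>, b \<beta>) |\<beta>. \<beta> < l})"

text \<open>\<open>\<exists>\<close> wins iff at no stage she is the first to break the rules, i.e. iff after every
  sequence of legal moves of \<open>\<forall>\<close> her answers keep the set of pairs a partial isomorphism.\<close>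

definition EF_equiv :: "'o::wellorder \<Rightarrow> 't tree \<Rightarrow> ('r, 'a) rel_structure \<Rightarrow>
    ('r, 'b) rel_structure \<Rightarrow> bool" where
  "EF_equiv lam t A B \<longleftrightarrow> (\<exists>sa sb. \<forall>h. legal_history lam t A B h \<longrightarrow>
     partial_iso A B (\<Union>x\<in>dom h. round_pairs sa sb t h x))"


section \<open>Large trees\<close>

definition tree_enumeration :: "'o::wellorder \<Rightarrow> 't tree \<Rightarrow> ('o \<Rightarrow> 't) \<Rightarrow> bool" where
  "tree_enumeration lam t e \<longleftrightarrow> bij_betw e {..<lam} (nodes t) \<and>
     (\<forall>i<lam. \<forall>j<lam. lt t (e i) (e j) \<longrightarrow> i < j)"

text \<open>The set \<open>S[s]\<close> for a set \<open>s\<close> of nodes of \<open>t\<close>, with respect to the enumeration \<open>e\<close>.\<close>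

definition S_set :: "'o::wellorder \<Rightarrow> 't tree \<Rightarrow> ('o \<Rightarrow> 't) \<Rightarrow> 't set \<Rightarrow> 'o set" where
  "S_set lam t e s = {\<delta>. \<delta> < lam \<and> limit_ord \<delta> \<and>
     (\<exists>B. branch_of t {e i |i. i < \<delta> \<and> e i \<in> s} B \<and> tree_rel t B =o ord_rel {..<\<delta>})}"

definition increasing_seq :: "'t tree \<Rightarrow> 'o::wellorder \<Rightarrow> ('o \<Rightarrow> 't) \<Rightarrow> bool" where
  "increasing_seq t \<delta> x \<longleftrightarrow> (\<forall>\<xi><\<delta>. x \<xi> \<in> nodes t) \<and> (\<forall>\<xi> \<eta>. \<xi> < \<eta> \<and> \<eta> < \<delta> \<longrightarrow> lt t (x \<xi>) (x \<eta>))"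

text \<open>The subtree \<open>t\<^sub>x\<close>, where \<open>F\<close> is the level set above that of \<open>x\<close>.\<close>

definition subtree_below :: "'t tree \<Rightarrow> 't set \<Rightarrow> 't \<Rightarrow> 't set" where
  "subtree_below t F x = {y \<in> nodes t. (y = x \<or> lt t x y) \<and> (\<exists>z\<in>F. lt t y z)}"

definition large :: "'o::wellorder \<Rightarrow> 'o \<Rightarrow> 't tree \<Rightarrow> ('o \<Rightarrow> 't) \<Rightarrow> bool" where
  "large lam \<kappa> t e \<longleftrightarrow> (\<exists>E :: 'o \<Rightarrow> 't set.
     E ord_zero \<noteq> {} \<and>
     (\<forall>\<xi>\<le>\<kappa>. E \<xi> \<subseteq> nodes t) \<and>
     (\<forall>\<xi>\<le>\<kappa>. \<forall>\<eta>\<le>\<kappa>. \<xi> \<noteq> \<eta> \<longrightarrow> E \<xi> \<inter> E \<eta> = {}) \<and>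
     (\<forall>\<delta>\<le>\<kappa>. \<forall>\<xi><\<delta>. \<forall>x\<in>E \<delta>. \<exists>!y. y \<in> E \<xi> \<and> lt t y x) \<and>
     (\<forall>\<delta>\<le>\<kappa>. limit_ord \<delta> \<longrightarrow>
        (\<forall>x. (\<forall>\<xi><\<delta>. x \<xi> \<in> E \<xi>) \<and> increasing_seq t \<delta> x \<longrightarrow>
           (\<exists>y\<in>E \<delta>. \<forall>\<xi><\<delta>. lt t (x \<xi>) y))) \<and>
     (\<forall>\<xi><\<kappa>. \<forall>x\<in>E \<xi>. let tx = subtree_below t (E (ord_suc \<xi>)) x in
        (\<exists>\<Theta>. (\<forall>\<theta>\<in>\<Theta>. regular_cardinal \<theta> \<and> \<theta> < lam) \<and>
           (\<exists>C. cub lam C \<and> C \<subseteq> S_set lam t e tx \<union> {\<delta>. \<delta> < lam \<and> cf \<delta> < \<delta> \<and> cf \<delta> \<in> \<Theta>}) \<and>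
           {\<delta>. \<delta> < lam \<and> cf \<delta> < \<delta> \<and> cf \<delta> \<in> \<Theta> \<and> \<delta> \<notin> S_set lam t e tx} \<in> I_ideal lam \<and>
           (\<forall>\<theta>\<in>\<Theta>. \<exists>y\<in>tx.
              tree_rel t {z \<in> nodes t. (z = x \<or> lt t x z) \<and> lt t z y} =o ord_rel {..<\<theta>}))) \<and>
     (\<forall>\<beta> \<gamma> (\<delta> :: 'o) (x :: 'o \<Rightarrow> 't).
        \<gamma> = ord_suc \<beta> \<and> \<beta> < \<kappa> \<and> \<gamma> < \<kappa> \<and> ord_zero < \<delta> \<and> increasing_seq t \<delta> x \<and>
        x ord_zero \<in> E \<beta> \<and> (\<forall>\<xi><\<delta>. \<exists>y\<in>E \<gamma>. lt t (x \<xi>) y) \<longrightarrow>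
        (\<exists>y\<in>E \<gamma>. \<forall>\<xi><\<delta>. lt t (x \<xi>) y)))"

end

theory Submission
  imports Defs
begin

text \<open>
  From a winning strategy of \<open>\<exists>\<close> an isomorphism is built by recursion on the levels of \<open>I\<^sub>0\<close>; every
  matched pair comes with a position of the game in which it has been played, the positions of comparable
  pairs extend each other, and the position of a pair of level \<open>\<zeta>\<close> ends at a node in \<open>E \<xi>\<close> with
  \<open>\<xi> = 2\<zeta>\<close>.  At limit levels the positions are united, condition (iii) provides the next node, and
  one more move finds the node on the other side.

  The crucial step is to match the at most \<open>\<lambda>\<close> immediate successors of \<open>\<eta>\<close> with those of the partner
  \<open>\<nu>\<close>.  Enumerate both in order type at most \<open>\<lambda>\<close>.  By condition (iv) there is, for every \<open>\<delta>\<close> in a cub,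
  a play in \<open>t\<^sub>x\<close> in which the first \<open>\<delta>\<close> successors of \<open>\<nu>\<close> are answered by successors of \<open>\<eta>\<close> among
  the first \<open>\<delta>\<close>: it runs along a branch of length \<open>\<delta>\<close> if \<open>\<delta> \<in> S[t\<^sub>x]\<close>, and otherwise it has length
  \<open>cf \<delta>\<close> and is guided by the set that \<open>I[\<lambda>]\<close> attaches to \<open>\<delta>\<close>, so that its proper initial parts are among
  fewer than \<open>\<lambda>\<close> plays foreseen below \<open>\<delta>\<close>.  After this play, \<open>\<omega>\<close> moves inside the next subtree answer the
  successors of \<open>\<eta>\<close> in some interval \<open>[\<delta>, \<delta>')\<close> by successors of \<open>\<nu>\<close> in the same interval.  Such
  intervals partition \<open>\<lambda>\<close>, which gives an injection between the two sets of successors; by symmetry there is one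
  in the other direction, and the Schroeder-Bernstein construction combines them into a bijection all of whose
  pairs occur in plays.
\<close>

section \<open>Ordinals and regular cardinals\<close>

text \<open>One play handles fewer than \<lambda> elements, while a node may have \<lambda>
  immediate successors. So no position contains the whole bijection, different successors are
  matched in different plays, and answers in unrelated plays might collide. Indices prevent this:
  the play responsible for an interval answers inside that interval, so a collision could occur only
  within one play, where the partial isomorphism excludes it. To keep answers from falling below
  \<delta>, the target side is exhausted below \<delta> beforehand, with all its partners below
  \<delta> as well. This preparation and the \<omega> moves for the interval each consume one step
  from E \<xi> to E (\<xi>+1), which is the origin of the factor 2 in the levels. The preparation is
  the delicate part: \<delta> has to be closed under the answers of \<exists>, which are known only
  once the play is fixed, while the play itself depends on \<delta>. Guessing breaks this circle,
  since all proper initial parts of the play are taken from lists that are drawn up without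
  reference to \<delta>.\<close>

lemma Field_ord_rel [simp]: "Field (ord_rel A) = A"
  by (auto simp: ord_rel_def Field_def)

lemma ord_rel_iff: "(\<alpha>, \<beta>) \<in> ord_rel A \<longleftrightarrow> \<alpha> \<in> A \<and> \<beta> \<in> A \<and> \<alpha> \<le> \<beta>"
  by (simp add: ord_rel_def)

lemma Well_order_ord_rel: "Well_order (ord_rel (A :: 'o::wellorder set))"
proof -
  have "wf (ord_rel A - Id)"
    by (rule wf_subset[OF wf]) (auto simp: ord_rel_def)
  then show ?thesis
    unfolding Field_ord_rel well_order_on_def linear_order_on_def partial_order_on_def preorder_on_def
    by (auto simp: refl_on_def trans_def antisym_def total_on_def ord_rel_iff)
qed

lemma Restr_ord_rel: "Restr (ord_rel A) B = ord_rel (A \<inter> B)"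
  by (auto simp: ord_rel_def)

lemma underS_ord_rel: "a \<in> A \<Longrightarrow> underS (ord_rel A) a = A \<inter> {..<a}"
  by (auto simp: ord_rel_def underS_def)

lemma ord_rel_initial_less:
  fixes \<alpha> \<beta> :: "'o::wellorder"
  assumes "\<alpha> < \<beta>"
  shows "ord_rel {..<\<alpha>} <o ord_rel {..<\<beta>}"
proof -
  have "Restr (ord_rel {..<\<beta>}) (underS (ord_rel {..<\<beta>}) \<alpha>) = ord_rel {..<\<alpha>}"
    using assms by (auto simp: underS_ord_rel Restr_ord_rel intro!: arg_cong[where f = ord_rel])
  then show ?thesis
    using assms ordIso_reflexive[OF Well_order_ord_rel[of "{..<\<alpha>}"]]
    by (subst ordLess_iff_ordIso_Restr[OF Well_order_ord_rel Well_order_ord_rel])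
      (auto intro!: bexI[of _ \<alpha>])
qed

lemma ord_rel_initial_eq:
  fixes \<alpha> \<beta> :: "'o::wellorder"
  assumes "ord_rel {..<\<alpha>} =o ord_rel {..<\<beta>}"
  shows "\<alpha> = \<beta>"
proof (rule linorder_cases[of \<alpha> \<beta>])
  assume "\<alpha> < \<beta>" then show ?thesis
    using assms ord_rel_initial_less not_ordLess_ordIso by blast
next
  assume "\<beta> < \<alpha>" then show ?thesis
    using assms ord_rel_initial_less not_ordLess_ordIso ordIso_symmetric by blast
qed

lemma ordLess_initial:
  fixes \<beta> :: "'o::wellorder"
  assumes "r <o ord_rel {..<\<beta>}"
  shows "\<exists>\<alpha><\<beta>. r =o ord_rel {..<\<alpha>}"
proof -
  have "Well_order r" using assms by (simp add: ordLess_def)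
  then obtain a where a: "a < \<beta>" "r =o Restr (ord_rel {..<\<beta>}) (underS (ord_rel {..<\<beta>}) a)"
    using assms ordLess_iff_ordIso_Restr[OF Well_order_ord_rel[of "{..<\<beta>}"]] by auto
  have "{..<\<beta>} \<inter> ({..<\<beta>} \<inter> {..<a}) = {..<a}" using a(1) by auto
  then show ?thesis using a by (auto simp: underS_ord_rel Restr_ord_rel)
qed

lemma ordIso_enum:
  fixes \<delta> :: "'o::wellorder"
  assumes "r =o ord_rel {..<\<delta>}"
  obtains g where "bij_betw g {..<\<delta>} (Field r)"
    "\<forall>\<alpha><\<delta>. \<forall>\<beta><\<delta>. \<alpha> \<le> \<beta> \<longleftrightarrow> (g \<alpha>, g \<beta>) \<in> r"
proof -
  obtain g where "iso (ord_rel {..<\<delta>}) r g"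
    using ordIso_symmetric[OF assms] by (auto simp: ordIso_def)
  then show thesis using that[of g] by (auto simp: iso_iff2 ord_rel_iff)
qed

lemma regular_Cinfinite: "regular_cardinal (\<kappa> :: 'o::wellorder) \<Longrightarrow> Cinfinite (ord_rel {..<\<kappa>})"
  by (simp add: regular_cardinal_def)

lemma regular_infinite: "regular_cardinal (\<kappa> :: 'o::wellorder) \<Longrightarrow> infinite {..<\<kappa>}"
  using regular_Cinfinite[of \<kappa>] by (simp add: cinfinite_def)

lemma card_of_ord_rel: "regular_cardinal (\<kappa> :: 'o::wellorder) \<Longrightarrow> |{..<\<kappa>}| =o ord_rel {..<\<kappa>}"
  using card_of_Field_ordIso[of "ord_rel {..<\<kappa>}"] regular_Cinfinite[of \<kappa>] by simp

lemma regular_no_max: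
  fixes \<kappa> :: "'o::wellorder"
  assumes "regular_cardinal \<kappa>" "\<alpha> < \<kappa>"
  shows "\<exists>\<beta><\<kappa>. \<alpha> < \<beta>"
  using infinite_Card_order_limit[of "ord_rel {..<\<kappa>}" \<alpha>] regular_Cinfinite[OF assms(1)] assms(2)
  by (auto simp: cinfinite_def ord_rel_iff less_le)

lemma regular_limit_ord: "regular_cardinal (\<kappa> :: 'o::wellorder) \<Longrightarrow> limit_ord \<kappa>"
  using regular_no_max[of \<kappa>] infinite_imp_nonempty[OF regular_infinite, of \<kappa>]
  by (auto simp: limit_ord_def)

lemma ord_zero_le [simp]: "ord_zero \<le> (\<alpha> :: 'o::wellorder)"
  by (simp add: ord_zero_def Least_le)

lemma less_ord_suc: "\<alpha> < \<beta> \<Longrightarrow> \<alpha> < ord_suc (\<alpha> :: 'o::wellorder)"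
  unfolding ord_suc_def by (rule LeastI)

lemma ord_suc_le: "\<alpha> < \<beta> \<Longrightarrow> ord_suc \<alpha> \<le> (\<beta> :: 'o::wellorder)"
  unfolding ord_suc_def by (rule Least_le)

lemma limit_ord_suc_less: "limit_ord \<delta> \<Longrightarrow> \<alpha> < \<delta> \<Longrightarrow> ord_suc \<alpha> < (\<delta> :: 'o::wellorder)"
  unfolding limit_ord_def using le_less_trans[OF ord_suc_le] by blast

lemma limit_ord_zero_less: "limit_ord \<delta> \<Longrightarrow> ord_zero < (\<delta> :: 'o::wellorder)"
  unfolding limit_ord_def using le_less_trans[OF ord_zero_le] by blast

text \<open>An unbounded \<open>X\<close> is cofinal, and \<open>regularCard\<close> makes every
  cofinal subset as large as \<kappa> itself.\<close>

lemma regular_bounded: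
  fixes \<kappa> :: "'o::wellorder"
  assumes \<kappa>: "regular_cardinal \<kappa>" and X: "X \<subseteq> {..<\<kappa>}" and small: "|X| <o |{..<\<kappa>}|"
  shows "\<exists>\<beta><\<kappa>. \<forall>x\<in>X. x < \<beta>"
proof (rule ccontr)
  assume neg: "\<not> ?thesis"
  have "cofinal X (ord_rel {..<\<kappa>})"
    unfolding cofinal_def
  proof
    fix a assume "a \<in> Field (ord_rel {..<\<kappa>})"
    \<comment> \<open>\<open>cofinal\<close> asks for a strictly larger element, hence the passage
      from \<open>a\<close> to some \<open>b\<close> above it.\<close>
    then obtain b where b: "b < \<kappa>" "a < b" using regular_no_max[OF \<kappa>, of a] by auto
    then obtain x where "x \<in> X" "b \<le> x" using neg by (meson not_less)
    then show "\<exists>b\<in>X. a \<noteq> b \<and> (a, b) \<in> ord_rel {..<\<kappa>}"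
      using b X by (intro bexI[of _ x]) (auto simp: ord_rel_def)
  qed
  then have "|X| =o ord_rel {..<\<kappa>}"
    using \<kappa> X unfolding regular_cardinal_def regularCard_def by simp
  then have "|X| =o |{..<\<kappa>}|"

    by (rule ordIso_transitive[OF _ ordIso_symmetric[OF card_of_ord_rel[OF \<kappa>]]])
  then show False using small not_ordLess_ordIso by blast
qed

lemma small_initial:
  fixes \<kappa> :: "'o::wellorder"
  assumes "regular_cardinal \<kappa>" "\<alpha> < \<kappa>"
  shows "|{..<\<alpha>}| <o |{..<\<kappa>}|"
proof -
  have "|{..<\<alpha>}| \<le>o ord_rel {..<\<alpha>}"
    using card_of_least[of "{..<\<alpha>}" "ord_rel {..<\<alpha>}"] Well_order_ord_rel[of "{..<\<alpha>}"] by simp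
  also have "ord_rel {..<\<alpha>} <o ord_rel {..<\<kappa>}" by (rule ord_rel_initial_less) fact
  also have "ord_rel {..<\<kappa>} =o |{..<\<kappa>}|" by (rule ordIso_symmetric[OF card_of_ord_rel]) fact
  finally show ?thesis .
qed

lemma small_subset: "|Y| <o r \<Longrightarrow> X \<subseteq> Y \<Longrightarrow> |X| <o r"
  by (rule ordLeq_ordLess_trans[OF card_of_mono1])

lemma small_image: "|X| <o r \<Longrightarrow> |f ` X| <o r"
  by (rule ordLeq_ordLess_trans[OF card_of_image])

lemma small_inj: "inj_on f X \<Longrightarrow> f ` X \<subseteq> Y \<Longrightarrow> |Y| <o r \<Longrightarrow> |X| <o r"
  by (rule ordLeq_ordLess_trans[OF card_of_ordLeqI]) auto

lemma small_finite: "regular_cardinal (\<kappa> :: 'o::wellorder) \<Longrightarrow> finite X \<Longrightarrow> |X| <o |{..<\<kappa>}|"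
  using regular_infinite[of \<kappa>]
  by (intro finite_ordLess_infinite) (auto simp: Field_card_of card_of_well_order_on)

lemma small_Un:
  "regular_cardinal (\<kappa> :: 'o::wellorder) \<Longrightarrow> |X| <o |{..<\<kappa>}| \<Longrightarrow> |Y| <o |{..<\<kappa>}| \<Longrightarrow>
     |X \<union> Y| <o |{..<\<kappa>}|"
  by (rule card_of_Un_ordLess_infinite) (auto simp: regular_infinite)

lemma small_UN:
  fixes \<kappa> :: "'o::wellorder"
  assumes \<kappa>: "regular_cardinal \<kappa>" and "|A| <o |{..<\<kappa>}|" "\<And>a. a \<in> A \<Longrightarrow> |F a| <o |{..<\<kappa>}|"
  shows "|\<Union>a\<in>A. F a| <o |{..<\<kappa>}|"
proof -
  have "stable (ord_rel {..<\<kappa>})"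
    using \<kappa> by (intro regularCard_stable) (auto simp: regular_cardinal_def cinfinite_def)
  then have "stable |{..<\<kappa>}|" by (rule stable_ordIso1[OF _ card_of_ord_rel[OF \<kappa>]])
  then show ?thesis using assms(2,3) by (rule stable_UNION)
qed

lemma small_Times:
  fixes \<kappa> :: "'o::wellorder"
  assumes "regular_cardinal \<kappa>" "|X| <o |{..<\<kappa>}|" "|Y| <o |{..<\<kappa>}|"
  shows "|X \<times> Y| <o |{..<\<kappa>}|"
proof -
  have "X \<times> Y = (\<Union>x\<in>X. Pair x ` Y)" by auto
  then show ?thesis using assms by (auto intro!: small_UN small_image)
qed

text \<open>A move lists a sequence of length below \<lambda>, so this is what allows any set of
  fewer than \<lambda> elements to be played in one move. The order type of the cardinal
  \<open>|X|\<close> serves as the length.\<close>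

lemma small_enum:
  fixes \<kappa> :: "'o::wellorder"
  assumes \<kappa>: "regular_cardinal \<kappa>" and "|X| <o |{..<\<kappa>}|"
  shows "\<exists>l<\<kappa>. \<exists>a\<in>{..<l} \<rightarrow>\<^sub>E X. a ` {..<l} = X"
proof -
  have "|X| <o ord_rel {..<\<kappa>}" 
    by (rule ordLess_ordIso_trans[OF assms(2) card_of_ord_rel[OF \<kappa>]])
  from ordLess_initial[OF this] obtain l where l: "l < \<kappa>" "|X| =o ord_rel {..<l}" by auto
  obtain g where "bij_betw g {..<l} (Field |X| )" by (rule ordIso_enum[OF l(2)])
  then have "bij_betw g {..<l} X" by (simp add: Field_card_of)
  then have "restrict g {..<l} \<in> {..<l} \<rightarrow>\<^sub>E X" "restrict g {..<l} ` {..<l} = X"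
    by (auto simp: bij_betw_def)
  then show ?thesis using l(1) by blast
qed

lemma small_atMost:
  fixes \<kappa> :: "'o::wellorder"
  assumes "regular_cardinal \<kappa>" "\<alpha> < \<kappa>"
  shows "|{..\<alpha>}| <o |{..<\<kappa>}|"
  using small_initial[OF assms(1) limit_ord_suc_less[OF regular_limit_ord[OF assms(1)] assms(2)]]
  by (rule small_subset) (use less_ord_suc[OF assms(2)] in auto)

lemma cf_cofinal:
  fixes \<delta> :: "'o::wellorder"
  obtains f where "f ` {..<cf \<delta>} \<subseteq> {..<\<delta>}" "\<And>\<alpha>. \<alpha> < \<delta> \<Longrightarrow> \<exists>\<beta><cf \<delta>. \<alpha> \<le> f \<beta>"
proof -
  \<comment> \<open>The identity on \<delta> is cofinal, so the \<open>LEAST\<close> in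
    \<open>cf\<close> ranges over a nonempty set.\<close>
  have "\<exists>f. f ` {..<\<delta>} \<subseteq> {..<\<delta>} \<and> (\<forall>\<alpha><\<delta>. \<exists>\<beta><\<delta>. \<alpha> \<le> f \<beta>)"
    by (rule exI[of _ id]) auto
  then have "\<exists>f. f ` {..<cf \<delta>} \<subseteq> {..<\<delta>} \<and> (\<forall>\<alpha><\<delta>. \<exists>\<beta><cf \<delta>. \<alpha> \<le> f \<beta>)"
    unfolding cf_def by (rule LeastI)
  then show thesis using that by blast
qed

text \<open>Cubs are handled through the closure points of functions: every cub contains the limit
  ordinals closed under a suitable function, and finitely many such functions amount to one.\<close>

definition closed_under :: "('o::wellorder \<Rightarrow> 'o) \<Rightarrow> 'o \<Rightarrow> bool" where
  "closed_under \<phi> \<delta> \<longleftrightarrow> limit_ord \<delta> \<and> (\<forall>\<beta><\<delta>. \<phi> \<beta> < \<delta>)"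

lemma closed_underD: "closed_under \<phi> \<delta> \<Longrightarrow> \<beta> < \<delta> \<Longrightarrow> \<phi> \<beta> < \<delta>"
  by (simp add: closed_under_def)

text \<open>\<open>\<phi>\<close> picks an element of \<open>C\<close> above \<beta>; a limit
  ordinal closed under \<open>\<phi>\<close> is then a limit of elements of
  \<open>C\<close>.\<close>

lemma cub_closed_under:
  fixes lam :: "'o::wellorder"
  assumes "cub lam C"
  obtains \<phi> where "\<And>\<beta>. \<beta> < lam \<Longrightarrow> \<phi> \<beta> < lam"
    "\<And>\<delta>. \<delta> < lam \<Longrightarrow> closed_under \<phi> \<delta> \<Longrightarrow> \<delta> \<in> C"
proof -
  have "\<forall>\<beta>. \<exists>\<gamma>. \<beta> < lam \<longrightarrow> \<gamma> \<in> C \<and> \<beta> < \<gamma>" using assms by (auto simp: cub_def)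
  then obtain \<phi> where \<phi>: "\<And>\<beta>. \<beta> < lam \<Longrightarrow> \<phi> \<beta> \<in> C \<and> \<beta> < \<phi> \<beta>" by metis
  show thesis
  proof (rule that[of \<phi>])
    fix \<beta> assume "\<beta> < lam" then show "\<phi> \<beta> < lam" using \<phi> assms by (auto simp: cub_def)
  next
    fix \<delta> assume "\<delta> < lam" "closed_under \<phi> \<delta>"
    then have "limit_ord \<delta>" and cl: "\<And>\<beta>. \<beta> < \<delta> \<Longrightarrow> \<phi> \<beta> < \<delta>"
      by (auto simp: closed_under_def)
    have "\<forall>\<alpha><\<delta>. \<exists>\<beta>\<in>C. \<alpha> < \<beta> \<and> \<beta> < \<delta>"
      using \<phi>[OF less_trans[OF _ \<open>\<delta> < lam\<close>]] cl by blast
    then show "\<delta> \<in> C" using assms \<open>\<delta> < lam\<close> \<open>limit_ord \<delta>\<close> by (simp add: cub_def)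
  qed
qed

lemma closed_under_max:
  "closed_under (\<lambda>\<beta>. max (\<phi> \<beta>) (\<psi> \<beta>)) \<delta> \<Longrightarrow> closed_under \<phi> \<delta> \<and> closed_under \<psi> \<delta>"
  by (auto simp: closed_under_def)

section \<open>Trees\<close>

definition tree_less :: "'a tree \<Rightarrow> 'a rel" where
  "tree_less T = {(x, y). x \<in> nodes T \<and> y \<in> nodes T \<and> lt T x y}"

definition succs :: "'a tree \<Rightarrow> 'a \<Rightarrow> 'a set" where
  "succs T x = {y \<in> nodes T. lt T x y \<and> \<not> (\<exists>z\<in>nodes T. lt T x z \<and> lt T z y)}"

lemma tree_irrefl: "is_tree T \<Longrightarrow> x \<in> nodes T \<Longrightarrow> \<not> lt T x x"
  by (simp add: is_tree_def)

lemma tree_trans: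
  "is_tree T \<Longrightarrow> x \<in> nodes T \<Longrightarrow> y \<in> nodes T \<Longrightarrow> z \<in> nodes T \<Longrightarrow> lt T x y \<Longrightarrow> lt T y z \<Longrightarrow> lt T x z"
  unfolding is_tree_def by blast

lemma tree_linear:
  assumes "is_tree T" "x \<in> nodes T" "y \<in> preds T x" "z \<in> preds T x"
  shows "y = z \<or> lt T y z \<or> lt T z y"
proof -
  have "well_order_on (preds T x) (tree_rel T (preds T x))"
    using assms by (simp add: is_tree_def)
  then have "total_on (preds T x) (tree_rel T (preds T x))"
    by (simp add: well_order_on_def linear_order_on_def)
  then show ?thesis using assms(3,4) by (auto simp: total_on_def tree_rel_def)
qed

text \<open>If an element of \<open>Q\<close> is not itself minimal, the well-order of its
  predecessors selects the least of those that lie in \<open>Q\<close>; by transitivity nothing of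
  \<open>Q\<close> lies below that one.\<close>

lemma wf_tree_less:
  assumes T: "is_tree T"
  shows "wf (tree_less T)"
proof (rule wfI_min)
  fix x and Q :: "'a set" assume x: "x \<in> Q"
  show "\<exists>z\<in>Q. \<forall>y. (y, z) \<in> tree_less T \<longrightarrow> y \<notin> Q"
  proof (cases "x \<in> nodes T \<and> Q \<inter> preds T x \<noteq> {}")
    case False
    then show ?thesis using x by (intro bexI[of _ x]) (auto simp: tree_less_def preds_def)
  next
    case True
    then have "wf (tree_rel T (preds T x) - Id)"
      using T by (simp add: is_tree_def well_order_on_def)
    then obtain z where z: "z \<in> Q \<inter> preds T x"
      and min: "\<And>y. (y, z) \<in> tree_rel T (preds T x) - Id \<Longrightarrow> y \<notin> Q \<inter> preds T x"
      using True wfE_min[of _ _ "Q \<inter> preds T x"] by (metis ex_in_conv)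
    have "y \<notin> Q" if "(y, z) \<in> tree_less T" for y
    proof -
      have y: "y \<in> nodes T" "z \<in> nodes T" "lt T y z" "lt T z x"
        using that z by (auto simp: tree_less_def preds_def)
      then have "y \<in> preds T x" "y \<noteq> z"
        using tree_trans[OF T y(1,2) conjunct1[OF True] y(3,4)] tree_irrefl[OF T y(2)]
        by (auto simp: preds_def)
      then show ?thesis using min[of y] z y(3) by (auto simp: tree_rel_def)
    qed
    then show ?thesis using z by blast
  qed
qed

lemma preds_succs:
  assumes T: "is_tree T" and x: "x \<in> nodes T" and y: "y \<in> succs T x"
  shows "preds T y = insert x (preds T x)"
proof -
  have y': "y \<in> nodes T" "lt T x y" "\<And>z. z \<in> nodes T \<Longrightarrow> lt T x z \<Longrightarrow> lt T z y \<Longrightarrow> False"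
    using y by (auto simp: succs_def)
  have "z = x \<or> lt T z x" if "z \<in> nodes T" "lt T z y" for z
    using tree_linear[OF T y'(1), of z x] that y' x by (auto simp: preds_def)
  then show ?thesis using y' x tree_trans[OF T _ x y'(1)] by (auto simp: preds_def)
qed

lemma succs_unique:
  assumes T: "is_tree T" and xs: "x \<in> nodes T" "x' \<in> nodes T" and y: "y \<in> succs T x" "y \<in> succs T x'"
  shows "x = x'"
  using tree_linear[OF T, of y x x'] xs y by (auto simp: preds_def succs_def)

lemma has_immediate_pred_iff:
  assumes "y \<in> nodes T"
  shows "has_immediate_pred T y \<longleftrightarrow> (\<exists>x\<in>nodes T. y \<in> succs T x)"
  using assms by (auto simp: has_immediate_pred_def succs_def preds_def)

text \<open>Cuts a node above \<open>X\<close> down to one directly above \<open>X\<close>. For a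
  minimal candidate \<open>w\<close>, a predecessor outside \<open>X\<close> would lie above all of
  \<open>X\<close>, because \<open>X\<close> is closed downwards, and would be a smaller
  candidate.\<close>

lemma least_node_above:
  assumes T: "is_tree T" and v: "v \<in> nodes T" and X: "X \<subseteq> preds T v"
    and down: "\<And>x. x \<in> X \<Longrightarrow> preds T x \<subseteq> X"
  shows "\<exists>w\<in>nodes T. (w = v \<or> lt T w v) \<and> preds T w = X"
proof -
  let ?Q = "{w \<in> nodes T. (w = v \<or> lt T w v) \<and> X \<subseteq> preds T w}"
  obtain w where w: "w \<in> ?Q" and min: "\<And>y. (y, w) \<in> tree_less T \<Longrightarrow> y \<notin> ?Q"
    using wfE_min[OF wf_tree_less[OF T], of v ?Q] v X by auto
  have "y \<in> X" if y: "y \<in> preds T w" for y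
  proof (rule ccontr)
    assume "y \<notin> X"
    have yn: "y \<in> nodes T" "lt T y w" using y by (auto simp: preds_def)
    have "X \<subseteq> preds T y"
    proof
      fix x assume x: "x \<in> X"
      then have "x = y \<or> lt T x y \<or> lt T y x"
        using w y by (intro tree_linear[OF T, of w]) auto
      then show "x \<in> preds T y"
        using x \<open>y \<notin> X\<close> down[OF x] yn X by (auto simp: preds_def)
    qed
    moreover have "lt T y v" using w yn v tree_trans[OF T, of y w v] by auto
    ultimately show False using min[of y] yn w by (auto simp: tree_less_def)
  qed
  then show ?thesis using w by blast
qed

lemma infinite_chain_sequence:
  assumes "W \<noteq> {}" "\<forall>w\<in>W. \<exists>w'\<in>W. lt T w w'"
  obtains w :: "nat \<Rightarrow> 'a" where "\<And>n. w n \<in> W" "\<And>n. lt T (w n) (w (Suc n))"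
proof -
  have "\<exists>w. \<forall>n. w n \<in> W \<and> lt T (w n) (w (Suc n))"
    by (rule dependent_nat_choice) (use assms in auto)
  then show thesis using that by blast
qed

section \<open>Large trees\<close>

text \<open>Opens the existential quantifier over \<open>E\<close> in \<open>large\<close> once, so
  that all later choices refer to the same level sets.\<close>

locale large_tree =
  fixes lam \<kappa> :: "'o::wellorder" and t :: "'t tree" and e :: "'o \<Rightarrow> 't" and E :: "'o \<Rightarrow> 't set"
  assumes lam: "regular_cardinal lam" and \<kappa>: "regular_cardinal \<kappa>" and \<kappa>_lam: "\<kappa> < lam"
    and tree: "is_tree t" and enum: "tree_enumeration lam t e"
    and E_zero: "E ord_zero \<noteq> {}"
    and E_nodes: "\<xi> \<le> \<kappa> \<Longrightarrow> E \<xi> \<subseteq> nodes t"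
    and E_disjoint: "\<xi> \<le> \<kappa> \<Longrightarrow> \<eta> \<le> \<kappa> \<Longrightarrow> \<xi> \<noteq> \<eta> \<Longrightarrow> E \<xi> \<inter> E \<eta> = {}"
    and E_below: "\<delta> \<le> \<kappa> \<Longrightarrow> \<xi> < \<delta> \<Longrightarrow> x \<in> E \<delta> \<Longrightarrow> \<exists>!y. y \<in> E \<xi> \<and> lt t y x"
    and E_limit: "\<delta> \<le> \<kappa> \<Longrightarrow> limit_ord \<delta> \<Longrightarrow> \<forall>\<xi><\<delta>. s \<xi> \<in> E \<xi> \<Longrightarrow> increasing_seq t \<delta> s \<Longrightarrow>
      \<exists>y\<in>E \<delta>. \<forall>\<xi><\<delta>. lt t (s \<xi>) y"
    and E_guess: "\<xi> < \<kappa> \<Longrightarrow> x \<in> E \<xi> \<Longrightarrow>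
      \<exists>\<Theta>. (\<forall>\<theta>\<in>\<Theta>. regular_cardinal \<theta> \<and> \<theta> < lam) \<and>
         (\<exists>C. cub lam C \<and> C \<subseteq> S_set lam t e (subtree_below t (E (ord_suc \<xi>)) x) \<union>
            {\<delta>. \<delta> < lam \<and> cf \<delta> < \<delta> \<and> cf \<delta> \<in> \<Theta>}) \<and>
         {\<delta>. \<delta> < lam \<and> cf \<delta> < \<delta> \<and> cf \<delta> \<in> \<Theta> \<and>
            \<delta> \<notin> S_set lam t e (subtree_below t (E (ord_suc \<xi>)) x)} \<in> I_ideal lam \<and>
         (\<forall>\<theta>\<in>\<Theta>. \<exists>y\<in>subtree_below t (E (ord_suc \<xi>)) x.
            tree_rel t {z \<in> nodes t. (z = x \<or> lt t x z) \<and> lt t z y} =o ord_rel {..<\<theta>})"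
    and E_bound: "\<gamma> = ord_suc \<beta> \<Longrightarrow> \<beta> < \<kappa> \<Longrightarrow> \<gamma> < \<kappa> \<Longrightarrow> ord_zero < \<delta> \<Longrightarrow> increasing_seq t \<delta> s \<Longrightarrow>
      s ord_zero \<in> E \<beta> \<Longrightarrow> \<forall>\<xi><\<delta>. \<exists>y\<in>E \<gamma>. lt t (s \<xi>) y \<Longrightarrow> \<exists>y\<in>E \<gamma>. \<forall>\<xi><\<delta>. lt t (s \<xi>) y"
begin

lemma \<kappa>_suc: "\<xi> < \<kappa> \<Longrightarrow> ord_suc \<xi> < \<kappa>"
  by (rule limit_ord_suc_less[OF regular_limit_ord[OF \<kappa>]])

lemma E_node: "x \<in> E \<xi> \<Longrightarrow> \<xi> \<le> \<kappa> \<Longrightarrow> x \<in> nodes t"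
  using E_nodes by blast

abbreviation small :: "'x set \<Rightarrow> bool" where
  "small X \<equiv> |X| <o |{..<lam}|"

definition node_index :: "'t \<Rightarrow> 'o" where
  "node_index = inv_into {..<lam} e"

lemma node_index:
  assumes "w \<in> nodes t"
  shows "e (node_index w) = w" "node_index w < lam"
proof -
  have "w \<in> e ` {..<lam}" using assms enum by (auto simp: tree_enumeration_def bij_betw_def)
  from f_inv_into_f[OF this] inv_into_into[OF this]
  show "e (node_index w) = w" "node_index w < lam"
    by (simp_all add: node_index_def)
qed

lemma node_index_e: "i < lam \<Longrightarrow> node_index (e i) = i"
  using enum by (simp add: node_index_def tree_enumeration_def bij_betw_def)

lemma node_index_less:
  "v \<in> nodes t \<Longrightarrow> w \<in> nodes t \<Longrightarrow> lt t v w \<Longrightarrow> node_index v < node_index w"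
  using enum node_index unfolding tree_enumeration_def by metis

text \<open>\<open>W\<close> is the set of nodes on which a play of length \<open>\<delta>\<close> or \<open>cf \<delta>\<close> continuing at \<open>x\<close> takes place,
  \<open>q w\<close> tells which part of \<open>\<delta>\<close> is dealt with at \<open>w\<close>, and the set \<open>G \<beta>\<close> lists the partial plays
  that have been foreseen at \<open>\<beta>\<close>.\<close>

definition guessed :: "'o \<Rightarrow> 't \<Rightarrow> ('o \<Rightarrow> ('t \<times> ('t \<Rightarrow> 'o)) set) \<Rightarrow> 'o \<Rightarrow> 't set \<Rightarrow> ('t \<Rightarrow> 'o) \<Rightarrow> 't \<Rightarrow> bool"
  where "guessed \<xi> x G \<delta> W q z \<longleftrightarrow> z \<in> E (ord_suc \<xi>) \<and> W \<noteq> {} \<and> W \<subseteq> {w \<in> nodes t. lt t x w \<and> lt t w z} \<and>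
    (\<forall>w\<in>W. \<forall>v\<in>nodes t. lt t x v \<and> lt t v w \<longrightarrow> v \<in> W) \<and> (\<forall>w\<in>W. \<exists>w'\<in>W. lt t w w') \<and>
    (\<forall>w\<in>W. q w < \<delta>) \<and> (\<forall>\<alpha><\<delta>. \<exists>w\<in>W. \<alpha> < q w) \<and>
    (\<forall>w\<in>W. \<exists>\<beta><\<delta>. \<exists>q'. (w, q') \<in> G \<beta> \<and> (\<forall>v\<in>W. v = w \<or> lt t v w \<longrightarrow> q' v = q v))"

text \<open>The case \<delta> \<in> S[t_x]. A branch of length \<delta> has a bound \<open>z\<close>
  in the next level set, and the label of a node is its index in the enumeration. The initial part
  up to \<open>w\<close> is then coded by \<open>w\<close> alone, and this code was listed at the
  stage \<open>node_index w\<close>, which is below \<delta>.\<close>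

lemma guessed_branch:
  assumes \<xi>: "\<xi> < \<kappa>" and x: "x \<in> E \<xi>"
    and S: "\<delta> \<in> S_set lam t e (subtree_below t (E (ord_suc \<xi>)) x)"
    and G: "\<And>\<beta>. (e \<beta>, node_index) \<in> G \<beta>"
  shows "\<exists>W z. guessed \<xi> x G \<delta> W node_index z"
proof -
  define tx where "tx = subtree_below t (E (ord_suc \<xi>)) x"
  have \<delta>: "\<delta> < lam" "limit_ord \<delta>" and "\<exists>B. B \<subseteq> {e i |i. i < \<delta> \<and> e i \<in> tx} \<and> tree_rel t B =o ord_rel {..<\<delta>}"
    using S by (auto simp: S_set_def tx_def branch_of_def pred_on.maxchain_def pred_on.chain_def)
  then obtain B where B: "B \<subseteq> {e i |i. i < \<delta> \<and> e i \<in> tx}" and iso: "tree_rel t B =o ord_rel {..<\<delta>}"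
    by blast
  have Btx: "b \<in> nodes t" "b = x \<or> lt t x b" "\<exists>z\<in>E (ord_suc \<xi>). lt t b z" "node_index b < \<delta>" if "b \<in> B" for b
    using B that \<delta> by (auto simp: tx_def subtree_below_def node_index_e)
  have xn: "x \<in> nodes t" using E_node[OF x] \<xi> by simp
  obtain g where g: "bij_betw g {..<\<delta>} (Field (tree_rel t B))"
    and gle: "\<forall>\<alpha><\<delta>. \<forall>\<beta><\<delta>. \<alpha> \<le> \<beta> \<longleftrightarrow> (g \<alpha>, g \<beta>) \<in> tree_rel t B"
    by (rule ordIso_enum[OF iso])
  have "Field (tree_rel t B) = B" by (auto simp: Field_def tree_rel_def)
  with g have gB: "g ` {..<\<delta>} = B" and ginj: "inj_on g {..<\<delta>}" by (auto simp: bij_betw_def)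
  have gl: "lt t (g \<alpha>) (g \<beta>)" if "\<alpha> < \<beta>" "\<beta> < \<delta>" for \<alpha> \<beta>
  proof -
    have "g \<alpha> \<noteq> g \<beta>" using that ginj by (auto dest: inj_onD)
    then show ?thesis using gle[rule_format, of \<alpha> \<beta>] that less_trans[OF that] by (auto simp: tree_rel_def)
  qed
  have gin: "g \<alpha> \<in> B" if "\<alpha> < \<delta>" for \<alpha> using gB that by auto
  have z0: "ord_zero < \<delta>" by (rule limit_ord_zero_less[OF \<delta>(2)])
  have x_less: "lt t x (g \<alpha>)" if "ord_zero < \<alpha>" "\<alpha> < \<delta>" for \<alpha>
    using Btx(2)[OF gin[OF z0]] gl[OF that] tree_trans[OF tree xn _ _ _ gl[OF that]]
      Btx(1)[OF gin[OF z0]] Btx(1)[OF gin[OF that(2)]] by auto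
  \<comment> \<open>\<open>E_bound\<close> speaks of sequences that begin in \<open>E \<xi>\<close>,
    so \<open>x\<close> replaces the first node of the branch. The bound obtained is above
    \<open>g ord_zero\<close> as well, because the next node of the branch is.\<close>
  define s where "s \<alpha> = (if \<alpha> = ord_zero then x else g \<alpha>)" for \<alpha> :: 'o
  have pos: "\<alpha> = ord_zero \<or> ord_zero < \<alpha>" for \<alpha> :: 'o using ord_zero_le[of \<alpha>] by (auto simp: less_le)
  have "increasing_seq t \<delta> s"
    unfolding increasing_seq_def s_def
    using xn Btx(1) gin x_less gl pos by (metis leD ord_zero_le)
  moreover have "\<forall>\<alpha><\<delta>. \<exists>y\<in>E (ord_suc \<xi>). lt t (s \<alpha>) y"
  proof (intro allI impI)
    fix \<alpha> assume a: "\<alpha> < \<delta>"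
    obtain y where y: "y \<in> E (ord_suc \<xi>)" "lt t (g ord_zero) y" using Btx(3)[OF gin[OF z0]] by auto
    have "lt t x y"
      using Btx(2)[OF gin[OF z0]] y tree_trans[OF tree xn Btx(1)[OF gin[OF z0]] _ _ y(2)]
        E_node[OF y(1)] \<kappa>_suc[OF \<xi>] by auto
    then show "\<exists>y\<in>E (ord_suc \<xi>). lt t (s \<alpha>) y"
      using y Btx(3)[OF gin[OF a]] by (auto simp: s_def)
  qed
  moreover have "s ord_zero \<in> E \<xi>" by (simp add: s_def x)
  ultimately obtain z where z: "z \<in> E (ord_suc \<xi>)" "\<forall>\<alpha><\<delta>. lt t (s \<alpha>) z"
    using E_bound[OF refl \<xi> \<kappa>_suc[OF \<xi>] z0] by blast
  have zn: "z \<in> nodes t" using E_node[OF z(1)] \<kappa>_suc[OF \<xi>] by simp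
  have suc: "\<alpha> < ord_suc \<alpha>" "ord_suc \<alpha> < \<delta>" "ord_zero < ord_suc \<alpha>" if "\<alpha> < \<delta>" for \<alpha>
    using that limit_ord_suc_less[OF \<delta>(2)] less_ord_suc[OF that] le_less_trans[OF ord_zero_le] by blast+
  have gz: "lt t (g \<alpha>) z" if "\<alpha> < \<delta>" for \<alpha>
  proof -
    have "lt t (g (ord_suc \<alpha>)) z" using z(2) suc[OF that] by (auto simp: s_def split: if_splits)
    then show ?thesis
      using tree_trans[OF tree _ _ zn gl[OF suc(1,2)[OF that]]] Btx(1) gin suc(2)[OF that] that by blast
  qed
  \<comment> \<open>The branch is filled up to a downward closed set above \<open>x\<close>; the
    added nodes have smaller indices than branch nodes above them, so all labels stay below
    \<delta>.\<close>
  define W where "W = {w \<in> nodes t. lt t x w \<and> (\<exists>\<alpha><\<delta>. w = g \<alpha> \<or> lt t w (g \<alpha>))}"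
  have gn: "g \<alpha> \<in> nodes t" if "\<alpha> < \<delta>" for \<alpha> using Btx(1) gin that by blast
  have gW: "g (ord_suc \<alpha>) \<in> W" if "\<alpha> < \<delta>" for \<alpha>
    using gn suc[OF that] x_less by (auto simp: W_def)
  \<comment> \<open>An increasing map of ordinals never falls below its argument; this makes the
    labels cofinal in \<delta>.\<close>
  have idx: "\<alpha> \<le> node_index (g \<alpha>)" if "\<alpha> < \<delta>" for \<alpha>
    using that
  proof (induction \<alpha> rule: less_induct)
    case (less \<alpha>)
    show ?case
    proof (rule ccontr)
      assume "\<not> ?case"
      then have *: "node_index (g \<alpha>) < \<alpha>" by simp
      then have b: "node_index (g \<alpha>) < \<delta>" using less.prems by simp
      have "node_index (g (node_index (g \<alpha>))) < node_index (g \<alpha>)"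
        using node_index_less[OF gn[OF b] gn[OF less.prems] gl[OF * less.prems]] .
      then show False using less.IH[OF * b] by simp
    qed
  qed
  have "guessed \<xi> x G \<delta> W node_index z"
    unfolding guessed_def
  proof (intro conjI)
    show "z \<in> E (ord_suc \<xi>)" by fact
    show "W \<noteq> {}" using gW[OF z0] by auto
    show "W \<subseteq> {w \<in> nodes t. lt t x w \<and> lt t w z}"
      using gz tree_trans[OF tree _ gn zn _ gz] by (auto simp: W_def)
    show "\<forall>w\<in>W. \<forall>v\<in>nodes t. lt t x v \<and> lt t v w \<longrightarrow> v \<in> W"
      using tree_trans[OF tree _ _ gn] unfolding W_def by blast
    show "\<forall>w\<in>W. \<exists>w'\<in>W. lt t w w'"
    proof
      fix w assume w: "w \<in> W"
      then obtain \<alpha> where a: "\<alpha> < \<delta>" "w = g \<alpha> \<or> lt t w (g \<alpha>)" "w \<in> nodes t" by (auto simp: W_def)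
      then have "lt t w (g (ord_suc \<alpha>))"
        using gl[OF suc(1,2)[OF a(1)]] tree_trans[OF tree a(3) gn[OF a(1)] gn[OF suc(2)[OF a(1)]]] by auto
      then show "\<exists>w'\<in>W. lt t w w'" using gW[OF a(1)] by blast
    qed
    show small_idx: "\<forall>w\<in>W. node_index w < \<delta>"
      using Btx(4)[OF gin] less_trans[OF node_index_less[OF _ gn] Btx(4)[OF gin]] by (auto simp: W_def)
    show "\<forall>\<alpha><\<delta>. \<exists>w\<in>W. \<alpha> < node_index w"
      using gW idx suc less_le_trans by blast
    show "\<forall>w\<in>W. \<exists>\<beta><\<delta>. \<exists>q'. (w, q') \<in> G \<beta> \<and> (\<forall>v\<in>W. v = w \<or> lt t v w \<longrightarrow> q' v = node_index v)"
    proof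
      fix w assume w: "w \<in> W"
      then have "e (node_index w) = w" using node_index(1) by (auto simp: W_def)
      then have "(w, node_index) \<in> G (node_index w)" using G[of "node_index w"] by simp
      then show "\<exists>\<beta><\<delta>. \<exists>q'. (w, q') \<in> G \<beta> \<and> (\<forall>v\<in>W. v = w \<or> lt t v w \<longrightarrow> q' v = node_index v)"
        using small_idx w by blast
    qed
  qed
  then show ?thesis by blast
qed

end

text \<open>The element of \<open>p\<close> with index \<open>j\<close>.  It is not changed if \<open>p\<close> is cut off above it, so it can be
  read off from the initial segments provided by \<open>I_ideal\<close>.\<close>

definition nth_elem :: "'o::wellorder set \<Rightarrow> 'o \<Rightarrow> 'o" where
  "nth_elem p j = (LEAST \<alpha>. \<alpha> \<in> p \<and> ord_rel (p \<inter> {..<\<alpha>}) =o ord_rel {..<j})"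

lemma ord_rel_image_initial:
  fixes j :: "'o::wellorder" and g :: "'o \<Rightarrow> 'o"
  assumes "\<And>\<alpha> \<beta>. \<alpha> < \<beta> \<Longrightarrow> \<beta> < j \<Longrightarrow> g \<alpha> < g \<beta>"
  shows "ord_rel (g ` {..<j}) =o ord_rel {..<j}"
proof -
  have "inj_on g {..<j}" using assms by (intro linorder_inj_onI) (auto simp: less_le)
  moreover have "\<alpha> \<le> \<beta> \<longleftrightarrow> g \<alpha> \<le> g \<beta>" if "\<alpha> < j" "\<beta> < j" for \<alpha> \<beta>
    using assms[of \<alpha> \<beta>] assms[of \<beta> \<alpha>] that by (cases \<alpha> \<beta> rule: linorder_cases) auto
  ultimately have "iso (ord_rel {..<j}) (ord_rel (g ` {..<j})) g"
    by (auto simp: iso_iff2 ord_rel_iff bij_betw_def)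
  then have "ord_rel {..<j} =o ord_rel (g ` {..<j})"
    using Well_order_ord_rel by (auto simp: ordIso_def)
  then show ?thesis by (rule ordIso_symmetric)
qed

text \<open>Below \<open>g i\<close> the set \<open>C\<close> has order type \<open>i\<close>, and
  this remains visible in every cut above \<open>g i\<close>; different \<open>i\<close> give
  different order types, so the description singles out \<open>g j\<close>.\<close>

lemma nth_elem_eq:
  fixes \<mu> \<alpha> :: "'o::wellorder"
  assumes C: "C = g ` {..<\<mu>}" and g: "\<And>i j. i < j \<Longrightarrow> j < \<mu> \<Longrightarrow> g i < g j"
    and j: "j < \<mu>" "g j < \<alpha>"
  shows "nth_elem (C \<inter> {..<\<alpha>}) j = g j"
proof -
  have init: "C \<inter> {..<\<alpha>} \<inter> {..<g i} = g ` {..<i}" if "i < \<mu>" "g i < \<alpha>" for i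
  proof -
    have "g k < g i \<longleftrightarrow> k < i" if "k < \<mu>" for k
      using g[of k i] g[of i k] \<open>i < \<mu>\<close> that by (cases k i rule: linorder_cases) auto
    then show ?thesis using that g[of _ i] by (fastforce simp: C)
  qed
  have iso: "ord_rel (g ` {..<i}) =o ord_rel {..<i}" if "i < \<mu>" for i
    using g that by (intro ord_rel_image_initial) auto
  show ?thesis
    unfolding nth_elem_def
  proof (rule Least_equality)
    show "g j \<in> C \<inter> {..<\<alpha>} \<and> ord_rel (C \<inter> {..<\<alpha>} \<inter> {..<g j}) =o ord_rel {..<j}"
      unfolding init[OF j] using iso[OF j(1)] j by (auto simp: C)
  next
    fix \<beta> assume \<beta>: "\<beta> \<in> C \<inter> {..<\<alpha>} \<and> ord_rel (C \<inter> {..<\<alpha>} \<inter> {..<\<beta>}) =o ord_rel {..<j}"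
    then obtain i where i: "i < \<mu>" "\<beta> = g i" "g i < \<alpha>" by (auto simp: C)
    have "ord_rel (g ` {..<i}) =o ord_rel {..<j}" using \<beta> init[OF i(1,3)] i(2) by simp
    then have "ord_rel {..<i} =o ord_rel {..<j}"
      by (rule ordIso_transitive[OF ordIso_symmetric[OF iso[OF i(1)]]])
    then have "i = j" by (rule ord_rel_initial_eq)
    then show "g j \<le> \<beta>" using i by simp
  qed
qed

lemma below_cf_bounded:
  fixes \<delta> :: "'o::wellorder"
  assumes "\<gamma> < cf \<delta>" "f ` {..<\<gamma>} \<subseteq> {..<\<delta>}"
  shows "\<exists>\<alpha><\<delta>. \<forall>\<beta><\<gamma>. f \<beta> < \<alpha>"
  using not_less_Least[OF assms(1)[unfolded cf_def]] assms(2) by (metis not_le)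

lemma ord_sup_cofinal:
  fixes \<delta> :: "'o::wellorder"
  assumes "ord_sup C = \<delta>" "\<alpha> < \<delta>"
  shows "\<exists>\<gamma>\<in>C. \<alpha> < \<gamma>"
proof (rule ccontr)
  assume "\<not> ?thesis"
  then have "ord_sup C \<le> \<alpha>" unfolding ord_sup_def by (intro Least_le) (auto simp: not_less)
  then show False using assms by simp
qed

section \<open>Foreseen plays at closure points\<close>

context large_tree
begin

text \<open>A fixed choice for every pair of ordinals. The codes of partial plays must not mention
  \<delta>, but they may mention \<mu> and \<theta>, and this recovers the cofinal map from these
  two.\<close>

definition cofinal_map :: "'o \<Rightarrow> 'o \<Rightarrow> 'o \<Rightarrow> 'o" where
  "cofinal_map \<mu> \<theta> = (SOME u. u ` {..<\<theta>} \<subseteq> {..<\<mu>} \<and> (\<forall>j<\<mu>. \<exists>i<\<theta>. j \<le> u i))"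

text \<open>The case cf \<delta> = \<theta>. The play runs along the segment of type \<theta> below
  \<open>y\<close>, and its \<open>i\<close>-th node is labelled by the element of \<open>C\<close>
  with index \<open>u i\<close>, where \<open>u\<close> is cofinal from \<theta> to the order type
  \<mu> of \<open>C\<close>. Fewer than cf \<delta> labels are bounded by some \<alpha> < \<delta>,
  so an initial part of the play can be read off from \<mu>, \<theta>, \<open>i\<close> and
  \<open>C \<inter> {..<\<alpha>}\<close>, all of which are available below \<delta>.\<close>

lemma guessed_cofinality:
  assumes \<xi>: "\<xi> < \<kappa>" and x: "x \<in> E \<xi>"
    and y: "y \<in> subtree_below t (E (ord_suc \<xi>)) x"
    and \<theta>: "regular_cardinal \<theta>" "cf \<delta> = \<theta>" "\<theta> < \<delta>" and \<delta>: "limit_ord \<delta>"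
    and \<iota>: "bij_betw \<iota> {..<\<theta>} {z \<in> nodes t. (z = x \<or> lt t x z) \<and> lt t z y}"
      "\<And>i j. i < j \<Longrightarrow> j < \<theta> \<Longrightarrow> lt t (\<iota> i) (\<iota> j)"
    and C: "C \<subseteq> {..<\<delta>}" "ord_rel C <o ord_rel {..<\<delta>}" "ord_sup C = \<delta>"
      "\<And>\<alpha>. \<alpha> < \<delta> \<Longrightarrow> \<exists>\<beta><\<delta>. C \<inter> {..<\<alpha>} \<in> P \<beta>"
    and G: "\<And>\<beta> \<mu> i p. \<mu> \<le> \<beta> \<Longrightarrow> \<theta> \<le> \<beta> \<Longrightarrow> i \<le> \<beta> \<Longrightarrow> p \<in> (\<Union>\<gamma>\<in>{..\<beta>}. P \<gamma>) \<Longrightarrow>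
        (\<iota> i, \<lambda>v. nth_elem p (cofinal_map \<mu> \<theta> (inv_into {..<\<theta>} \<iota> v))) \<in> G \<beta>"
  shows "\<exists>W q z. guessed \<xi> x G \<delta> W q z"
proof -
  obtain \<mu> where \<mu>: "\<mu> < \<delta>" "ord_rel C =o ord_rel {..<\<mu>}" using ordLess_initial[OF C(2)] by auto
  obtain g where "bij_betw g {..<\<mu>} (Field (ord_rel C))"
    and gle: "\<forall>\<alpha><\<mu>. \<forall>\<beta><\<mu>. \<alpha> \<le> \<beta> \<longleftrightarrow> (g \<alpha>, g \<beta>) \<in> ord_rel C"
    by (rule ordIso_enum[OF \<mu>(2)])
  then have gC: "C = g ` {..<\<mu>}" and ginj: "inj_on g {..<\<mu>}" by (auto simp: bij_betw_def)
  have gl: "g i < g j" if "i < j" "j < \<mu>" for i j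
    using gle[rule_format, of i j] inj_onD[OF ginj, of i j] that less_trans[OF that]
    by (auto simp: ord_rel_iff less_le)
  have gd: "g j < \<delta>" if "j < \<mu>" for j using C(1) gC that by auto
  define u where "u = cofinal_map \<mu> \<theta>"
  \<comment> \<open>A cofinal map from \<theta> to \<delta> is pushed into \<open>C\<close>: the
    index \<open>u i\<close> is chosen so that \<open>g (u i)\<close> is at least its value.\<close>
  have "\<exists>u. u ` {..<\<theta>} \<subseteq> {..<\<mu>} \<and> (\<forall>j<\<mu>. \<exists>i<\<theta>. j \<le> u i)"
  proof -
    obtain f where f: "f ` {..<\<theta>} \<subseteq> {..<\<delta>}" "\<And>\<alpha>. \<alpha> < \<delta> \<Longrightarrow> \<exists>\<beta><\<theta>. \<alpha> \<le> f \<beta>"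
      using cf_cofinal[of \<delta>] \<theta>(2) by auto
    have "\<forall>i. \<exists>j. i < \<theta> \<longrightarrow> j < \<mu> \<and> f i \<le> g j"
      using ord_sup_cofinal[OF C(3)] f(1) gC by (fastforce simp: image_subset_iff)
    then obtain u where u: "\<And>i. i < \<theta> \<Longrightarrow> u i < \<mu> \<and> f i \<le> g (u i)" by metis
    have "\<exists>i<\<theta>. j \<le> u i" if "j < \<mu>" for j
    proof -
      obtain i where i: "i < \<theta>" "g j \<le> f i" using f(2)[OF gd[OF \<open>j < \<mu>\<close>]] by auto
      then have "g j \<le> g (u i)" using u by force
      then have "\<not> u i < j" using gl[of "u i" j] \<open>j < \<mu>\<close> by auto
      then show ?thesis using i by auto
    qed
    then show ?thesis using u by (intro exI[of _ u]) auto
  qed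
  then have "u ` {..<\<theta>} \<subseteq> {..<\<mu>} \<and> (\<forall>j<\<mu>. \<exists>i<\<theta>. j \<le> u i)"
    unfolding u_def cofinal_map_def by (rule someI_ex)
  then have u: "\<And>i. i < \<theta> \<Longrightarrow> u i < \<mu>" "\<And>j. j < \<mu> \<Longrightarrow> \<exists>i<\<theta>. j \<le> u i" by auto
  define q where "q v = g (u (inv_into {..<\<theta>} \<iota> v))" for v
  have inv: "inv_into {..<\<theta>} \<iota> (\<iota> i) = i" if "i < \<theta>" for i
    using \<iota>(1) that by (auto simp: bij_betw_def)
  have q\<iota>: "q (\<iota> i) = g (u i)" if "i < \<theta>" for i using inv[OF that] by (simp add: q_def)
  have xn: "x \<in> nodes t" using E_node[OF x] \<xi> by simp
  obtain z where z: "z \<in> E (ord_suc \<xi>)" "lt t y z" "y \<in> nodes t" using y by (auto simp: subtree_below_def)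
  have zn: "z \<in> nodes t" using E_node[OF z(1)] \<kappa>_suc[OF \<xi>] by simp
  have \<iota>in: "\<iota> i \<in> nodes t" "\<iota> i = x \<or> lt t x (\<iota> i)" "lt t (\<iota> i) y" if "i < \<theta>" for i
    using \<iota>(1) that by (auto simp: bij_betw_def)
  define W where "W = {w \<in> nodes t. lt t x w \<and> lt t w y}"
  have W\<iota>: "\<exists>i<\<theta>. w = \<iota> i" if "w \<in> W" for w
    using \<iota>(1) that by (auto simp: bij_betw_def W_def)
  have \<iota>W: "\<iota> j \<in> W" if "i < j" "j < \<theta>" for i j
  proof -
    have "i < \<theta>" using that by simp
    then have "lt t x (\<iota> j)"
      using \<iota>in(1,2)[of i] \<iota>in(1)[of j] \<iota>(2)[OF that] that tree_trans[OF tree xn, of "\<iota> i" "\<iota> j"]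
      by metis
    then show ?thesis using \<iota>in[OF that(2)] by (simp add: W_def)
  qed
  have \<theta>suc: "ord_suc i < \<theta>" "i < ord_suc i" if "i < \<theta>" for i
    using that limit_ord_suc_less[OF regular_limit_ord[OF \<theta>(1)]] less_ord_suc by auto
  have \<theta>0: "ord_zero < \<theta>" by (rule limit_ord_zero_less[OF regular_limit_ord[OF \<theta>(1)]])
  have xy: "lt t x y" using \<iota>in[OF \<theta>0] tree_trans[OF tree xn _ z(3), of "\<iota> ord_zero"] by auto
  then obtain i0 where i0: "i0 < \<theta>" "\<iota> i0 = x"
    using bij_betw_imp_surj_on[OF \<iota>(1)] xn by (blast dest: equalityD2)
  have "guessed \<xi> x G \<delta> W q z"
    unfolding guessed_def
  proof (intro conjI)
    show "z \<in> E (ord_suc \<xi>)" by fact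
    show "W \<noteq> {}" using \<iota>W[OF \<theta>suc(2,1)[OF \<theta>0]] by auto
    show "W \<subseteq> {w \<in> nodes t. lt t x w \<and> lt t w z}"
      using tree_trans[OF tree _ z(3) zn _ z(2)] by (auto simp: W_def)
    show "\<forall>w\<in>W. \<forall>v\<in>nodes t. lt t x v \<and> lt t v w \<longrightarrow> v \<in> W"
      using tree_trans[OF tree _ _ z(3)] by (auto simp: W_def)
    show "\<forall>w\<in>W. \<exists>w'\<in>W. lt t w w'"
      using W\<iota> \<iota>W \<theta>suc \<iota>(2) by metis
    show qd: "\<forall>w\<in>W. q w < \<delta>" using W\<iota> q\<iota> gd u(1) by metis
    show "\<forall>\<alpha><\<delta>. \<exists>w\<in>W. \<alpha> < q w"
    proof (intro allI impI)
      fix \<alpha> assume a: "\<alpha> < \<delta>"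
      \<comment> \<open>The node \<open>x\<close> belongs to the segment but not to
        \<open>W\<close>. Asking for a label above \<open>q x\<close> as well ensures that the node
        found is not \<open>x\<close>.\<close>
      have "max \<alpha> (q x) < \<delta>" using a gd[OF u(1)[OF i0(1)]] q\<iota>[OF i0(1)] i0(2) by simp
      then obtain j where j: "j < \<mu>" "\<alpha> < g j" "q x < g j"
        using ord_sup_cofinal[OF C(3)] gC by fastforce
      obtain i where i: "i < \<theta>" "j \<le> u i" using u(2)[OF j(1)] by auto
      have "g j \<le> g (u i)" using gl[of j "u i"] i u(1)[OF i(1)] by (cases "j = u i") (auto simp: less_le)
      then have qi: "\<alpha> < q (\<iota> i)" "q x < q (\<iota> i)" using q\<iota>[OF i(1)] j by auto
      then have "\<iota> i \<in> W" using \<iota>in[OF i(1)] by (auto simp: W_def)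
      then show "\<exists>w\<in>W. \<alpha> < q w" using qi by blast
    qed
    show "\<forall>w\<in>W. \<exists>\<beta><\<delta>. \<exists>q'. (w, q') \<in> G \<beta> \<and> (\<forall>v\<in>W. v = w \<or> lt t v w \<longrightarrow> q' v = q v)"
    proof
      fix w assume w: "w \<in> W"
      then obtain i where i: "i < \<theta>" "w = \<iota> i" using W\<iota> by auto
      \<comment> \<open>The successor of \<open>i\<close> is used so that the label of
        \<open>w\<close> itself is bounded by \<alpha> too.\<close>
      have "(\<lambda>k. q (\<iota> k)) ` {..<ord_suc i} \<subseteq> {..<\<delta>}"
        using q\<iota> gd u(1) less_trans[OF _ \<theta>suc(1)[OF i(1)]] by auto
      then obtain \<alpha> where a: "\<alpha> < \<delta>" "\<And>k. k < ord_suc i \<Longrightarrow> q (\<iota> k) < \<alpha>"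
        using below_cf_bounded[of "ord_suc i" \<delta> "\<lambda>k. q (\<iota> k)"] \<theta>suc(1)[OF i(1)] \<theta>(2) by blast
      obtain \<beta>' where b': "\<beta>' < \<delta>" "C \<inter> {..<\<alpha>} \<in> P \<beta>'" using C(4)[OF a(1)] by auto
      define \<beta> where "\<beta> = max (max \<mu> \<theta>) (max i \<beta>')"
      have "\<beta> < \<delta>" using \<mu> \<theta> i b' by (auto simp: \<beta>_def)
      have "(w, \<lambda>v. nth_elem (C \<inter> {..<\<alpha>}) (cofinal_map \<mu> \<theta> (inv_into {..<\<theta>} \<iota> v))) \<in> G \<beta>"
        unfolding i(2) using b' by (intro G) (auto simp: \<beta>_def le_max_iff_disj intro: bexI[of _ \<beta>'])
      moreover have "nth_elem (C \<inter> {..<\<alpha>}) (cofinal_map \<mu> \<theta> (inv_into {..<\<theta>} \<iota> v)) = q v"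
        if v: "v \<in> W" "v = w \<or> lt t v w" for v
      proof -
        obtain k where k: "k < \<theta>" "v = \<iota> k" using W\<iota> v by auto
        have "k \<le> i"
        proof (rule ccontr)
          assume "\<not> k \<le> i"
          then have "lt t w v" using \<iota>(2)[of i k] k i by auto
          then show False using v(2) tree_trans[OF tree \<iota>in(1)[OF i(1)] \<iota>in(1)[OF k(1)] \<iota>in(1)[OF i(1)]]
            tree_irrefl[OF tree \<iota>in(1)[OF i(1)]] i k by auto
        qed
        then have "q v < \<alpha>" using a(2) k le_less_trans[OF _ \<theta>suc(2)[OF i(1)]] by auto
        then have "nth_elem (C \<inter> {..<\<alpha>}) (u k) = g (u k)"
          using q\<iota>[OF k(1)] k by (intro nth_elem_eq[OF gC gl u(1)]) auto
        then show ?thesis using inv[OF k(1)] k q\<iota>[OF k(1)] by (simp add: u_def)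
      qed
      ultimately show "\<exists>\<beta><\<delta>. \<exists>q'. (w, q') \<in> G \<beta> \<and> (\<forall>v\<in>W. v = w \<or> lt t v w \<longrightarrow> q' v = q v)"
        using \<open>\<beta> < \<delta>\<close> by blast
    qed
  qed
  then show ?thesis by blast
qed

text \<open>Each closure point lies in both cubs, the one from the covering condition and the one
  attached to the set in \<open>I_ideal\<close>, so one of the two cases applies to it. The lists
  stay smaller than \<lambda> because their parameters do not exceed \<beta> and \<lambda> is
  regular.\<close>

lemma guess:
  assumes \<xi>: "\<xi> < \<kappa>" and x: "x \<in> E \<xi>"
  obtains G \<phi> where "\<And>\<beta>. \<beta> < lam \<Longrightarrow> small (G \<beta>)" "\<And>\<beta>. \<beta> < lam \<Longrightarrow> \<phi> \<beta> < lam"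
    "\<And>\<delta>. \<delta> < lam \<Longrightarrow> closed_under \<phi> \<delta> \<Longrightarrow> \<exists>W q z. guessed \<xi> x G \<delta> W q z"
proof -
  define tx where "tx = subtree_below t (E (ord_suc \<xi>)) x"
  define seg where "seg y = {z \<in> nodes t. (z = x \<or> lt t x z) \<and> lt t z y}" for y
  obtain \<Theta> C where \<Theta>: "\<forall>\<theta>\<in>\<Theta>. regular_cardinal \<theta> \<and> \<theta> < lam"
    and C: "cub lam C" "C \<subseteq> S_set lam t e tx \<union> {\<delta>. \<delta> < lam \<and> cf \<delta> < \<delta> \<and> cf \<delta> \<in> \<Theta>}"
    and I: "{\<delta>. \<delta> < lam \<and> cf \<delta> < \<delta> \<and> cf \<delta> \<in> \<Theta> \<and> \<delta> \<notin> S_set lam t e tx} \<in> I_ideal lam"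
    and y: "\<forall>\<theta>\<in>\<Theta>. \<exists>y\<in>tx. tree_rel t (seg y) =o ord_rel {..<\<theta>}"
    using E_guess[OF \<xi> x] unfolding tx_def seg_def by blast
  obtain D P where D: "cub lam D" and P: "\<forall>\<alpha><lam. P \<alpha> \<subseteq> Pow {..<\<alpha>} \<and> small (P \<alpha>)"
    and guess: "\<forall>\<delta>\<in>{\<delta>. \<delta> < lam \<and> cf \<delta> < \<delta> \<and> cf \<delta> \<in> \<Theta> \<and> \<delta> \<notin> S_set lam t e tx} \<inter> D.
        limit_ord \<delta> \<and> cf \<delta> < \<delta> \<longrightarrow>
        (\<exists>C\<subseteq>{..<\<delta>}. ord_rel C <o ord_rel {..<\<delta>} \<and> ord_sup C = \<delta> \<and>
           (\<forall>\<alpha><\<delta>. C \<inter> {..<\<alpha>} \<in> (\<Union>\<beta>\<in>{..<\<delta>}. P \<beta>)))"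
    using I unfolding I_ideal_def by auto
  obtain \<phi>C where \<phi>C: "\<And>\<beta>. \<beta> < lam \<Longrightarrow> \<phi>C \<beta> < lam"
    "\<And>\<delta>. \<delta> < lam \<Longrightarrow> closed_under \<phi>C \<delta> \<Longrightarrow> \<delta> \<in> C" using cub_closed_under[OF C(1)] by metis
  obtain \<phi>D where \<phi>D: "\<And>\<beta>. \<beta> < lam \<Longrightarrow> \<phi>D \<beta> < lam"
    "\<And>\<delta>. \<delta> < lam \<Longrightarrow> closed_under \<phi>D \<delta> \<Longrightarrow> \<delta> \<in> D" using cub_closed_under[OF D] by metis
  have "\<exists>y \<iota>. y \<in> tx \<and> bij_betw \<iota> {..<\<theta>} (seg y) \<and> (\<forall>i j. i < j \<and> j < \<theta> \<longrightarrow> lt t (\<iota> i) (\<iota> j))"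
    if "\<theta> \<in> \<Theta>" for \<theta>
  proof -
    obtain y where y: "y \<in> tx" "tree_rel t (seg y) =o ord_rel {..<\<theta>}" using y \<open>\<theta> \<in> \<Theta>\<close> by blast
    obtain \<iota> where bij: "bij_betw \<iota> {..<\<theta>} (Field (tree_rel t (seg y)))"
      and le: "\<forall>\<alpha><\<theta>. \<forall>\<beta><\<theta>. \<alpha> \<le> \<beta> \<longleftrightarrow> (\<iota> \<alpha>, \<iota> \<beta>) \<in> tree_rel t (seg y)"
      by (rule ordIso_enum[OF y(2)])
    have "Field (tree_rel t (seg y)) = seg y" by (auto simp: Field_def tree_rel_def)
    with bij have bij: "bij_betw \<iota> {..<\<theta>} (seg y)" by simp
    have "lt t (\<iota> i) (\<iota> j)" if "i < j" "j < \<theta>" for i j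
      using le[rule_format, of i j] inj_onD[OF bij_betw_imp_inj_on[OF bij], of i j] that less_trans[OF that]
      by (auto simp: tree_rel_def)
    then show ?thesis using y(1) bij by blast
  qed
  then have "\<forall>\<theta>. \<exists>y \<iota>. \<theta> \<in> \<Theta> \<longrightarrow> y \<in> tx \<and> bij_betw \<iota> {..<\<theta>} (seg y) \<and> (\<forall>i j. i < j \<and> j < \<theta> \<longrightarrow> lt t (\<iota> i) (\<iota> j))"
    by blast
  then obtain y \<iota> where \<iota>: "\<And>\<theta>. \<theta> \<in> \<Theta> \<Longrightarrow> y \<theta> \<in> tx \<and> bij_betw (\<iota> \<theta>) {..<\<theta>} (seg (y \<theta>)) \<and>
      (\<forall>i j. i < j \<and> j < \<theta> \<longrightarrow> lt t (\<iota> \<theta> i) (\<iota> \<theta> j))"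
    by metis
  define code where "code = (\<lambda>(\<mu>, \<theta>, i, p).
    (\<iota> \<theta> i, \<lambda>v. nth_elem p (cofinal_map \<mu> \<theta> (inv_into {..<\<theta>} (\<iota> \<theta>) v))))"
  \<comment> \<open>Both kinds of codes are listed, since the list at \<beta> cannot depend on which
    of the two cases a later \<delta> falls under.\<close>
  define G where "G \<beta> = insert (e \<beta>, node_index)
    (code ` ({..\<beta>} \<times> {..\<beta>} \<times> {..\<beta>} \<times> (\<Union>\<gamma>\<in>{..\<beta>}. P \<gamma>)))" for \<beta>
  show thesis
  proof (rule that[of G "\<lambda>\<beta>. max (\<phi>C \<beta>) (\<phi>D \<beta>)"])
    fix \<beta> assume b: "\<beta> < lam"
    show "max (\<phi>C \<beta>) (\<phi>D \<beta>) < lam" using \<phi>C \<phi>D b by simp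
    have s: "small {..\<beta>}" by (rule small_atMost[OF lam b])
    have "small (\<Union>\<gamma>\<in>{..\<beta>}. P \<gamma>)"
      by (rule small_UN[OF lam s]) (use P b in auto)
    then have "small (code ` ({..\<beta>} \<times> {..\<beta>} \<times> {..\<beta>} \<times> (\<Union>\<gamma>\<in>{..\<beta>}. P \<gamma>)))"
      by (intro small_image small_Times[OF lam] s)
    then show "small (G \<beta>)"
      unfolding G_def using small_Un[OF lam small_finite[OF lam, of "{(e \<beta>, node_index)}"]] by simp
  next
    fix \<delta> assume \<delta>: "\<delta> < lam" "closed_under (\<lambda>\<beta>. max (\<phi>C \<beta>) (\<phi>D \<beta>)) \<delta>"
    then have cl: "\<delta> \<in> C" "\<delta> \<in> D" "limit_ord \<delta>"
      using closed_under_max[OF \<delta>(2)] \<phi>C(2) \<phi>D(2) by (auto simp: closed_under_def)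
    show "\<exists>W q z. guessed \<xi> x G \<delta> W q z"
    proof (cases "\<delta> \<in> S_set lam t e tx")
      case True
      have "\<exists>W z. guessed \<xi> x G \<delta> W node_index z"
        by (rule guessed_branch[OF \<xi> x]) (use True in \<open>auto simp: tx_def G_def\<close>)
      then show ?thesis by blast
    next
      case False
      then have cf: "cf \<delta> < \<delta>" "cf \<delta> \<in> \<Theta>" using cl(1) C(2) by auto
      have "\<exists>C\<subseteq>{..<\<delta>}. ord_rel C <o ord_rel {..<\<delta>} \<and> ord_sup C = \<delta> \<and>
           (\<forall>\<alpha><\<delta>. C \<inter> {..<\<alpha>} \<in> (\<Union>\<beta>\<in>{..<\<delta>}. P \<beta>))"
        using guess[rule_format, of \<delta>] cl(2,3) cf \<delta>(1) False by simp
      then obtain C' where C': "C' \<subseteq> {..<\<delta>}" "ord_rel C' <o ord_rel {..<\<delta>}" "ord_sup C' = \<delta>"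
          "\<forall>\<alpha><\<delta>. C' \<inter> {..<\<alpha>} \<in> (\<Union>\<beta>\<in>{..<\<delta>}. P \<beta>)" by blast
      show ?thesis
      proof (rule guessed_cofinality[OF \<xi> x, of "y (cf \<delta>)" "cf \<delta>" \<delta> "\<iota> (cf \<delta>)" C' P])
        show "(\<iota> (cf \<delta>) i, \<lambda>v. nth_elem p (cofinal_map \<mu> (cf \<delta>) (inv_into {..<cf \<delta>} (\<iota> (cf \<delta>)) v))) \<in> G \<beta>"
          if "\<mu> \<le> \<beta>" "cf \<delta> \<le> \<beta>" "i \<le> \<beta>" "p \<in> (\<Union>\<gamma>\<in>{..\<beta>}. P \<gamma>)" for \<beta> \<mu> i p
          unfolding G_def code_def using that
          by (intro insertI2 image_eqI[of _ _ "(\<mu>, cf \<delta>, i, p)"]) auto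
      qed (use \<Theta> cf cl C' \<iota>[OF cf(2)] in \<open>auto simp: tx_def seg_def\<close>)
    qed
  qed
qed

end

section \<open>Recursion, and the Schroeder-Bernstein construction inside a relation\<close>

lemma wf_recursion_exists:
  assumes "wf R" and "\<And>f g x. (\<And>y. (y, x) \<in> R \<Longrightarrow> f y = g y) \<Longrightarrow> H f x = H g x"
  shows "\<exists>f. \<forall>x. f x = H f x"
proof -
  have "adm_wf R H" unfolding adm_wf_def using assms(2) by blast
  from wfrec_fixpoint[OF assms(1) this] show ?thesis by metis
qed

text \<open>The bijection agrees with \<open>F\<close> on the fixed point \<open>X\<close> and with
  the inverse of \<open>G\<close> elsewhere. Each of its pairs is therefore a pair of
  \<open>F\<close> or of \<open>G\<close>, which keeps it inside \<open>R\<close>.\<close>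

lemma relational_Schroeder_Bernstein:
  assumes F: "inj_on F C" "F ` C \<subseteq> D" "\<And>c. c \<in> C \<Longrightarrow> R c (F c)"
    and G: "inj_on G D" "G ` D \<subseteq> C" "\<And>d. d \<in> D \<Longrightarrow> R (G d) d"
  shows "\<exists>b. bij_betw b C D \<and> (\<forall>c\<in>C. R c (b c))"
proof -
  define X where "X = lfp (\<lambda>X. C - G ` (D - F ` X))"
  have "mono (\<lambda>X. C - G ` (D - F ` X))" by (intro monoI) blast
  then have X: "X = C - G ` (D - F ` X)" unfolding X_def by (rule lfp_unfold)
  define b where "b c = (if c \<in> X then F c else inv_into D G c)" for c
  have G': "c \<in> X \<or> (\<exists>d\<in>D - F ` X. c = G d)" if "c \<in> C" for c using X that by blast
  have inv: "inv_into D G (G d) = d" if "d \<in> D" for d using G(1) that by simp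
  have nX: "G d \<notin> X" if "d \<in> D - F ` X" for d using X that by blast
  have XC: "X \<subseteq> C" using X by blast
  have bX: "b c = F c" if "c \<in> X" for c using that by (simp add: b_def)
  have bG: "b (G d) = d" if "d \<in> D - F ` X" for d
    using nX[OF that] inv[of d] that by (simp add: b_def)
  have "inj_on b C"
  proof (rule inj_onI)
    fix c c' assume c: "c \<in> C" "c' \<in> C" "b c = b c'"
    consider "c \<in> X" "c' \<in> X" | d where "c \<in> X" "d \<in> D - F ` X" "c' = G d"
      | d where "c' \<in> X" "d \<in> D - F ` X" "c = G d"
      | d d' where "d \<in> D - F ` X" "c = G d" "d' \<in> D - F ` X" "c' = G d'"
      using G'[OF c(1)] G'[OF c(2)] by blast
    then show "c = c'"
    proof cases
      case 1
      then show ?thesis using inj_onD[OF F(1) _ c(1,2)] c(3) bX by simp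
    next
      case (2 d)
      then show ?thesis using c(3) bX[of c] bG[of d] by auto
    next
      case (3 d)
      then show ?thesis using c(3) bX[of c'] bG[of d] by auto
    next
      case (4 d d')
      then show ?thesis using c(3) bG[of d] bG[of d'] by auto
    qed
  qed
  moreover have "b ` C = D"
  proof
    show "b ` C \<subseteq> D"
    proof
      fix d assume "d \<in> b ` C"
      then obtain c where c: "c \<in> C" "d = b c" by blast
      from G'[OF c(1)] show "d \<in> D"
        using c bX[of c] bG F(2) by auto
    qed
    show "D \<subseteq> b ` C"
    proof
      fix d assume d: "d \<in> D"
      show "d \<in> b ` C"
      proof (cases "d \<in> F ` X")
        case True
        then show ?thesis using XC bX by (metis (no_types, lifting) imageE image_eqI subsetD)
      next
        case False
        then have "b (G d) = d" using bG[of d] d by simp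
        then show ?thesis using d G(2) by (metis image_eqI image_subset_iff)
      qed
    qed
  qed
  moreover have "R c (b c)" if "c \<in> C" for c
    using G'[OF that] F(3)[OF that] G(3) bX[of c] bG by auto
  ultimately show ?thesis by (auto simp: bij_betw_def)
qed

section \<open>Closure points and countable chains\<close>

context large_tree
begin

lemma bounded: "X \<subseteq> {..<lam} \<Longrightarrow> small X \<Longrightarrow> \<exists>\<beta><lam. \<forall>x\<in>X. x < \<beta>"
  by (rule regular_bounded[OF lam])

text \<open>Since \<kappa> is infinite and below the regular \<lambda>, countable subsets of
  \<lambda> are bounded. The least strict upper bound of an increasing sequence is a limit.\<close>

lemma omega_sup:
  fixes \<gamma> :: "nat \<Rightarrow> 'o"
  assumes mono: "\<And>n. \<gamma> n < \<gamma> (Suc n)" and less: "\<And>n. \<gamma> n < lam"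
  shows "\<exists>\<sigma><lam. limit_ord \<sigma> \<and> (\<forall>n. \<gamma> n < \<sigma>) \<and> (\<forall>\<alpha><\<sigma>. \<exists>n. \<alpha> < \<gamma> n)"
proof -
  have "|UNIV :: nat set| \<le>o |{..<\<kappa>}|"
    using regular_infinite[OF \<kappa>] by (simp add: infinite_iff_card_of_nat)
  from ordLeq_ordLess_trans[OF this small_initial[OF lam \<kappa>_lam]]
  have "small (range \<gamma>)" by (rule small_image)
  then obtain \<beta> where \<beta>: "\<beta> < lam" "\<And>n. \<gamma> n < \<beta>" using bounded[of "range \<gamma>"] less by auto
  define \<sigma> where "\<sigma> = (LEAST \<sigma>. \<forall>n. \<gamma> n < \<sigma>)"
  have gs: "\<gamma> n < \<sigma>" for n
    using LeastI[of "\<lambda>\<sigma>. \<forall>n. \<gamma> n < \<sigma>", of \<beta>] \<beta>(2) by (simp add: \<sigma>_def)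
  have "\<sigma> \<le> \<beta>" unfolding \<sigma>_def using \<beta>(2) by (intro Least_le) simp
  moreover have below: "\<exists>n. \<alpha> < \<gamma> n" if "\<alpha> < \<sigma>" for \<alpha>
  proof -
    have "\<not> (\<forall>n. \<gamma> n < \<alpha>)" using not_less_Least[of \<alpha> "\<lambda>\<sigma>. \<forall>n. \<gamma> n < \<sigma>"] that by (simp add: \<sigma>_def)
    then show ?thesis using mono le_less_trans by (metis not_less)
  qed
  moreover have "limit_ord \<sigma>" unfolding limit_ord_def using gs below by blast
  ultimately show ?thesis using gs \<beta>(1) by (intro exI[of _ \<sigma>]) auto
qed

lemma closed_under_step:
  assumes "\<And>\<beta>. \<beta> < lam \<Longrightarrow> \<phi> \<beta> < lam" "\<gamma> < lam" "X \<subseteq> {..<lam}" "small X"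
  shows "\<exists>\<gamma>'<lam. \<gamma> < \<gamma>' \<and> (\<forall>\<beta>\<le>\<gamma>. \<phi> \<beta> < \<gamma>') \<and> (\<forall>\<beta>\<in>X. \<beta> < \<gamma>')"
proof -
  have "small (insert \<gamma> (\<phi> ` {..\<gamma>} \<union> X))"
    using small_Un[OF lam small_finite[OF lam, of "{\<gamma>}"] small_Un[OF lam small_image[OF small_atMost[OF lam assms(2)]] assms(4)]]
    by simp
  moreover have "insert \<gamma> (\<phi> ` {..\<gamma>} \<union> X) \<subseteq> {..<lam}" using assms by auto
  ultimately show ?thesis using bounded by (metis Un_iff atMost_iff image_eqI insert_iff)
qed

lemma small_empty [simp]: "small {}"
  by (rule small_finite[OF lam]) simp

text \<open>Closing off \<omega> times suffices, because countable suprema stay below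
  \<lambda>.\<close>

lemma closed_under_exists:
  assumes \<phi>: "\<And>\<beta>. \<beta> < lam \<Longrightarrow> \<phi> \<beta> < lam"
  shows "\<exists>\<delta><lam. closed_under \<phi> \<delta>"
proof -
  have "\<exists>\<gamma> :: nat \<Rightarrow> 'o. \<forall>n. \<gamma> n < lam \<and> \<gamma> n < \<gamma> (Suc n) \<and> (\<forall>\<beta>\<le>\<gamma> n. \<phi> \<beta> < \<gamma> (Suc n))"
  proof -
    have "\<exists>\<gamma> :: nat \<Rightarrow> 'o. \<forall>n. \<gamma> n < lam \<and> (\<gamma> n < \<gamma> (Suc n) \<and> (\<forall>\<beta>\<le>\<gamma> n. \<phi> \<beta> < \<gamma> (Suc n)))"
    proof (rule dependent_nat_choice)
      show "\<exists>\<gamma>. \<gamma> < lam" using \<kappa>_lam by blast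
      fix \<gamma> and n :: nat assume "\<gamma> < lam"
      then show "\<exists>\<gamma>'. \<gamma>' < lam \<and> \<gamma> < \<gamma>' \<and> (\<forall>\<beta>\<le>\<gamma>. \<phi> \<beta> < \<gamma>')"
        using closed_under_step[of \<phi> \<gamma> "{}"] \<phi> by auto
    qed
    then show ?thesis by simp
  qed
  then obtain \<gamma> :: "nat \<Rightarrow> 'o"
    where \<gamma>: "\<And>n. \<gamma> n < lam" "\<And>n. \<gamma> n < \<gamma> (Suc n)" "\<And>n \<beta>. \<beta> \<le> \<gamma> n \<Longrightarrow> \<phi> \<beta> < \<gamma> (Suc n)" by blast
  obtain \<sigma> where \<sigma>: "\<sigma> < lam" "limit_ord \<sigma>" "\<And>n. \<gamma> n < \<sigma>" "\<And>\<alpha>. \<alpha> < \<sigma> \<Longrightarrow> \<exists>n. \<alpha> < \<gamma> n"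
    using omega_sup[of \<gamma>, OF \<gamma>(2) \<gamma>(1)] by blast
  have "\<phi> \<beta> < \<sigma>" if "\<beta> < \<sigma>" for \<beta>
    using \<sigma>(4)[OF that] \<gamma>(3) \<sigma>(3) by (meson less_imp_le less_trans)
  then show ?thesis using \<sigma> by (auto simp: closed_under_def)
qed

text \<open>Any closure point of the guessing function yields a nonempty set of nodes without a last
  one, all below one node of the next level set; an increasing \<omega>-sequence can be picked from
  it.\<close>

lemma infinite_chain_above:
  assumes "\<xi> < \<kappa>" "x \<in> E \<xi>"
  shows "\<exists>(w :: nat \<Rightarrow> 't) z. z \<in> E (ord_suc \<xi>) \<and>
    (\<forall>n. w n \<in> nodes t \<and> lt t x (w n) \<and> lt t (w n) z \<and> lt t (w n) (w (Suc n)))"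
proof -
  obtain G \<phi> where \<phi>: "\<And>\<beta>. \<beta> < lam \<Longrightarrow> \<phi> \<beta> < lam"
    and gu: "\<And>\<delta>. \<delta> < lam \<Longrightarrow> closed_under \<phi> \<delta> \<Longrightarrow> \<exists>W q z. guessed \<xi> x G \<delta> W q z"
    using guess[OF assms] by metis
  obtain \<delta> where "\<delta> < lam" "closed_under \<phi> \<delta>" using closed_under_exists[of \<phi>] \<phi> by blast
  from gu[OF this] obtain W z where W: "z \<in> E (ord_suc \<xi>)" "W \<noteq> {}"
      "W \<subseteq> {w \<in> nodes t. lt t x w \<and> lt t w z}" "\<forall>w\<in>W. \<exists>w'\<in>W. lt t w w'"
    unfolding guessed_def by auto
  obtain w where "\<And>n. w n \<in> W" "\<And>n. lt t (w n) (w (Suc n))"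
    using infinite_chain_sequence[OF W(2,4)] by blast
  then show ?thesis using W by blast
qed

lemma next_above:
  assumes "\<xi> < \<kappa>" "x \<in> E \<xi>"
  shows "\<exists>z\<in>E (ord_suc \<xi>). z \<in> nodes t \<and> lt t x z"
proof -
  obtain w :: "nat \<Rightarrow> 't" and z where z: "z \<in> E (ord_suc \<xi>)" "\<And>n. w n \<in> nodes t" "\<And>n. lt t x (w n)"
    "\<And>n. lt t (w n) z" using infinite_chain_above[OF assms] by blast
  have "z \<in> nodes t" using E_node[OF z(1)] \<kappa>_suc[OF assms(1)] by simp
  moreover have "x \<in> nodes t" using E_node[OF assms(2)] assms(1) by simp
  ultimately show ?thesis
    using z(1) tree_trans[OF tree _ z(2)[of 0] _ z(3)[of 0] z(4)[of 0]] by blast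
qed

end

section \<open>The game\<close>

text \<open>Positions of the game are treated abstractly, so that the two structures become
  interchangeable: \<open>D p\<close> is the set of nodes used so far and \<open>Q p\<close> the set of pairs.\<close>

locale game = large_tree lam \<kappa> t e E
  for lam \<kappa> :: "'o::wellorder" and t :: "'t tree" and e :: "'o \<Rightarrow> 't" and E :: "'o \<Rightarrow> 't set" +
  fixes I0 :: "'a tree" and I1 :: "'b tree" and pos :: "'p set" and D :: "'p \<Rightarrow> 't set"
    and le :: "'p \<Rightarrow> 'p \<Rightarrow> bool" and Q :: "'p \<Rightarrow> ('a \<times> 'b) set"
    and extL :: "'p \<Rightarrow> 't set \<Rightarrow> ('t \<Rightarrow> 'a set) \<Rightarrow> 'p"
    and extR :: "'p \<Rightarrow> 't set \<Rightarrow> ('t \<Rightarrow> 'b set) \<Rightarrow> 'p"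
  assumes I0: "bounded_height_tree lam \<kappa> I0" and I1: "bounded_height_tree lam \<kappa> I1"
    and D_nodes: "p \<in> pos \<Longrightarrow> D p \<subseteq> nodes t"
    and le_refl: "p \<in> pos \<Longrightarrow> le p p"
    and le_trans: "le p p' \<Longrightarrow> le p' p'' \<Longrightarrow> le p p''"
    and le_Q: "p' \<in> pos \<Longrightarrow> le p p' \<Longrightarrow> Q p \<subseteq> Q p'"
    and le_D: "le p p' \<Longrightarrow> D p \<subseteq> D p'"
    and extL: "p \<in> pos \<Longrightarrow> K \<subseteq> nodes t \<Longrightarrow> \<forall>v\<in>K. \<forall>w\<in>K. v = w \<or> lt t v w \<or> lt t w v \<Longrightarrow>
      \<forall>w\<in>D p. \<forall>v\<in>K. lt t w v \<Longrightarrow> \<forall>v\<in>K. mL v \<subseteq> nodes I0 \<and> small (mL v) \<Longrightarrow>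
      extL p K mL \<in> pos \<and> le p (extL p K mL) \<and> D (extL p K mL) = D p \<union> K \<and>
      (\<forall>v\<in>K. mL v \<subseteq> Domain (Q (extL p K mL)))"
    and extR: "p \<in> pos \<Longrightarrow> K \<subseteq> nodes t \<Longrightarrow> \<forall>v\<in>K. \<forall>w\<in>K. v = w \<or> lt t v w \<or> lt t w v \<Longrightarrow>
      \<forall>w\<in>D p. \<forall>v\<in>K. lt t w v \<Longrightarrow> \<forall>v\<in>K. mR v \<subseteq> nodes I1 \<and> small (mR v) \<Longrightarrow>
      extR p K mR \<in> pos \<and> le p (extR p K mR) \<and> D (extR p K mR) = D p \<union> K \<and>
      (\<forall>v\<in>K. mR v \<subseteq> Range (Q (extR p K mR)))"
    and extL_le: "p \<in> pos \<Longrightarrow> K \<subseteq> nodes t \<Longrightarrow> \<forall>v\<in>K. \<forall>w\<in>K. v = w \<or> lt t v w \<or> lt t w v \<Longrightarrow>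
      \<forall>w\<in>D p. \<forall>v\<in>K. lt t w v \<Longrightarrow> K' \<subseteq> K \<Longrightarrow> \<forall>v\<in>K. \<forall>w\<in>K'. lt t v w \<longrightarrow> v \<in> K' \<Longrightarrow>
      \<forall>v\<in>K'. mL v = mL' v \<Longrightarrow> le (extL p K' mL') (extL p K mL)"
    and extR_le: "p \<in> pos \<Longrightarrow> K \<subseteq> nodes t \<Longrightarrow> \<forall>v\<in>K. \<forall>w\<in>K. v = w \<or> lt t v w \<or> lt t w v \<Longrightarrow>
      \<forall>w\<in>D p. \<forall>v\<in>K. lt t w v \<Longrightarrow> K' \<subseteq> K \<Longrightarrow> \<forall>v\<in>K. \<forall>w\<in>K'. lt t v w \<longrightarrow> v \<in> K' \<Longrightarrow>
      \<forall>v\<in>K'. mR v = mR' v \<Longrightarrow> le (extR p K' mR') (extR p K mR)"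
    and chain_bound: "H \<subseteq> pos \<Longrightarrow> \<forall>p\<in>H. \<forall>p'\<in>H. le p p' \<or> le p' p \<Longrightarrow>
      \<exists>u\<in>pos. (\<forall>p\<in>H. le p u) \<and> D u = \<Union> (D ` H)"
    and partial_isomorphism: "p \<in> pos \<Longrightarrow> z \<in> nodes t \<Longrightarrow> \<forall>w\<in>D p. w = z \<or> lt t w z \<Longrightarrow>
      Q p \<subseteq> nodes I0 \<times> nodes I1 \<and>
      (\<forall>(a, b)\<in>Q p. \<forall>(a', b')\<in>Q p. (a = a' \<longleftrightarrow> b = b') \<and> (lt I0 a a' \<longleftrightarrow> lt I1 b b'))"
begin

text \<open>Inverting all pairs exchanges the two trees and the two kinds of moves and leaves
  positions and their order alone. Every one-sided fact about plays thus becomes available for the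
  other side.\<close>

lemma swapped: "game lam \<kappa> t e E I1 I0 pos D le (\<lambda>p. (Q p)\<inverse>) extR extL"
proof unfold_locales
  show "(Q p)\<inverse> \<subseteq> (Q p')\<inverse>" if "p' \<in> pos" "le p p'" for p p' using le_Q[OF that] by auto
  show "(Q p)\<inverse> \<subseteq> nodes I1 \<times> nodes I0 \<and> (\<forall>(a, b)\<in>(Q p)\<inverse>. \<forall>(a', b')\<in>(Q p)\<inverse>.
      (a = a' \<longleftrightarrow> b = b') \<and> (lt I1 a a' \<longleftrightarrow> lt I0 b b'))"
    if "p \<in> pos" "z \<in> nodes t" "\<forall>w\<in>D p. w = z \<or> lt t w z" for p z
    using partial_isomorphism[OF that] by fast
  show "extR p K m \<in> pos \<and> le p (extR p K m) \<and> D (extR p K m) = D p \<union> K \<and>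
      (\<forall>v\<in>K. m v \<subseteq> Domain ((Q (extR p K m))\<inverse>))"
    if "p \<in> pos" "K \<subseteq> nodes t" "\<forall>v\<in>K. \<forall>w\<in>K. v = w \<or> lt t v w \<or> lt t w v"
      "\<forall>w\<in>D p. \<forall>v\<in>K. lt t w v" "\<forall>v\<in>K. m v \<subseteq> nodes I1 \<and> small (m v)" for p K m
    using extR[OF that] by simp
  show "extL p K m \<in> pos \<and> le p (extL p K m) \<and> D (extL p K m) = D p \<union> K \<and>
      (\<forall>v\<in>K. m v \<subseteq> Range ((Q (extL p K m))\<inverse>))"
    if "p \<in> pos" "K \<subseteq> nodes t" "\<forall>v\<in>K. \<forall>w\<in>K. v = w \<or> lt t v w \<or> lt t w v"
      "\<forall>w\<in>D p. \<forall>v\<in>K. lt t w v" "\<forall>v\<in>K. m v \<subseteq> nodes I0 \<and> small (m v)" for p K m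
    using extL[OF that] by simp
  show "le p p''" if "le p p'" "le p' p''" for p p' p'' by (rule le_trans[OF that])
qed (fact I0 I1 D_nodes le_refl le_D extL_le extR_le chain_bound)+

definition ends :: "'p \<Rightarrow> 't \<Rightarrow> bool" where
  "ends p x \<longleftrightarrow> x \<in> D p \<and> (\<forall>w\<in>D p. w = x \<or> lt t w x)"

lemma is_tree_I0: "is_tree I0" and is_tree_I1: "is_tree I1"
  using I0 I1 by (auto simp: bounded_height_tree_def succ_card_tree_def)

lemma ends_less:
  assumes "p \<in> pos" "ends p x" "x \<in> nodes t" "z \<in> nodes t" "lt t x z" "w \<in> D p"
  shows "lt t w z"
proof -
  have "w \<in> nodes t" using D_nodes[OF assms(1)] assms(6) by blast
  then show ?thesis
    using tree_trans[OF tree _ assms(3,4) _ assms(5)] assms(2,5,6) by (auto simp: ends_def)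
qed

lemma Q_nodes:
  assumes "p \<in> pos" "z \<in> nodes t" "\<forall>w\<in>D p. w = z \<or> lt t w z" "(a, b) \<in> Q p"
  shows "a \<in> nodes I0" "b \<in> nodes I1"
  using partial_isomorphism[OF assms(1-3)] assms(4) by auto

lemma Q_iff:
  assumes "p \<in> pos" "z \<in> nodes t" "\<forall>w\<in>D p. w = z \<or> lt t w z" "(a, b) \<in> Q p" "(a', b') \<in> Q p"
  shows "a = a' \<longleftrightarrow> b = b'" "lt I0 a a' \<longleftrightarrow> lt I1 b b'"
  using partial_isomorphism[OF assms(1-3)] assms(4,5) by fast+

lemma play_left:
  assumes "p \<in> pos" "z \<in> nodes t" "\<forall>w\<in>D p. lt t w z" "X \<subseteq> nodes I0" "small X"
  obtains p' where "p' \<in> pos" "le p p'" "ends p' z" "D p' = insert z (D p)" "X \<subseteq> Domain (Q p')"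
  using extL[of p "{z}" "\<lambda>_. X"] assms that[of "extL p {z} (\<lambda>_. X)"] by (simp add: ends_def)

lemma play_right:
  assumes "p \<in> pos" "z \<in> nodes t" "\<forall>w\<in>D p. lt t w z" "X \<subseteq> nodes I1" "small X"
  obtains p' where "p' \<in> pos" "le p p'" "ends p' z" "D p' = insert z (D p)" "X \<subseteq> Range (Q p')"
  using extR[of p "{z}" "\<lambda>_. X"] assms that[of "extR p {z} (\<lambda>_. X)"] by (simp add: ends_def)

lemma ends_le: "ends p z \<Longrightarrow> \<forall>w\<in>D p. w = z \<or> lt t w z"
  by (simp add: ends_def)

text \<open>An answer that is not an immediate successor can be refuted by one more move.\<close>

lemma answer_succs:
  assumes p: "p \<in> pos" "z \<in> nodes t" "\<forall>w\<in>D p. lt t w z"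
    and cd: "(\<eta>, \<nu>) \<in> Q p" "(c, d) \<in> Q p" "c \<in> succs I0 \<eta>"
  shows "d \<in> succs I1 \<nu>"
proof -
  have "\<forall>w\<in>D p. w = z \<or> lt t w z" using p(3) by auto
  note bd = p(1,2) this
  have "lt I1 \<nu> d" "d \<in> nodes I1"
    using Q_iff(2)[OF bd cd(1,2)] Q_nodes[OF bd cd(2)] cd(3) by (auto simp: succs_def)
  moreover have False if \<nu>': "\<nu>' \<in> nodes I1" "lt I1 \<nu> \<nu>'" "lt I1 \<nu>' d" for \<nu>'
  proof -
    obtain p' where p': "p' \<in> pos" "le p p'" "ends p' z" "{\<nu>'} \<subseteq> Range (Q p')"
      by (rule play_right[OF p, of "{\<nu>'}"]) (use \<nu>'(1) small_finite[OF lam, of "{\<nu>'}"] in auto)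
    note bd' = p'(1) p(2) ends_le[OF p'(3)]
    obtain \<eta>' where "(\<eta>', \<nu>') \<in> Q p'" using p'(4) by auto
    moreover have "(\<eta>, \<nu>) \<in> Q p'" "(c, d) \<in> Q p'" using le_Q[OF p'(1,2)] cd by auto
    ultimately have "lt I0 \<eta> \<eta>'" "lt I0 \<eta>' c" "\<eta>' \<in> nodes I0"
      using Q_iff(2)[OF bd'] Q_nodes(1)[OF bd'] \<nu>' by blast+
    then show False using cd(3) by (auto simp: succs_def)
  qed
  ultimately show ?thesis by (auto simp: succs_def)
qed

section \<open>Plays that match immediate successors\<close>

lemma tree_chain: "z \<in> nodes t \<Longrightarrow> K \<subseteq> insert z (preds t z) \<Longrightarrow> \<forall>v\<in>K. \<forall>w\<in>K. v = w \<or> lt t v w \<or> lt t w v"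
proof (intro ballI)
  fix v w assume z: "z \<in> nodes t" and K: "K \<subseteq> insert z (preds t z)" and vw: "v \<in> K" "w \<in> K"
  then have "v = z \<or> v \<in> preds t z" "w = z \<or> w \<in> preds t z" by auto
  then show "v = w \<or> lt t v w \<or> lt t w v"
    using tree_linear[OF tree z, of v w] by (auto simp: preds_def)
qed

text \<open>Fewer than \<open>\<lambda>\<close> partial plays are foreseen below \<open>\<delta>\<close>, so all answers occurring in them have an
  index below \<open>\<delta>\<close> as soon as \<open>\<delta>\<close> is a closure point of a suitable function.\<close>

lemma closed_play:
  assumes h: "h \<in> pos" "ends h x" and \<xi>: "\<xi> < \<kappa>" "x \<in> E \<xi>" and Q: "(\<eta>, \<nu>) \<in> Q h"
    and rC: "rC ` succs I0 \<eta> \<subseteq> {..<lam}"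
    and rD: "inj_on rD (succs I1 \<nu>)"
  shows "\<exists>\<phi>. (\<forall>\<beta><lam. \<phi> \<beta> < lam) \<and> (\<forall>\<delta><lam. closed_under \<phi> \<delta> \<longrightarrow>
     (\<exists>h1\<in>pos. le h h1 \<and> (\<exists>z\<in>E (ord_suc \<xi>). ends h1 z) \<and>
       (\<forall>d\<in>succs I1 \<nu>. rD d < \<delta> \<longrightarrow> (\<exists>c\<in>succs I0 \<eta>. rC c < \<delta> \<and> (c, d) \<in> Q h1))))"
proof -
  interpret swap: game lam \<kappa> t e E I1 I0 pos D le "\<lambda>p. (Q p)\<inverse>" extR extL
    by (rule swapped)
  define C where "C = succs I0 \<eta>"
  define D' where "D' = succs I1 \<nu>"
  have xn: "x \<in> nodes t" using E_node[OF \<xi>(2)] \<xi>(1) by simp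
  have Dh: "w = x \<or> lt t w x" "w \<in> nodes t" if "w \<in> D h" for w
    using that h D_nodes by (auto simp: ends_def)
  obtain G \<phi>\<^sub>0 where G: "\<And>\<beta>. \<beta> < lam \<Longrightarrow> small (G \<beta>)" and \<phi>\<^sub>0: "\<And>\<beta>. \<beta> < lam \<Longrightarrow> \<phi>\<^sub>0 \<beta> < lam"
    and gu: "\<And>\<delta>. \<delta> < lam \<Longrightarrow> closed_under \<phi>\<^sub>0 \<delta> \<Longrightarrow> \<exists>W q z. guessed \<xi> x G \<delta> W q z"
    using guess[OF \<xi>] by metis
  define K where "K w = {v \<in> nodes t. lt t x v \<and> (v = w \<or> lt t v w)}" for w
  \<comment> \<open>At node \<open>v\<close> all successors of \<nu> with index below the label
    \<open>q v\<close> are played. Injectivity of \<open>rD\<close> makes this fewer than \<lambda>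
    elements.\<close>
  define m where "m q v = {d \<in> D'. rD d < q v}" for q :: "'t \<Rightarrow> 'o" and v
  define hp where "hp = (\<lambda>(w, q). extR h (K w) (m q))"
  \<comment> \<open>A list may contain codes that describe no play. The filter keeps labels below
    \<lambda>, which make the moves legal, and a node above \<open>w\<close>, which leaves room for
    testing the answers.\<close>
  define valid where "valid = (\<lambda>(w, q). w \<in> nodes t \<and> (\<forall>v\<in>K w. q v < lam) \<and> (\<exists>z\<in>nodes t. lt t w z))"
  have small_m: "m q v \<subseteq> nodes I1 \<and> small (m q v)" if "q v < lam" for q v
  proof -
    have "inj_on rD (m q v)" by (rule inj_on_subset[OF rD]) (auto simp: m_def D'_def)
    then have "small (m q v)"
      by (rule small_inj[OF _ _ small_initial[OF lam that]]) (auto simp: m_def)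
    then show ?thesis by (auto simp: m_def D'_def succs_def)
  qed
  have before: "\<forall>w\<in>D h. \<forall>v\<in>K'. lt t w v" if "K' \<subseteq> {v \<in> nodes t. lt t x v}" for K'
  proof (intro ballI)
    fix w v assume "w \<in> D h" "v \<in> K'"
    then show "lt t w v" using Dh[of w] that tree_trans[OF tree _ xn, of w v] by auto
  qed
  have before1: "\<forall>w\<in>D h. lt t w v" if "v \<in> nodes t" "lt t x v" for v
    using before[of "{v}"] that by (simp del: insert_subset add: subset_eq)
  have hp: "hp g \<in> pos \<and> D (hp g) = D h \<union> K (fst g) \<and> (\<forall>v\<in>K (fst g). m (snd g) v \<subseteq> Range (Q (hp g))) \<and> le h (hp g)"
    if "valid g" for g
  proof -
    obtain w q where g: "g = (w, q)" by force
    have w: "w \<in> nodes t" "\<And>v. v \<in> K w \<Longrightarrow> q v < lam" using that by (auto simp: valid_def g)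
    have "extR h (K w) (m q) \<in> pos \<and> le h (extR h (K w) (m q)) \<and> D (extR h (K w) (m q)) = D h \<union> K w \<and>
        (\<forall>v\<in>K w. m q v \<subseteq> Range (Q (extR h (K w) (m q))))"
    proof (rule extR[OF h(1)])
      show "\<forall>v\<in>K w. \<forall>v'\<in>K w. v = v' \<or> lt t v v' \<or> lt t v' v"
        by (rule tree_chain[OF w(1)]) (auto simp: K_def preds_def)
      show "\<forall>w'\<in>D h. \<forall>v\<in>K w. lt t w' v" by (rule before) (auto simp: K_def)
      show "\<forall>v\<in>K w. m q v \<subseteq> nodes I1 \<and> small (m q v)" using small_m w(2) by blast
    qed (auto simp: K_def)
    then show ?thesis by (simp add: g hp_def)
  qed
  \<comment> \<open>A position has to be bounded by a node of \<open>t\<close> before \<exists> is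
    committed to a partial isomorphism. If no node is added to \<open>h\<close>, the bound comes
    from the next level set instead of from the code.\<close>
  have hp_bound: "\<exists>z\<in>nodes t. \<forall>v\<in>D (hp g). lt t v z" if g: "valid g" for g
  proof -
    obtain w q where gw: "g = (w, q)" by force
    obtain z where z: "z \<in> nodes t" "lt t w z" "w \<in> nodes t" using g by (auto simp: valid_def gw)
    have D_hp: "D (hp g) = D h \<union> K w" using hp[OF g] by (simp add: gw)
    show ?thesis
    proof (cases "K w = {}")
      case True
      from next_above[OF \<xi>] obtain z' where z': "z' \<in> E (ord_suc \<xi>)" "z' \<in> nodes t" "lt t x z'"
        by (elim bexE conjE)
      have "\<forall>v\<in>D h. lt t v z'" by (rule before1[OF z'(2,3)])
      then show ?thesis using D_hp True z'(2) by auto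
    next
      case False
      then have "lt t x w" using tree_trans[OF tree xn _ z(3)] by (auto simp: K_def)
      then have "lt t x z" using tree_trans[OF tree xn z(3,1) _ z(2)] by simp
      from before1[OF z(1) this] have "\<forall>v\<in>D h. lt t v z" .
      moreover have "\<forall>v\<in>K w. lt t v z" using z(2) tree_trans[OF tree _ z(3,1) _ z(2)] unfolding K_def by blast
      ultimately show ?thesis unfolding D_hp using z(1) by blast
    qed
  qed
  have hp_Q: "(\<eta>, \<nu>) \<in> Q (hp g)" if "valid g" for g using hp[OF that] le_Q[of "hp g" h] Q by auto
  \<comment> \<open>All indices of answers to successors of index below \<beta> in plays listed up
    to \<beta>. A closure point \<delta> of a function bounding these sets absorbs every foreseen
    answer.\<close>
  define X where "X \<beta> = (\<Union>g\<in>{g\<in>\<Union>\<gamma>\<in>{..\<beta>}. G \<gamma>. valid g}. {rC c |c d. c \<in> C \<and> d \<in> D' \<and> rD d < \<beta> \<and> (c, d) \<in> Q (hp g)})" for \<beta>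
  have "\<exists>\<gamma><lam. \<forall>\<alpha>\<in>X \<beta>. \<alpha> < \<gamma>" if \<beta>: "\<beta> < lam" for \<beta>
  proof (rule bounded)
    show "X \<beta> \<subseteq> {..<lam}" using rC by (auto simp: X_def C_def)
    have "small (\<Union>\<gamma>\<in>{..\<beta>}. G \<gamma>)"
      by (rule small_UN[OF lam small_atMost[OF lam \<beta>]]) (use G \<beta> in auto)
    then have sG: "small {g\<in>\<Union>\<gamma>\<in>{..\<beta>}. G \<gamma>. valid g}" by (rule small_subset) auto
    show "small (X \<beta>)"
      unfolding X_def
    proof (rule small_UN[OF lam sG])
      fix g assume "g \<in> {g\<in>\<Union>\<gamma>\<in>{..\<beta>}. G \<gamma>. valid g}"
      then have v: "valid g" by simp
      obtain z where z: "z \<in> nodes t" "\<forall>v\<in>D (hp g). lt t v z" using hp_bound[OF v] by blast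
      have "\<forall>v\<in>D (hp g). v = z \<or> lt t v z" using z by auto
      note fn = Q_iff(1)[OF conjunct1[OF hp[OF v]] z(1) this]
      have "small (m (\<lambda>_. \<beta>) x)" using small_m[of "\<lambda>_. \<beta>" x] \<beta> by simp
      then have "small ((\<lambda>d. rC (SOME c. (c, d) \<in> Q (hp g))) ` m (\<lambda>_. \<beta>) x)" by (rule small_image)
      \<comment> \<open>In a bounded position the pairs are one-to-one, so each \<open>d\<close>
        accounts for at most one answer \<open>c\<close>.\<close>
      moreover have "{rC c |c d. c \<in> C \<and> d \<in> D' \<and> rD d < \<beta> \<and> (c, d) \<in> Q (hp g)} \<subseteq>
          (\<lambda>d. rC (SOME c. (c, d) \<in> Q (hp g))) ` m (\<lambda>_. \<beta>) x"
      proof clarify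
        fix c d assume cd: "c \<in> C" "d \<in> D'" "rD d < \<beta>" "(c, d) \<in> Q (hp g)"
        then have "(SOME c. (c, d) \<in> Q (hp g)) = c" using fn by (intro some_equality) blast+
        then show "rC c \<in> (\<lambda>d. rC (SOME c. (c, d) \<in> Q (hp g))) ` m (\<lambda>_. \<beta>) x"
          using cd by (intro image_eqI[of _ _ d]) (auto simp: m_def)
      qed
      ultimately show "small {rC c |c d. c \<in> C \<and> d \<in> D' \<and> rD d < \<beta> \<and> (c, d) \<in> Q (hp g)}"
        by (rule small_subset)
    qed
  qed
  then obtain \<psi> where \<psi>: "\<And>\<beta>. \<beta> < lam \<Longrightarrow> \<psi> \<beta> < lam" "\<And>\<beta> \<alpha>. \<beta> < lam \<Longrightarrow> \<alpha> \<in> X \<beta> \<Longrightarrow> \<alpha> < \<psi> \<beta>"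
    by metis
  show ?thesis
  proof (intro exI[of _ "\<lambda>\<beta>. max (\<phi>\<^sub>0 \<beta>) (\<psi> \<beta>)"] conjI allI impI)
    fix \<beta> assume "\<beta> < lam"
    then show "max (\<phi>\<^sub>0 \<beta>) (\<psi> \<beta>) < lam" using \<phi>\<^sub>0 \<psi>(1) by simp
  next
    fix \<delta> assume \<delta>: "\<delta> < lam" "closed_under (\<lambda>\<beta>. max (\<phi>\<^sub>0 \<beta>) (\<psi> \<beta>)) \<delta>"
    have cl: "closed_under \<phi>\<^sub>0 \<delta>" "closed_under \<psi> \<delta>" using closed_under_max[OF \<delta>(2)] by auto
    have lim: "limit_ord \<delta>" using \<delta>(2) by (simp add: closed_under_def)
    obtain W q z where "guessed \<xi> x G \<delta> W q z" using gu[OF \<delta>(1) cl(1)] by blast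
    note gd = this[unfolded guessed_def]
    have z: "z \<in> E (ord_suc \<xi>)" using gd by (elim conjE)
    have "W \<noteq> {}" using gd by (elim conjE)
    moreover have "W \<subseteq> {w \<in> nodes t. lt t x w \<and> lt t w z}" using gd by (elim conjE)
    ultimately have W: "W \<noteq> {}" "W \<subseteq> {w \<in> nodes t. lt t x w \<and> lt t w z}" by this+
    have W_down: "v \<in> W" if "w \<in> W" "v \<in> nodes t" "lt t x v" "lt t v w" for w v
      using gd that by (elim conjE) blast
    have "\<forall>w\<in>W. q w < \<delta>" using gd by (elim conjE)
    moreover have "\<forall>\<alpha><\<delta>. \<exists>w\<in>W. \<alpha> < q w" using gd by (elim conjE)
    ultimately have q: "\<And>w. w \<in> W \<Longrightarrow> q w < \<delta>" "\<And>\<alpha>. \<alpha> < \<delta> \<Longrightarrow> \<exists>w\<in>W. \<alpha> < q w"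
      by simp_all
    have "\<forall>w\<in>W. \<exists>\<beta><\<delta>. \<exists>q'. (w, q') \<in> G \<beta> \<and> (\<forall>v\<in>W. v = w \<or> lt t v w \<longrightarrow> q' v = q v)"
      using gd by (elim conjE)
    note code = bspec[OF this]
    have zn: "z \<in> nodes t" using E_node[OF z] \<kappa>_suc[OF \<xi>(1)] by simp
    have xz: "lt t x z" using W tree_trans[OF tree xn _ zn] by blast
    have zW: "z \<notin> W" using W(2) tree_irrefl[OF tree zn] by auto
    \<comment> \<open>The label \<open>ord_zero\<close> at the final node \<open>z\<close> makes the
      move there empty, as no index lies below it. It only moves the end of the position into the
      next level set.\<close>
    define q0 where "q0 = q(z := ord_zero)"
    define h1 where "h1 = extR h (insert z W) (m q0)"
    have K_sub: "insert z W \<subseteq> {v \<in> nodes t. lt t x v}" using W(2) zn xz by auto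
    have chain: "\<forall>v\<in>insert z W. \<forall>w\<in>insert z W. v = w \<or> lt t v w \<or> lt t w v"
      by (rule tree_chain[OF zn]) (use W(2) in \<open>auto simp: preds_def\<close>)
    have q0_lam: "q0 v < lam" if "v \<in> insert z W" for v
      using that q(1)[of v] \<delta>(1) less_trans le_less_trans[OF ord_zero_le \<delta>(1)] by (auto simp: q0_def)
    have ins: "insert z W \<subseteq> nodes t" using K_sub by auto
    have h1: "h1 \<in> pos \<and> le h h1 \<and> D h1 = D h \<union> insert z W \<and> (\<forall>v\<in>insert z W. m q0 v \<subseteq> Range (Q h1))"
      unfolding h1_def
      by (rule extR[OF h(1) ins chain before[OF K_sub]]) (use small_m q0_lam in blast)
    have "ends h1 z"
      using h1 W(2) before1[OF zn xz] unfolding ends_def by blast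
    moreover have "\<exists>c\<in>C. rC c < \<delta> \<and> (c, d) \<in> Q h1" if d: "d \<in> D'" "rD d < \<delta>" for d
    proof -
      obtain w where w: "w \<in> W" "rD d < q w" using q(2)[OF d(2)] by blast
      obtain \<beta> q' where b: "\<beta> < \<delta>" "(w, q') \<in> G \<beta>" "\<And>v. v \<in> W \<Longrightarrow> v = w \<or> lt t v w \<Longrightarrow> q' v = q v"
        using code[OF w(1)] by blast
      have KW: "K w \<subseteq> W" using W_down[OF w(1)] w(1) by (auto simp: K_def)
      have wn: "w \<in> nodes t" "lt t x w" "lt t w z" using W(2) w(1) by auto
      have q'q: "q' v = q v" if "v \<in> K w" for v using b(3) that KW by (auto simp: K_def)
      have val: "valid (w, q')"
        using wn zn q'q q(1) KW \<delta>(1) unfolding valid_def by (auto intro: less_trans)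
      have hp_h1: "le (hp (w, q')) h1"
        unfolding hp_def h1_def prod.case
      proof (rule extR_le[OF h(1) ins chain before[OF K_sub]])
        show "K w \<subseteq> insert z W" using KW by blast
        show "\<forall>v\<in>insert z W. \<forall>w'\<in>K w. lt t v w' \<longrightarrow> v \<in> K w"
        proof (intro ballI impI)
          fix v w' assume v: "v \<in> insert z W" "w' \<in> K w" "lt t v w'"
          then have "lt t v w" using tree_trans[OF tree _ _ wn(1), of v w'] K_sub by (auto simp: K_def)
          then show "v \<in> K w" using v(1) K_sub by (auto simp: K_def)
        qed
        show "\<forall>v\<in>K w. m q0 v = m q' v" using q'q KW zW by (auto simp: m_def q0_def)
      qed
      have "w \<in> K w" using wn by (simp add: K_def)
      moreover from this have "d \<in> m q' w" using d w q'q by (simp add: m_def)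
      ultimately have "d \<in> Range (Q (hp (w, q')))" using hp[OF val] unfolding fst_conv snd_conv by blast
      then obtain c where c: "(c, d) \<in> Q (hp (w, q'))" by blast
      then have c': "(c, d) \<in> Q h1" using le_Q[OF conjunct1[OF h1] hp_h1] by blast
      obtain z' where "z' \<in> nodes t" "\<forall>v\<in>D (hp (w, q')). lt t v z'" using hp_bound[OF val] by blast
      then have "c \<in> C"
        using swap.answer_succs[of "hp (w, q')" z' \<nu> \<eta> d c] hp[OF val] hp_Q[OF val] c d(1)
        by (simp add: C_def D'_def)
      \<comment> \<open>One stage has to cover both the code of the play and the index of
        \<open>d\<close>; the latter must lie strictly below it, hence the successor.\<close>
      define \<beta>' where "\<beta>' = max \<beta> (ord_suc (rD d))"
      have b': "\<beta>' < \<delta>" "rD d < \<beta>'" "\<beta> \<le> \<beta>'"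
        using b(1) limit_ord_suc_less[OF lim d(2)] less_ord_suc[OF d(2)] by (auto simp: \<beta>'_def less_max_iff_disj)
      have "rC c \<in> X \<beta>'"
        unfolding X_def using \<open>c \<in> C\<close> d(1) b' b(2) c val by blast
      then have "rC c < \<psi> \<beta>'" using \<psi>(2) b'(1) \<delta>(1) less_trans by blast
      also have "\<psi> \<beta>' < \<delta>" using cl(2) b'(1) by (rule closed_underD)
      finally show ?thesis using \<open>c \<in> C\<close> c' by blast
    qed
    ultimately show "\<exists>h1\<in>pos. le h h1 \<and> (\<exists>z\<in>E (ord_suc \<xi>). ends h1 z) \<and>
       (\<forall>d\<in>succs I1 \<nu>. rD d < \<delta> \<longrightarrow> (\<exists>c\<in>succs I0 \<eta>. rC c < \<delta> \<and> (c, d) \<in> Q h1))"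
      using h1 z unfolding C_def D'_def by blast
  qed
qed

text \<open>In each of \<open>\<omega>\<close> further moves all successors with index below the bound reached so far are played;
  since those matched before stay below \<open>\<delta>\<close>, the new answers have index at least \<open>\<delta>\<close>.\<close>

lemma interval_play:
  assumes h: "h \<in> pos" "ends h x" and \<xi>: "\<xi> < \<kappa>" "x \<in> E \<xi>" and Q: "(\<eta>, \<nu>) \<in> Q h"
    and rC: "inj_on rC (succs I0 \<eta>)" and rD: "rD ` succs I1 \<nu> \<subseteq> {..<lam}"
    and \<phi>: "\<And>\<beta>. \<beta> < lam \<Longrightarrow> \<phi> \<beta> < lam" and \<delta>: "\<delta> < lam"
    and matched: "\<And>d. d \<in> succs I1 \<nu> \<Longrightarrow> rD d < \<delta> \<Longrightarrow> \<exists>c\<in>succs I0 \<eta>. rC c < \<delta> \<and> (c, d) \<in> Q h"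
  shows "\<exists>\<delta>'<lam. \<delta> < \<delta>' \<and> closed_under \<phi> \<delta>' \<and> (\<exists>h2\<in>pos. le h h2 \<and> (\<exists>z\<in>E (ord_suc \<xi>). ends h2 z) \<and>
     (\<forall>c\<in>succs I0 \<eta>. \<delta> \<le> rC c \<and> rC c < \<delta>' \<longrightarrow>
        (\<exists>d\<in>succs I1 \<nu>. \<delta> \<le> rD d \<and> rD d < \<delta>' \<and> (c, d) \<in> Q h2)))"
proof -
  define C where "C = succs I0 \<eta>"
  obtain w :: "nat \<Rightarrow> 't" and z where z: "z \<in> E (ord_suc \<xi>)"
    and w: "\<And>n. w n \<in> nodes t" "\<And>n. lt t x (w n)" "\<And>n. lt t (w n) z" "\<And>n. lt t (w n) (w (Suc n))"
    using infinite_chain_above[OF \<xi>] by blast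
  have zn: "z \<in> nodes t" using E_node[OF z] \<kappa>_suc[OF \<xi>(1)] by simp
  have xn: "x \<in> nodes t" using E_node[OF \<xi>(2)] \<xi>(1) by simp
  \<comment> \<open>The position stays below \<open>w n\<close>, so that this node is free for the
    next move; \<gamma> is the bound on indices reached so far.\<close>
  define ok where "ok n = (\<lambda>(g, \<gamma>). g \<in> pos \<and> le h g \<and> (\<forall>v\<in>D g. lt t v (w n)) \<and> \<delta> \<le> \<gamma> \<and> \<gamma> < lam)" for n
  define step where "step = (\<lambda>(g, \<gamma>) (g', \<gamma>'). le g g' \<and> \<gamma> < \<gamma>' \<and> (\<forall>\<beta>\<le>\<gamma>. \<phi> \<beta> < \<gamma>') \<and>
     (\<forall>c\<in>C. rC c < \<gamma> \<longrightarrow> (\<exists>d\<in>succs I1 \<nu>. rD d < \<gamma>' \<and> (c, d) \<in> Q g')))"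
  have "\<exists>s. \<forall>n. ok n (s n) \<and> step (s n) (s (Suc n))"
  proof (rule dependent_nat_choice)
    have "ok 0 (h, \<delta>)" using h le_refl[OF h(1)] ends_less[OF h xn w(1,2)] \<delta> by (simp add: ok_def)
    then show "\<exists>s. ok 0 s" by blast
  next
    fix s n assume "ok n s"
    then obtain g \<gamma> where s: "s = (g, \<gamma>)" and g: "g \<in> pos" "le h g" "\<forall>v\<in>D g. lt t v (w n)"
      and \<gamma>: "\<delta> \<le> \<gamma>" "\<gamma> < lam" by (cases s) (auto simp: ok_def)
    define X where "X = {c \<in> C. rC c < \<gamma>}"
    have "inj_on rC X" by (rule inj_on_subset[OF rC]) (auto simp: X_def C_def)
    then have sX: "small X"
      by (rule small_inj[OF _ _ small_initial[OF lam \<gamma>(2)]]) (auto simp: X_def)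
    have "X \<subseteq> nodes I0" by (auto simp: X_def C_def succs_def)
    obtain g' where g': "g' \<in> pos" "le g g'" "ends g' (w n)" "X \<subseteq> Domain (Q g')"
      by (rule play_left[OF g(1) w(1) g(3) \<open>X \<subseteq> nodes I0\<close> sX])
    have g'w: "\<forall>v\<in>D g'. lt t v (w (Suc n))" using ends_less[OF g'(1,3) w(1) w(1) w(4)] by blast
    have Qg': "(\<eta>, \<nu>) \<in> Q g'" using le_Q[OF g'(1) le_trans[OF g(2) g'(2)]] Q by blast
    have "\<forall>c. \<exists>d. c \<in> X \<longrightarrow> (c, d) \<in> Q g'" using g'(4) by blast
    then obtain d where d: "\<And>c. c \<in> X \<Longrightarrow> (c, d c) \<in> Q g'" by metis
    \<comment> \<open>The next node of the sequence lies above the whole position and so leaves room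
      for the move that refutes other answers.\<close>
    have dD: "d c \<in> succs I1 \<nu>" if "c \<in> X" for c
      using answer_succs[OF g'(1) w(1) g'w Qg' d[OF that]] that by (simp add: X_def C_def)
    have "rD ` d ` X \<subseteq> {..<lam}" using subsetD[OF rD imageI[OF dD]] by auto
    then have "\<exists>\<gamma>'<lam. \<gamma> < \<gamma>' \<and> (\<forall>\<beta>\<le>\<gamma>. \<phi> \<beta> < \<gamma>') \<and> (\<forall>\<beta>\<in>rD ` d ` X. \<beta> < \<gamma>')"
      using small_image[OF small_image[OF sX]] by (intro closed_under_step \<phi> \<gamma>(2))
    then obtain \<gamma>' where \<gamma>': "\<gamma>' < lam" "\<gamma> < \<gamma>'" "\<forall>\<beta>\<le>\<gamma>. \<phi> \<beta> < \<gamma>'" "\<forall>\<beta>\<in>rD ` d ` X. \<beta> < \<gamma>'"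
      by (elim exE conjE)
    have "ok (Suc n) (g', \<gamma>')"
      using g' g'w \<gamma> \<gamma>' le_trans[OF g(2) g'(2)] by (auto simp: ok_def)
    moreover have "step s (g', \<gamma>')"
      using g' \<gamma>' d dD unfolding step_def s X_def by auto
    ultimately show "\<exists>s'. ok (Suc n) s' \<and> step s s'" by blast
  qed
  then obtain s where s: "\<And>n. ok n (s n)" "\<And>n. step (s n) (s (Suc n))" by blast
  define g where "g n = fst (s n)" for n
  define \<gamma> where "\<gamma> n = snd (s n)" for n
  have sn: "s n = (g n, \<gamma> n)" for n by (simp add: g_def \<gamma>_def)
  have g: "g n \<in> pos" "le h (g n)" "\<forall>v\<in>D (g n). lt t v (w n)" and \<gamma>: "\<delta> \<le> \<gamma> n" "\<gamma> n < lam" for n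
    using s(1)[of n] by (auto simp: ok_def sn)
  have st: "le (g n) (g (Suc n))" "\<gamma> n < \<gamma> (Suc n)" "\<And>\<beta>. \<beta> \<le> \<gamma> n \<Longrightarrow> \<phi> \<beta> < \<gamma> (Suc n)"
      "\<And>c. c \<in> C \<Longrightarrow> rC c < \<gamma> n \<Longrightarrow> \<exists>d\<in>succs I1 \<nu>. rD d < \<gamma> (Suc n) \<and> (c, d) \<in> Q (g (Suc n))" for n
    using s(2)[of n] by (auto simp: step_def sn)
  obtain \<sigma> where \<sigma>: "\<sigma> < lam" "limit_ord \<sigma>" "\<And>n. \<gamma> n < \<sigma>" "\<And>\<alpha>. \<alpha> < \<sigma> \<Longrightarrow> \<exists>n. \<alpha> < \<gamma> n"
    using omega_sup[of \<gamma>, OF st(2) \<gamma>(2)] by blast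
  have cl: "closed_under \<phi> \<sigma>"
    unfolding closed_under_def
  proof (intro conjI allI impI)
    fix \<beta> assume "\<beta> < \<sigma>"
    then obtain n where "\<beta> < \<gamma> n" using \<sigma>(4) by blast
    then show "\<phi> \<beta> < \<sigma>" using less_trans[OF st(3)[of \<beta> n] \<sigma>(3)] by simp
  qed (fact \<sigma>(2))
  have mono: "le (g n) (g m)" if "n \<le> m" for n m
    using that by (induction m rule: dec_induct) (auto intro: le_refl g(1) le_trans[OF _ st(1)])
  have "\<forall>p\<in>range g. \<forall>p'\<in>range g. le p p' \<or> le p' p" using mono nat_le_linear by blast
  then have "\<exists>u\<in>pos. (\<forall>p\<in>range g. le p u) \<and> D u = \<Union> (D ` range g)"
    by (intro chain_bound) (use g(1) in auto)
  then obtain u where u: "u \<in> pos" "\<forall>p\<in>range g. le p u" "D u = \<Union> (D ` range g)"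
    by (elim bexE conjE)
  have gu: "le (g n) u" for n using u(2) by simp
  have uz: "lt t v z" if "v \<in> D u" for v
  proof -
    from that obtain n where n: "v \<in> D (g n)" unfolding u(3) by blast
    then have "v \<in> nodes t" "lt t v (w n)" using D_nodes[OF g(1)] g(3) by blast+
    then show ?thesis using tree_trans[OF tree _ w(1) zn _ w(3)] by blast
  qed
  \<comment> \<open>An empty move at \<open>z\<close>: the union of the \<omega> positions has no
    last node, while the next use needs one in a level set.\<close>
  obtain h2 where h2: "h2 \<in> pos" "le u h2" "ends h2 z"
    by (rule play_left[OF u(1) zn ballI[OF uz] empty_subsetI small_empty])
  have leh: "le h h2" "le (g n) h2" for n
    using le_trans[OF g(2) le_trans[OF gu h2(2)]] le_trans[OF gu h2(2)] by auto
  note fn = Q_iff(1)[OF h2(1) zn ends_le[OF h2(3)]]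
  have "\<exists>d\<in>succs I1 \<nu>. \<delta> \<le> rD d \<and> rD d < \<sigma> \<and> (c, d) \<in> Q h2"
    if c: "c \<in> C" "\<delta> \<le> rC c" "rC c < \<sigma>" for c
  proof -
    obtain n where n: "rC c < \<gamma> n" using \<sigma>(4)[OF c(3)] by blast
    obtain d where d: "d \<in> succs I1 \<nu>" "rD d < \<gamma> (Suc n)" "(c, d) \<in> Q (g (Suc n))"
      using st(4)[OF c(1) n] by blast
    have cd: "(c, d) \<in> Q h2" using le_Q[OF h2(1) leh(2)] d(3) by blast
    have "\<delta> \<le> rD d"
    proof (rule ccontr)
      assume "\<not> \<delta> \<le> rD d"
      then obtain c' where c': "c' \<in> succs I0 \<eta>" "rC c' < \<delta>" "(c', d) \<in> Q h"
        using matched[OF d(1)] unfolding not_le by blast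
      then have "(c', d) \<in> Q h2" using le_Q[OF h2(1) leh(1)] by blast
      then have "c' = c" using fn[OF cd] by blast
      then show False using c' c by simp
    qed
    then show ?thesis using d cd less_trans[OF d(2) \<sigma>(3)] by blast
  qed
  then show ?thesis
    using \<sigma>(1) cl h2 leh(1) z le_less_trans[OF \<gamma>(1) \<sigma>(3)] unfolding C_def by blast
qed

end

lemma ordinal_recursion_exists:
  fixes H :: "('o::wellorder \<Rightarrow> 'b) \<Rightarrow> 'o \<Rightarrow> 'b"
  assumes "\<And>f g i. (\<And>j. j < i \<Longrightarrow> f j = g j) \<Longrightarrow> H f i = H g i"
  shows "\<exists>f. \<forall>i. f i = H f i"
proof (rule wf_recursion_exists)
  show "wf {(x, y :: 'o). x < y}" by (rule wf)
  fix f g :: "'o \<Rightarrow> 'b" and i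
  assume "\<And>j. (j, i) \<in> {(x, y). x < y} \<Longrightarrow> f j = g j"
  then show "H f i = H g i" by (intro assms) simp
qed

text \<open>Immediate successors of one node share their predecessors and hence lie in a single
  class of \<open>tree_sim\<close>. Its size below the successor cardinal of \<lambda> means at most
  \<lambda>.\<close>

lemma succs_index:
  assumes "bounded_height_tree lam \<kappa> T" "\<eta> \<in> nodes T"
  shows "\<exists>r. inj_on r (succs T \<eta>) \<and> r ` succs T \<eta> \<subseteq> {..<lam}"
proof (cases "succs T \<eta> = {}")
  case False
  then obtain c where c: "c \<in> succs T \<eta>" by blast
  have T: "is_tree T" "|sim_class T c| <o cardSuc |{..<lam}|"
    using assms c by (auto simp: bounded_height_tree_def succ_card_tree_def succs_def)
  have "succs T \<eta> \<subseteq> sim_class T c"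
    using preds_succs[OF T(1) assms(2)] c by (auto simp: sim_class_def tree_sim_def succs_def[of T \<eta>])
  from ordLeq_ordLess_trans[OF card_of_mono1[OF this] T(2)]
  have "|succs T \<eta>| \<le>o |{..<lam}|"
    using cardSuc_ordLeq_ordLess[OF card_of_Card_order card_of_Card_order] by blast
  then show ?thesis using card_of_ordLeq[of "succs T \<eta>" "{..<lam}"] by blast
qed simp

section \<open>Injections and bijections between sets of successors\<close>

context game
begin

text \<open>The interval that contains the index of \<open>c\<close> decides which play answers
  \<open>c\<close>, and the answer has its index in the same interval. Equal answers therefore come
  from the same interval, that is from the same play, where pairs are one-to-one. The two plays
  behind each interval lead to the level set two steps above.\<close>

lemma succs_injection:
  assumes h: "h \<in> pos" "ends h x" and \<xi>: "\<xi> < \<kappa>" "x \<in> E \<xi>" and Q: "(\<eta>, \<nu>) \<in> Q h"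
  shows "\<exists>F. inj_on F (succs I0 \<eta>) \<and> F ` succs I0 \<eta> \<subseteq> succs I1 \<nu> \<and>
    (\<forall>c\<in>succs I0 \<eta>. \<exists>h2\<in>pos. le h h2 \<and> (\<exists>z\<in>E (ord_suc (ord_suc \<xi>)). ends h2 z) \<and> (c, F c) \<in> Q h2)"
proof -
  have xn: "x \<in> nodes t" using E_node[OF \<xi>(2)] \<xi>(1) by simp
  have \<eta>\<nu>: "\<eta> \<in> nodes I0" "\<nu> \<in> nodes I1" using Q_nodes[OF h(1) xn ends_le[OF h(2)] Q] by auto
  obtain rC where rC: "inj_on rC (succs I0 \<eta>)" "rC ` succs I0 \<eta> \<subseteq> {..<lam}"
    using succs_index[OF I0 \<eta>\<nu>(1)] by blast
  obtain rD where rD: "inj_on rD (succs I1 \<nu>)" "rD ` succs I1 \<nu> \<subseteq> {..<lam}"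
    using succs_index[OF I1 \<eta>\<nu>(2)] by blast
  define good where "good \<delta> \<longleftrightarrow> (\<exists>h1\<in>pos. le h h1 \<and> (\<exists>z\<in>E (ord_suc \<xi>). ends h1 z) \<and>
       (\<forall>d\<in>succs I1 \<nu>. rD d < \<delta> \<longrightarrow> (\<exists>c\<in>succs I0 \<eta>. rC c < \<delta> \<and> (c, d) \<in> Q h1)))" for \<delta>
  obtain \<phi> where "\<forall>\<beta><lam. \<phi> \<beta> < lam" "\<forall>\<delta><lam. closed_under \<phi> \<delta> \<longrightarrow> good \<delta>"
    using closed_play[OF h \<xi> Q rC(2) rD(1)] unfolding good_def[symmetric] by (elim exE conjE)
  then have \<phi>: "\<And>\<beta>. \<beta> < lam \<Longrightarrow> \<phi> \<beta> < lam"
    and \<phi>_good: "\<And>\<delta>. \<delta> < lam \<Longrightarrow> closed_under \<phi> \<delta> \<Longrightarrow> good \<delta>" by simp_all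
  define cand where "cand \<delta> \<longleftrightarrow> \<delta> < lam \<and> (closed_under \<phi> \<delta> \<or> \<delta> = ord_zero)" for \<delta>
  have good_zero: "good ord_zero"
  proof -
    obtain z where z: "z \<in> E (ord_suc \<xi>)" "z \<in> nodes t" "lt t x z" using next_above[OF \<xi>] by blast
    have "\<forall>w\<in>D h. lt t w z" using ends_less[OF h xn z(2,3)] by blast
    then obtain h1 where "h1 \<in> pos" "le h h1" "ends h1 z"
      by (rule play_left[OF h(1) z(2) _ empty_subsetI small_empty])
    then show ?thesis using z(1) ord_zero_le unfolding good_def by (metis not_le)
  qed
  define int where "int \<delta> \<delta>' h2 \<longleftrightarrow> \<delta>' < lam \<and> \<delta> < \<delta>' \<and> closed_under \<phi> \<delta>' \<and> h2 \<in> pos \<and> le h h2 \<and>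
     (\<exists>z\<in>E (ord_suc (ord_suc \<xi>)). ends h2 z) \<and>
     (\<forall>c\<in>succs I0 \<eta>. \<delta> \<le> rC c \<and> rC c < \<delta>' \<longrightarrow>
        (\<exists>d\<in>succs I1 \<nu>. \<delta> \<le> rD d \<and> rD d < \<delta>' \<and> (c, d) \<in> Q h2))" for \<delta> \<delta>' h2
  have "\<exists>\<delta>' h2. int \<delta> \<delta>' h2" if "cand \<delta>" for \<delta>
  proof -
    have \<delta>: "\<delta> < lam" "good \<delta>" using that \<phi>_good good_zero by (auto simp: cand_def)
    then obtain h1 z where h1: "h1 \<in> pos" "le h h1" "z \<in> E (ord_suc \<xi>)" "ends h1 z"
      and m: "\<And>d. d \<in> succs I1 \<nu> \<Longrightarrow> rD d < \<delta> \<Longrightarrow> \<exists>c\<in>succs I0 \<eta>. rC c < \<delta> \<and> (c, d) \<in> Q h1"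
      unfolding good_def by blast
    have Q1: "(\<eta>, \<nu>) \<in> Q h1" using le_Q[OF h1(1,2)] Q by blast
    obtain \<delta>' h2 where "\<delta>' < lam" "\<delta> < \<delta>'" "closed_under \<phi> \<delta>'" "h2 \<in> pos" "le h1 h2"
      "\<exists>z\<in>E (ord_suc (ord_suc \<xi>)). ends h2 z"
      "\<forall>c\<in>succs I0 \<eta>. \<delta> \<le> rC c \<and> rC c < \<delta>' \<longrightarrow>
        (\<exists>d\<in>succs I1 \<nu>. \<delta> \<le> rD d \<and> rD d < \<delta>' \<and> (c, d) \<in> Q h2)"
      using interval_play[where h = h1 and x = z and \<xi> = "ord_suc \<xi>" and \<phi> = \<phi> and \<delta> = \<delta>,
          OF h1(1,4) \<kappa>_suc[OF \<xi>(1)] h1(3) Q1 rC(1) rD(2) \<phi> \<delta>(1) m] by blast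
    then have "int \<delta> \<delta>' h2" unfolding int_def using le_trans[OF h1(2)] by blast
    then show ?thesis by blast
  qed
  then have "\<forall>\<delta>. \<exists>\<delta>' h2. cand \<delta> \<longrightarrow> int \<delta> \<delta>' h2" by blast
  then obtain N where "\<forall>\<delta>. \<exists>h2. cand \<delta> \<longrightarrow> int \<delta> (N \<delta>) h2" by (rule exE[OF choice])
  then obtain H where NH: "\<forall>\<delta>. cand \<delta> \<longrightarrow> int \<delta> (N \<delta>) (H \<delta>)" by (rule exE[OF choice])
  have N: "N \<delta> < lam" "\<delta> < N \<delta>" "closed_under \<phi> (N \<delta>)" "H \<delta> \<in> pos" "le h (H \<delta>)"
      "\<exists>z\<in>E (ord_suc (ord_suc \<xi>)). ends (H \<delta>) z"
      "\<forall>c\<in>succs I0 \<eta>. \<delta> \<le> rC c \<and> rC c < N \<delta> \<longrightarrow>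
        (\<exists>d\<in>succs I1 \<nu>. \<delta> \<le> rD d \<and> rD d < N \<delta> \<and> (c, d) \<in> Q (H \<delta>))" if "cand \<delta>" for \<delta>
    using NH that unfolding int_def by simp_all
  \<comment> \<open>Each left endpoint is the least upper bound of all earlier right endpoints; for
    \<open>i\<close> zero this gives zero.\<close>
  have "\<exists>s. \<forall>i :: 'o. s i = (LEAST \<delta>. \<forall>j<i. N (s j) \<le> \<delta>)"
    by (rule ordinal_recursion_exists[where H = "\<lambda>s i. LEAST \<delta>. \<forall>j<i. N (s j) \<le> \<delta>"]) simp
  then obtain s where s: "\<And>i :: 'o. s i = (LEAST \<delta>. \<forall>j<i. N (s j) \<le> \<delta>)" by blast
  have cand: "cand (s i) \<and> (\<forall>j<i. N (s j) \<le> s i)" if "i < lam" for i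
    using that
  proof (induction i rule: less_induct)
    case (less i)
    have IH: "cand (s j)" if "j < i" for j using less that by (meson less_trans)
    have "(\<lambda>j. N (s j)) ` {..<i} \<subseteq> {..<lam}" using N(1)[OF IH] by auto
    then obtain \<beta> where \<beta>: "\<beta> < lam" "\<forall>x\<in>(\<lambda>j. N (s j)) ` {..<i}. x < \<beta>"
      using bounded[OF _ small_image[OF small_initial[OF lam less.prems]]] by blast
    then have "\<forall>j<i. N (s j) \<le> \<beta>" by (auto simp: less_imp_le)
    then have ub: "\<forall>j<i. N (s j) \<le> s i" and le: "s i \<le> \<beta>"
      using LeastI[of "\<lambda>\<delta>. \<forall>j<i. N (s j) \<le> \<delta>" \<beta>] Least_le[of "\<lambda>\<delta>. \<forall>j<i. N (s j) \<le> \<delta>" \<beta>] s[of i]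
      by simp_all
    have below: "\<exists>j<i. \<alpha> < N (s j)" if "\<alpha> < s i" for \<alpha>
      using not_less_Least[of \<alpha> "\<lambda>\<delta>. \<forall>j<i. N (s j) \<le> \<delta>"] that s[of i] by (auto simp: not_le)
    \<comment> \<open>Either the supremum is one of the right endpoints, which are closed by choice,
      or it is a proper limit of them and inherits closure.\<close>
    have "closed_under \<phi> (s i)" if nz: "s i \<noteq> ord_zero"
    proof (cases "\<exists>j<i. N (s j) = s i")
      case True
      then show ?thesis using N(3)[OF IH] by metis
    next
      case False
      then have lt: "N (s j) < s i" if "j < i" for j using ub that by (auto simp: less_le)
      have "ord_zero < s i" using nz ord_zero_le[of "s i"] by (auto simp: less_le)
      moreover have "\<phi> \<alpha> < s i" if \<alpha>: "\<alpha> < s i" for \<alpha>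
      proof -
        obtain j where j: "j < i" "\<alpha> < N (s j)" using below[OF \<alpha>] by blast
        have "\<phi> \<alpha> < N (s j)" by (rule closed_underD[OF N(3)[OF IH[OF j(1)]] j(2)])
        then show ?thesis using lt[OF j(1)] by (rule less_trans)
      qed
      ultimately show ?thesis unfolding closed_under_def limit_ord_def using below lt by blast
    qed
    then show ?case using ub le \<beta>(1) by (auto simp: cand_def)
  qed
  have i_le: "i \<le> s i" if "i < lam" for i
    using that
  proof (induction i rule: less_induct)
    case (less i)
    have "j < s i" if "j < i" for j
      using less.IH[OF that less_trans[OF that less.prems]] N(2)[OF conjunct1[OF cand[OF less_trans[OF that less.prems]]]]
        cand[OF less.prems] that by (meson le_less_trans less_le_trans)
    then show ?case by (meson less_irrefl not_le)
  qed
  have cover: "\<exists>i<lam. s i \<le> \<gamma> \<and> \<gamma> < N (s i)" if "\<gamma> < lam" for \<gamma>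
  proof -
    \<comment> \<open>Such an \<open>i\<close> exists because \<gamma> \<le>
      \<open>s \<gamma>\<close> < \<open>N (s \<gamma>)\<close>. At the least one, \<gamma> bounds
      all earlier right endpoints and so is not below \<open>s i\<close>.\<close>
    define i where "i = (LEAST i. \<gamma> < N (s i))"
    have "\<gamma> < N (s \<gamma>)" using i_le[OF that] N(2) cand[OF that] le_less_trans by blast
    then have "\<gamma> < N (s i)" "i \<le> \<gamma>"
      unfolding i_def by (rule LeastI, rule Least_le)
    moreover have "\<forall>j<i. N (s j) \<le> \<gamma>" using not_less_Least unfolding i_def by (metis not_le)
    then have "s i \<le> \<gamma>" unfolding s[of i] by (rule Least_le)
    ultimately show ?thesis using that by (auto intro: le_less_trans)
  qed
  have disj: "i = j" if "i < lam" "j < lam" "s i \<le> \<gamma>" "\<gamma> < N (s i)" "s j \<le> \<gamma>" "\<gamma> < N (s j)" for i j \<gamma>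
  proof (rule linorder_cases[of i j])
    assume "i < j"
    then have "N (s i) \<le> s j" using cand[OF that(2)] by blast
    then show ?thesis using that by simp
  next
    assume "j < i"
    then have "N (s j) \<le> s i" using cand[OF that(1)] by blast
    then show ?thesis using that by simp
  qed
  have "\<exists>i d. i < lam \<and> s i \<le> rC c \<and> d \<in> succs I1 \<nu> \<and> s i \<le> rD d \<and> rD d < N (s i) \<and> (c, d) \<in> Q (H (s i))"
    if c: "c \<in> succs I0 \<eta>" for c
  proof -
    have "rC c < lam" using rC(2) c by blast
    then obtain i where i: "i < lam" "s i \<le> rC c" "rC c < N (s i)" using cover by blast
    then show ?thesis using N(7)[OF conjunct1[OF cand[OF i(1)]]] c by blast
  qed
  then have "\<forall>c. \<exists>i d. c \<in> succs I0 \<eta> \<longrightarrow> i < lam \<and> d \<in> succs I1 \<nu> \<and> s i \<le> rD d \<and> rD d < N (s i) \<and> (c, d) \<in> Q (H (s i))"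
    by blast
  then obtain i where "\<forall>c. \<exists>d. c \<in> succs I0 \<eta> \<longrightarrow> i c < lam \<and> d \<in> succs I1 \<nu> \<and>
      s (i c) \<le> rD d \<and> rD d < N (s (i c)) \<and> (c, d) \<in> Q (H (s (i c)))" by (rule exE[OF choice])
  then obtain F where F: "\<forall>c. c \<in> succs I0 \<eta> \<longrightarrow> i c < lam \<and> F c \<in> succs I1 \<nu> \<and>
      s (i c) \<le> rD (F c) \<and> rD (F c) < N (s (i c)) \<and> (c, F c) \<in> Q (H (s (i c)))" by (rule exE[OF choice])
  have "inj_on F (succs I0 \<eta>)"
  proof (rule inj_onI)
    fix c c' assume c: "c \<in> succs I0 \<eta>" "c' \<in> succs I0 \<eta>" "F c = F c'"
    note Fc = F[rule_format, OF c(1)] and Fc' = F[rule_format, OF c(2)]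
    have eq: "i c = i c'" using disj[of "i c" "i c'" "rD (F c)"] Fc Fc' c(3) by simp
    have cd: "cand (s (i c))" using cand Fc by blast
    obtain z where z: "z \<in> E (ord_suc (ord_suc \<xi>))" "ends (H (s (i c))) z" using N(6)[OF cd] by blast
    have zn: "z \<in> nodes t" using E_node[OF z(1)] \<kappa>_suc[OF \<kappa>_suc[OF \<xi>(1)]] by simp
    show "c = c'"
      using Q_iff(1)[OF N(4)[OF cd] zn ends_le[OF z(2)], of c "F c" c' "F c'"] Fc Fc' eq c(3) by simp
  qed
  moreover have "F ` succs I0 \<eta> \<subseteq> succs I1 \<nu>" using F by blast
  moreover have "\<exists>h2\<in>pos. le h h2 \<and> (\<exists>z\<in>E (ord_suc (ord_suc \<xi>)). ends h2 z) \<and> (c, F c) \<in> Q h2"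
    if "c \<in> succs I0 \<eta>" for c
  proof -
    have Fc: "i c < lam" "(c, F c) \<in> Q (H (s (i c)))" using F that by auto
    have "cand (s (i c))" using cand[OF Fc(1)] by blast
    from N(4-6)[OF this] Fc(2) show ?thesis by blast
  qed
  ultimately show ?thesis by blast
qed

text \<open>Being matched in some extension of \<open>h\<close> is a relation that reads the same in
  the swapped game. Both injections lie inside it, so the bijection assembled from them does too,
  although no single play realizes it.\<close>

lemma succs_bijection:
  assumes h: "h \<in> pos" "ends h x" and \<xi>: "\<xi> < \<kappa>" "x \<in> E \<xi>" and Q: "(\<eta>, \<nu>) \<in> Q h"
  shows "\<exists>b. bij_betw b (succs I0 \<eta>) (succs I1 \<nu>) \<and>
    (\<forall>c\<in>succs I0 \<eta>. \<exists>h2\<in>pos. le h h2 \<and> (\<exists>z\<in>E (ord_suc (ord_suc \<xi>)). ends h2 z) \<and> (c, b c) \<in> Q h2)"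
proof -
  interpret swap: game lam \<kappa> t e E I1 I0 pos D le "\<lambda>p. (Q p)\<inverse>" extR extL
    by (rule swapped)
  define R where "R c d \<longleftrightarrow> (\<exists>h2\<in>pos. le h h2 \<and> (\<exists>z\<in>E (ord_suc (ord_suc \<xi>)). ends h2 z) \<and> (c, d) \<in> Q h2)" for c d
  obtain F where F: "inj_on F (succs I0 \<eta>)" "F ` succs I0 \<eta> \<subseteq> succs I1 \<nu>" "\<forall>c\<in>succs I0 \<eta>. R c (F c)"
    using succs_injection[OF h \<xi> Q] unfolding R_def[symmetric] by (elim exE conjE)
  have "\<exists>G. inj_on G (succs I1 \<nu>) \<and> G ` succs I1 \<nu> \<subseteq> succs I0 \<eta> \<and> (\<forall>d\<in>succs I1 \<nu>. R (G d) d)"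
    using swap.succs_injection[unfolded converse_iff, OF h \<xi> Q] unfolding R_def .
  then obtain G where G: "inj_on G (succs I1 \<nu>)" "G ` succs I1 \<nu> \<subseteq> succs I0 \<eta>" "\<forall>d\<in>succs I1 \<nu>. R (G d) d"
    by (elim exE conjE)
  show ?thesis
    unfolding R_def[symmetric]
    by (rule relational_Schroeder_Bernstein[OF F(1,2) _ G(1,2)]) (simp_all add: F(3) G(3))
qed

end

section \<open>Levels\<close>

text \<open>Levels advance by two at every step, since a move from one level of \<open>I0\<close> to the next
  uses up two of the sets \<open>E \<xi>\<close>.\<close>

definition level :: "'a tree \<Rightarrow> 'a \<Rightarrow> 'o::wellorder" where
  "level T = (SOME f. \<forall>x. f x = (LEAST \<xi>. \<forall>y. (y, x) \<in> tree_less T \<longrightarrow> ord_suc (ord_suc (f y)) \<le> \<xi>))"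

lemma level_eq:
  assumes T: "is_tree T" and x: "x \<in> nodes T"
  shows "level T x = (LEAST \<xi> :: 'o::wellorder. \<forall>y\<in>preds T x. ord_suc (ord_suc (level T y)) \<le> \<xi>)"
proof -
  have "\<exists>f :: 'a \<Rightarrow> 'o. \<forall>x. f x = (LEAST \<xi>. \<forall>y. (y, x) \<in> tree_less T \<longrightarrow> ord_suc (ord_suc (f y)) \<le> \<xi>)"
    by (rule wf_recursion_exists[OF wf_tree_less[OF T],
          where H = "\<lambda>f x. LEAST \<xi>. \<forall>y. (y, x) \<in> tree_less T \<longrightarrow> ord_suc (ord_suc (f y)) \<le> \<xi>"]) simp
  then have "\<forall>x. (level T x :: 'o) = (LEAST \<xi>. \<forall>y. (y, x) \<in> tree_less T \<longrightarrow> ord_suc (ord_suc (level T y)) \<le> \<xi>)"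
    unfolding level_def by (rule someI_ex)
  then have "(level T x :: 'o) = (LEAST \<xi>. \<forall>y. (y, x) \<in> tree_less T \<longrightarrow> ord_suc (ord_suc (level T y)) \<le> \<xi>)"
    by (rule spec)
  moreover have "(y, x) \<in> tree_less T \<longleftrightarrow> y \<in> preds T x" for y
    using x by (auto simp: tree_less_def preds_def)
  ultimately show ?thesis unfolding Ball_def by (simp only:)
qed

text \<open>Being an immediate successor depends on \<open>y\<close> only through its predecessors,
  so nodes equivalent under \<open>tree_sim\<close> have the same immediate predecessor, if
  any.\<close>

lemma succs_iff_preds:
  assumes T: "is_tree T" and x: "x \<in> nodes T" "y \<in> nodes T"
  shows "y \<in> succs T x \<longleftrightarrow> preds T y = insert x (preds T x)"
proof
  assume "y \<in> succs T x" then show "preds T y = insert x (preds T x)" by (rule preds_succs[OF T x(1)])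
next
  assume *: "preds T y = insert x (preds T x)"
  have "x \<in> preds T y" unfolding * by simp
  then have "lt T x y" by (simp add: preds_def)
  moreover have False if z: "z \<in> nodes T" "lt T x z" "lt T z y" for z
  proof -
    have "z \<in> insert x (preds T x)" using z unfolding *[symmetric] by (simp add: preds_def)
    then show False
      using z(2) tree_irrefl[OF T x(1)] tree_trans[OF T x(1) z(1) x(1) z(2)] by (auto simp: preds_def)
  qed
  ultimately show "y \<in> succs T x" using x by (auto simp: succs_def)
qed

context
  fixes lam \<kappa> :: "'o::wellorder" and T :: "'a tree"
  assumes \<kappa>: "regular_cardinal \<kappa>" and T: "bounded_height_tree lam \<kappa> T"
begin

lemma level_suc_less:
  assumes "\<xi> < \<kappa>"
  shows "ord_suc (ord_suc \<xi>) < \<kappa>" "\<xi> < ord_suc (ord_suc \<xi>)"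
  using assms limit_ord_suc_less[OF regular_limit_ord[OF \<kappa>]] less_ord_suc
  by (blast, blast intro: less_trans)

text \<open>An embedding of the predecessors of \<open>x\<close> into \<kappa> shows that each of
  them has fewer than \<kappa> predecessors. By induction, and as \<kappa> is regular, their levels
  have a bound below \<kappa>.\<close>

lemma level_preds_less:
  assumes x: "x \<in> nodes T" and y: "y \<in> preds T x"
  shows "(level T y :: 'o) < \<kappa>"
proof -
  have tree: "is_tree T" using T by (simp add: bounded_height_tree_def succ_card_tree_def)
  have F: "Field (tree_rel T A) = A" for A by (auto simp: Field_def tree_rel_def)
  have "tree_rel T (preds T x) \<le>o ord_rel {..<\<kappa>}" using T x by (simp add: bounded_height_tree_def)
  then obtain \<rho> where wo: "Well_order (tree_rel T (preds T x))"
    and emb: "embed (tree_rel T (preds T x)) (ord_rel {..<\<kappa>}) \<rho>"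
    by (auto simp: ordLeq_def)
  have inj: "inj_on \<rho> (preds T x)" using embed_inj_on[OF wo emb] by (simp add: F)
  have range: "\<rho> ` preds T x \<subseteq> {..<\<kappa>}" using embed_Field[OF emb] by (simp add: F)
  have mono: "\<rho> a < \<rho> b" if "a \<in> preds T x" "b \<in> preds T x" "lt T a b" for a b
  proof -
    have "(a, b) \<in> tree_rel T (preds T x)" using that by (simp add: tree_rel_def)
    then have "\<rho> a \<le> \<rho> b" using embed_compat[OF emb] by (auto simp: compat_def ord_rel_iff)
    moreover have "a \<noteq> b" using that tree_irrefl[OF tree] by (auto simp: preds_def)
    ultimately show ?thesis using inj_onD[OF inj _ that(1,2)] by (auto simp: less_le)
  qed
  show ?thesis
    using y
  proof (induction y rule: wf_induct_rule[OF wf_tree_less[OF tree]])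
    case (1 y)
    have yn: "y \<in> nodes T" "lt T y x" using 1(2) by (auto simp: preds_def)
    have sub: "preds T y \<subseteq> preds T x" using tree_trans[OF tree _ yn(1) x _ yn(2)] by (auto simp: preds_def)
    have IH: "(level T v :: 'o) < \<kappa>" if "v \<in> preds T y" for v
      using 1(1)[of v] that sub yn by (auto simp: tree_less_def preds_def)
    have "\<rho> y < \<kappa>" using range 1(2) by auto
    from small_initial[OF \<kappa> this] have "|preds T y| <o |{..<\<kappa>}|"
      by (rule small_inj[OF inj_on_subset[OF inj sub], rotated]) (use mono sub 1(2) in \<open>auto simp: preds_def\<close>)
    then have "|(\<lambda>v. ord_suc (ord_suc (level T v)) :: 'o) ` preds T y| <o |{..<\<kappa>}|" by (rule small_image)
    moreover have "(\<lambda>v. ord_suc (ord_suc (level T v)) :: 'o) ` preds T y \<subseteq> {..<\<kappa>}"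
      using level_suc_less(1)[OF IH] by auto
    ultimately obtain \<beta> where "\<beta> < \<kappa>" "\<forall>a\<in>(\<lambda>v. ord_suc (ord_suc (level T v)) :: 'o) ` preds T y. a < \<beta>"
      using regular_bounded[OF \<kappa>] by blast
    then have "(level T y :: 'o) \<le> \<beta>"
      unfolding level_eq[OF tree yn(1)] by (intro Least_le) (auto simp: less_imp_le)
    then show ?case using \<open>\<beta> < \<kappa>\<close> by simp
  qed
qed

lemma level_le: "x \<in> nodes T \<Longrightarrow> (level T x :: 'o) \<le> \<kappa>"
  and suc_level_le: "x \<in> nodes T \<Longrightarrow> y \<in> preds T x \<Longrightarrow> ord_suc (ord_suc (level T y)) \<le> (level T x :: 'o)"
proof -
  assume x: "x \<in> nodes T"
  have tree: "is_tree T" using T by (simp add: bounded_height_tree_def succ_card_tree_def)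
  \<comment> \<open>With \<kappa> as an upper bound, the \<open>LEAST\<close> of
    \<open>level_eq\<close> is attained and is itself an upper bound.\<close>
  have ub: "\<forall>y\<in>preds T x. ord_suc (ord_suc (level T y)) \<le> \<kappa>"
    using level_suc_less(1)[OF level_preds_less[OF x]] by (auto simp: less_imp_le)
  then show "(level T x :: 'o) \<le> \<kappa>" unfolding level_eq[OF tree x] by (rule Least_le)
  show "ord_suc (ord_suc (level T y)) \<le> (level T x :: 'o)" if "y \<in> preds T x"
    using LeastI[of "\<lambda>\<xi>. \<forall>y\<in>preds T x. ord_suc (ord_suc (level T y)) \<le> \<xi>", OF ub] that
    unfolding level_eq[OF tree x] by blast
qed

lemma level_succs:
  assumes x: "x \<in> nodes T" and y: "y \<in> succs T x"
  shows "(level T y :: 'o) = ord_suc (ord_suc (level T x))"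
proof (rule antisym)
  have tree: "is_tree T" using T by (simp add: bounded_height_tree_def succ_card_tree_def)
  have yn: "y \<in> nodes T" using y by (simp add: succs_def)
  have p: "preds T y = insert x (preds T x)" by (rule preds_succs[OF tree x y])
  have x\<kappa>: "(level T x :: 'o) < \<kappa>" by (rule level_preds_less[OF yn]) (simp add: p)
  show "ord_suc (ord_suc (level T x)) \<le> (level T y :: 'o)" by (rule suc_level_le[OF yn]) (simp add: p)
  show "(level T y :: 'o) \<le> ord_suc (ord_suc (level T x))"
    unfolding level_eq[OF tree yn]
  proof (rule Least_le, intro ballI)
    fix v assume "v \<in> preds T y"
    then have "v = x \<or> v \<in> preds T x" by (simp add: p)
    then show "ord_suc (ord_suc (level T v)) \<le> (ord_suc (ord_suc (level T x)) :: 'o)"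
      using suc_level_le[OF x, of v] level_suc_less(2)[OF x\<kappa>] by auto
  qed
qed

end

section \<open>Recursion along the levels of the first tree\<close>

context game
begin

text \<open>The invariant of the recursion. A position is demanded only below level \<kappa>: a node
  of level \<kappa> has nothing above it, so no later match has to extend its position, and the tree
  \<open>t\<close> need not have room for testing it.\<close>

definition coherent :: "('a \<Rightarrow> 'b) \<Rightarrow> ('a \<Rightarrow> 'p) \<Rightarrow> 'a \<Rightarrow> bool" where
  "coherent f h a \<longleftrightarrow> a \<in> nodes I0 \<and> f a \<in> nodes I1 \<and> preds I1 (f a) = f ` preds I0 a \<and>
     (level I1 (f a) :: 'o) = level I0 a \<and>
     ((level I0 a :: 'o) < \<kappa> \<longrightarrow> h a \<in> pos \<and> (\<exists>x\<in>E (level I0 a). ends (h a) x) \<and> (a, f a) \<in> Q (h a) \<and>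
        (\<forall>y\<in>preds I0 a. le (h y) (h a)))"

lemma coherentD:
  assumes "coherent f h a"
  shows "a \<in> nodes I0" "f a \<in> nodes I1" "preds I1 (f a) = f ` preds I0 a"
    "(level I1 (f a) :: 'o) = level I0 a"
    "(level I0 a :: 'o) < \<kappa> \<Longrightarrow> h a \<in> pos" "(level I0 a :: 'o) < \<kappa> \<Longrightarrow> \<exists>x\<in>E (level I0 a). ends (h a) x"
    "(level I0 a :: 'o) < \<kappa> \<Longrightarrow> (a, f a) \<in> Q (h a)"
    "(level I0 a :: 'o) < \<kappa> \<Longrightarrow> y \<in> preds I0 a \<Longrightarrow> le (h y) (h a)"
  using assms by (simp_all add: coherent_def)

text \<open>A matched initial segment without a last node, possibly empty, together with the level
  \<sigma> that a node directly above it has. It is stated for a set instead of a node, because the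
  segment may come from a node of \<open>I0\<close> or be pulled back from one of
  \<open>I1\<close>.\<close>

definition limit_chain :: "('a \<Rightarrow> 'b) \<Rightarrow> ('a \<Rightarrow> 'p) \<Rightarrow> 'a set \<Rightarrow> 'o \<Rightarrow> bool" where
  "limit_chain f h A \<sigma> \<longleftrightarrow> (\<forall>a\<in>A. coherent f h a \<and> (level I0 a :: 'o) < \<kappa> \<and> preds I0 a \<subseteq> A) \<and>
     (\<forall>a\<in>A. \<forall>b\<in>A. a = b \<or> lt I0 a b \<or> lt I0 b a) \<and> (\<forall>a\<in>A. \<exists>b\<in>A. lt I0 a b) \<and>
     \<sigma> \<le> \<kappa> \<and> (\<forall>a\<in>A. ord_suc (ord_suc (level I0 a)) \<le> \<sigma>) \<and>
     \<sigma> = (LEAST \<xi>. \<forall>a\<in>A. ord_suc (ord_suc (level I0 a)) \<le> \<xi>)"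

text \<open>The positions along \<open>A\<close> form a chain, and their end nodes increase.
  \<open>E_limit\<close> needs a node in every level set below \<sigma>, not only in those where
  some position ends; the missing ones are the unique nodes of these sets below the end nodes, and
  uniqueness makes them fit together.\<close>

lemma limit_position:
  assumes "limit_chain f h A \<sigma>"
  shows "\<exists>u\<in>pos. (\<exists>z\<in>E \<sigma>. \<forall>w\<in>D u. lt t w z) \<and> (\<forall>a\<in>A. le (h a) u)"
proof -
  note lc = assms[unfolded limit_chain_def]
  have coh: "\<And>a. a \<in> A \<Longrightarrow> coherent f h a" and lev: "\<And>a. a \<in> A \<Longrightarrow> (level I0 a :: 'o) < \<kappa>"
    using lc by blast+
  have tot: "\<And>a b. a \<in> A \<Longrightarrow> b \<in> A \<Longrightarrow> a = b \<or> lt I0 a b \<or> lt I0 b a"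
    using lc by blast
  have nomax: "\<And>a. a \<in> A \<Longrightarrow> \<exists>b\<in>A. lt I0 a b" using lc by (elim conjE) (rule bspec)
  have \<sigma>: "\<sigma> \<le> \<kappa>" "\<And>a. a \<in> A \<Longrightarrow> ord_suc (ord_suc (level I0 a)) \<le> \<sigma>" using lc by blast+
  have \<sigma>_eq: "\<sigma> = (LEAST \<xi>. \<forall>a\<in>A. ord_suc (ord_suc (level I0 a)) \<le> \<xi>)" using lc by (elim conjE)
  have An: "a \<in> nodes I0" if "a \<in> A" for a using coherentD(1)[OF coh[OF that]] .
  have hpos: "h a \<in> pos" if "a \<in> A" for a using coherentD(5)[OF coh[OF that] lev[OF that]] .
  have mono: "le (h a) (h b)" if "a \<in> A" "b \<in> A" "lt I0 a b" for a b
    using coherentD(8)[OF coh[OF that(2)] lev[OF that(2)]] that An by (auto simp: preds_def)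
  have lev_mono: "ord_suc (ord_suc (level I0 a)) \<le> (level I0 b :: 'o)" if "a \<in> A" "b \<in> A" "lt I0 a b" for a b
    by (rule suc_level_le[OF \<kappa> I0]) (use that An in \<open>auto simp: preds_def\<close>)
  have lev_less: "(level I0 a :: 'o) < level I0 b" if "a \<in> A" "b \<in> A" "lt I0 a b" for a b
    using less_le_trans[OF level_suc_less(2)[OF \<kappa> I0 lev[OF that(1)]] lev_mono[OF that]] .
  have ch: "\<forall>p\<in>h ` A. \<forall>p'\<in>h ` A. le p p' \<or> le p' p"
  proof (intro ballI)
    fix p p' assume "p \<in> h ` A" "p' \<in> h ` A"
    then obtain a b where "a \<in> A" "p = h a" "b \<in> A" "p' = h b" by blast
    then show "le p p' \<or> le p' p" using tot[of a b] mono[of a b] mono[of b a] le_refl[OF hpos] by auto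
  qed
  have "h ` A \<subseteq> pos" using hpos by blast
  from chain_bound[OF this ch]
  obtain u where u: "u \<in> pos" "\<forall>p\<in>h ` A. le p u" "D u = \<Union> (D ` h ` A)"
    by (elim bexE conjE)
  have "\<exists>z\<in>E \<sigma>. \<forall>w\<in>D u. lt t w z"
  proof (cases "A = {}")
    \<comment> \<open>The case of the root: no move has been made, and \<sigma> is zero, so any node
      of the first level set will do.\<close>
    case True
    then have "\<sigma> = ord_zero" unfolding \<sigma>_eq by (simp add: ord_zero_def)
    moreover have "D u = {}" unfolding u(3) True by simp
    ultimately show ?thesis using E_zero by auto
  next
    case False
    obtain z where z: "\<And>a. a \<in> A \<Longrightarrow> z a \<in> E (level I0 a) \<and> ends (h a) (z a)"
      using coherentD(6)[OF coh lev] by metis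
    have zn: "z a \<in> nodes t" if "a \<in> A" for a
      using E_node[OF conjunct1[OF z[OF that]]] lev[OF that] by simp
    have lev_\<sigma>: "(level I0 a :: 'o) < \<sigma>" if "a \<in> A" for a
      using less_le_trans[OF level_suc_less(2)[OF \<kappa> I0 lev[OF that]] \<sigma>(2)[OF that]] .
    have below: "\<exists>a\<in>A. \<zeta> < level I0 a" if "\<zeta> < \<sigma>" for \<zeta>
    proof -
      have "\<not> (\<forall>a\<in>A. ord_suc (ord_suc (level I0 a)) \<le> \<zeta>)"
        using not_less_Least[of \<zeta> "\<lambda>\<xi>. \<forall>a\<in>A. ord_suc (ord_suc (level I0 a)) \<le> \<xi>"] that by (simp add: \<sigma>_eq)
      then obtain a where a: "a \<in> A" "\<zeta> < ord_suc (ord_suc (level I0 a))" by (auto simp: not_le)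
      obtain b where b: "b \<in> A" "lt I0 a b" using nomax[OF a(1)] by blast
      show ?thesis using less_le_trans[OF a(2) lev_mono[OF a(1) b]] b(1) by blast
    qed
    have lim: "limit_ord \<sigma>"
      unfolding limit_ord_def using lev_\<sigma> below False by blast
    have z_mono: "lt t (z a) (z b)" if ab: "a \<in> A" "b \<in> A" "lt I0 a b" for a b
    proof -
      have "z a \<in> D (h b)" using z[OF ab(1)] le_D[OF mono[OF ab]] by (auto simp: ends_def)
      moreover have "z a \<noteq> z b"
        using E_disjoint[OF less_imp_le[OF lev[OF ab(1)]] less_imp_le[OF lev[OF ab(2)]]
            less_imp_neq[OF lev_less[OF ab]]] z[OF ab(1)] z[OF ab(2)] by (metis IntI emptyE)
      ultimately show ?thesis using z[OF ab(2)] by (auto simp: ends_def)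
    qed
    \<comment> \<open>Later end nodes lie above every level set with index below \<sigma>, so
      \<open>E_below\<close> supplies a node of \<open>E \<zeta>\<close> beneath one of
      them.\<close>
    have ex: "\<exists>y. y \<in> E \<zeta> \<and> (\<exists>a\<in>A. \<zeta> < level I0 a \<and> lt t y (z a))" if \<zeta>: "\<zeta> < \<sigma>" for \<zeta>
    proof -
      obtain a where a: "a \<in> A" "\<zeta> < level I0 a" using below[OF \<zeta>] by blast
      then show ?thesis using E_below[of "level I0 a" \<zeta> "z a"] z[OF a(1)] lev[OF a(1)] by (auto simp: less_imp_le)
    qed
    then have "\<forall>\<zeta>. \<exists>y. \<zeta> < \<sigma> \<longrightarrow> y \<in> E \<zeta> \<and> (\<exists>a\<in>A. \<zeta> < level I0 a \<and> lt t y (z a))" by blast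
    then obtain s where s: "\<forall>\<zeta>. \<zeta> < \<sigma> \<longrightarrow> s \<zeta> \<in> E \<zeta> \<and> (\<exists>a\<in>A. \<zeta> < level I0 a \<and> lt t (s \<zeta>) (z a))"
      by (rule exE[OF choice])
    have sE: "s \<zeta> \<in> E \<zeta>" "s \<zeta> \<in> nodes t" if "\<zeta> < \<sigma>" for \<zeta>
      using s that E_node[of "s \<zeta>" \<zeta>] \<sigma>(1) by auto
    have s_less: "lt t (s \<zeta>) (z a)" if \<zeta>: "\<zeta> < \<sigma>" and a: "a \<in> A" "\<zeta> < level I0 a" for \<zeta> a
    proof -
      obtain b where b: "b \<in> A" "\<zeta> < level I0 b" "lt t (s \<zeta>) (z b)" using s \<zeta> by blast
      consider "a = b" | "lt I0 b a" | "lt I0 a b" using tot[OF a(1) b(1)] by blast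
      then show ?thesis
      proof cases
        case 1 then show ?thesis using b(3) by simp
      next
        case 2
        show ?thesis by (rule tree_trans[OF tree sE(2)[OF \<zeta>] zn[OF b(1)] zn[OF a(1)] b(3) z_mono[OF b(1) a(1) 2]])
      next
        case 3
        have uniq: "\<exists>!y. y \<in> E \<zeta> \<and> lt t y (z b)"
          using E_below[of "level I0 b" \<zeta> "z b"] z[OF b(1)] lev[OF b(1)] b(2) by (auto simp: less_imp_le)
        obtain y where y: "y \<in> E \<zeta>" "lt t y (z a)"
          using E_below[of "level I0 a" \<zeta> "z a"] z[OF a(1)] lev[OF a(1)] a(2) by (auto simp: less_imp_le)
        have yn: "y \<in> nodes t" using E_node[OF y(1)] \<zeta> \<sigma>(1) by simp
        have "lt t y (z b)"
          by (rule tree_trans[OF tree yn zn[OF a(1)] zn[OF b(1)] y(2) z_mono[OF a(1) b(1) 3]])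
        then have "y = s \<zeta>" using uniq y(1) b(3) sE(1)[OF \<zeta>] by blast
        then show ?thesis using y(2) by simp
      qed
    qed
    have "increasing_seq t \<sigma> s"
      unfolding increasing_seq_def
    proof (intro conjI allI impI)
      fix \<zeta> assume "\<zeta> < \<sigma>" then show "s \<zeta> \<in> nodes t" by (rule sE(2))
    next
      fix \<zeta> \<zeta>' assume \<zeta>: "\<zeta> < \<zeta>' \<and> \<zeta>' < \<sigma>"
      then have \<zeta>\<sigma>: "\<zeta> < \<sigma>" "\<zeta> < \<zeta>'" "\<zeta>' < \<sigma>" by (auto intro: less_trans)
      obtain a where a: "a \<in> A" "\<zeta>' < level I0 a" using below[OF \<zeta>\<sigma>(3)] by blast
      have a': "\<zeta> < level I0 a" by (rule less_trans[OF \<zeta>\<sigma>(2) a(2)])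
      have "\<zeta>' \<le> \<kappa>" using less_le_trans[OF \<zeta>\<sigma>(3) \<sigma>(1)] by (rule less_imp_le)
      then obtain y where y: "y \<in> E \<zeta>" "lt t y (s \<zeta>')" using E_below[of \<zeta>' \<zeta> "s \<zeta>'"] \<zeta>\<sigma> sE(1) by blast
      have yn: "y \<in> nodes t" using E_node[OF y(1)] less_le_trans[OF \<zeta>\<sigma>(1) \<sigma>(1)] by (simp add: less_imp_le)
      have "lt t y (z a)"
        by (rule tree_trans[OF tree yn sE(2)[OF \<zeta>\<sigma>(3)] zn[OF a(1)] y(2) s_less[OF \<zeta>\<sigma>(3) a]])
      moreover have "\<exists>!y. y \<in> E \<zeta> \<and> lt t y (z a)"
        using E_below[of "level I0 a" \<zeta> "z a"] z[OF a(1)] lev[OF a(1)] a' by (auto simp: less_imp_le)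
      ultimately have "y = s \<zeta>" using y(1) sE(1)[OF \<zeta>\<sigma>(1)] s_less[OF \<zeta>\<sigma>(1) a(1) a'] by blast
      then show "lt t (s \<zeta>) (s \<zeta>')" using y(2) by simp
    qed
    moreover have "\<forall>\<zeta><\<sigma>. s \<zeta> \<in> E \<zeta>" using sE(1) by blast
    ultimately obtain y where y: "y \<in> E \<sigma>" "\<forall>\<zeta><\<sigma>. lt t (s \<zeta>) y" using E_limit[OF \<sigma>(1) lim] by blast
    have yn: "y \<in> nodes t" using E_node[OF y(1)] \<sigma>(1) by simp
    have "lt t w y" if "w \<in> D u" for w
    proof -
      obtain a where a: "a \<in> A" "w \<in> D (h a)" using \<open>w \<in> D u\<close> unfolding u(3) by blast
      obtain b where b: "b \<in> A" "lt I0 a b" using nomax[OF a(1)] by blast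
      let ?\<zeta> = "level I0 a :: 'o"
      have "\<exists>!y. y \<in> E ?\<zeta> \<and> lt t y (z b)"
        using E_below[of "level I0 b" ?\<zeta> "z b"] z[OF b(1)] lev[OF b(1)] lev_less[OF a(1) b]
        by (auto simp: less_imp_le)
      \<comment> \<open>At the level of \<open>a\<close> the selected node is the end node itself,
        again by uniqueness; so a bound of the sequence bounds all positions.\<close>
      then have "s ?\<zeta> = z a"
        using s_less[OF lev_\<sigma>[OF a(1)] b(1) lev_less[OF a(1) b]] sE(1)[OF lev_\<sigma>[OF a(1)]]
          z[OF a(1)] z_mono[OF a(1) b] by blast
      then have zy: "lt t (z a) y" using y(2) lev_\<sigma>[OF a(1)] by metis
      have "ends (h a) (z a)" using z[OF a(1)] by blast
      from ends_less[OF hpos[OF a(1)] this zn[OF a(1)] yn zy a(2)] show ?thesis .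
    qed
    then show ?thesis using y(1) by blast
  qed
  then show ?thesis using u(1,2) by blast
qed

lemma small_singleton: "small {a}"
  by (rule small_finite[OF lam]) simp

text \<open>The answer to \<eta> lies above the matched segment but perhaps not directly above it,
  so it is cut down to \<nu>'. If that changed it, a further move at \<nu>' would be answered below
  \<eta>, hence inside \<open>A\<close>, where all partners are known and none of them is
  \<nu>'.\<close>

lemma limit_answer:
  assumes lc: "limit_chain f h A \<sigma>" and \<eta>: "\<eta> \<in> nodes I0" "preds I0 \<eta> = A"
  shows "\<exists>\<nu>\<in>nodes I1. preds I1 \<nu> = f ` A \<and>
    (\<sigma> < \<kappa> \<longrightarrow> (\<exists>p\<in>pos. (\<exists>z\<in>E \<sigma>. ends p z) \<and> (\<eta>, \<nu>) \<in> Q p \<and> (\<forall>a\<in>A. le (h a) p)))"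
proof -
  have coh: "\<And>a. a \<in> A \<Longrightarrow> coherent f h a" and lev: "\<And>a. a \<in> A \<Longrightarrow> (level I0 a :: 'o) < \<kappa>"
    and down: "\<And>a. a \<in> A \<Longrightarrow> preds I0 a \<subseteq> A" and \<sigma>: "\<sigma> \<le> \<kappa>"
    using lc by (auto simp: limit_chain_def)
  obtain u z where u: "u \<in> pos" "z \<in> E \<sigma>" "\<forall>w\<in>D u. lt t w z" "\<forall>a\<in>A. le (h a) u"
    using limit_position[OF lc] by blast
  have zn: "z \<in> nodes t" using E_node[OF u(2) \<sigma>] .
  have "{\<eta>} \<subseteq> nodes I0" using \<eta>(1) by simp
  then obtain p where p: "p \<in> pos" "le u p" "ends p z" "{\<eta>} \<subseteq> Domain (Q p)"
    by (rule play_left[OF u(1) zn u(3) _ small_singleton])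
  note bd = p(1) zn ends_le[OF p(3)]
  obtain \<nu> where \<nu>: "(\<eta>, \<nu>) \<in> Q p" using p(4) by auto
  have \<nu>n: "\<nu> \<in> nodes I1" using Q_nodes[OF bd \<nu>] by blast
  have Qa: "(a, f a) \<in> Q p'" if "a \<in> A" "p' \<in> pos" "le p p'" for a p'
    using coherentD(7)[OF coh[OF that(1)] lev[OF that(1)]]
      le_Q[OF that(2) le_trans[OF bspec[OF u(4) that(1)] le_trans[OF p(2) that(3)]]] by blast
  have "f ` A \<subseteq> preds I1 \<nu>"
  proof
    fix b assume "b \<in> f ` A"
    then obtain a where a: "a \<in> A" "b = f a" by blast
    have "lt I0 a \<eta>" using a(1) \<eta>(2) by (auto simp: preds_def)
    then show "b \<in> preds I1 \<nu>"
      using Q_iff(2)[OF bd Qa[OF a(1) p(1) le_refl[OF p(1)]] \<nu>] coherentD(2)[OF coh[OF a(1)]] a(2)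
      by (simp add: preds_def)
  qed
  moreover have "preds I1 b \<subseteq> f ` A" if b: "b \<in> f ` A" for b
  proof -
    obtain a where a: "a \<in> A" "b = f a" using b by blast
    show ?thesis unfolding a(2) coherentD(3)[OF coh[OF a(1)]] using down[OF a(1)] by blast
  qed
  ultimately obtain \<nu>' where \<nu>': "\<nu>' \<in> nodes I1" "\<nu>' = \<nu> \<or> lt I1 \<nu>' \<nu>" "preds I1 \<nu>' = f ` A"
    using least_node_above[OF is_tree_I1 \<nu>n, of "f ` A"] by blast
  have "(\<eta>, \<nu>') \<in> Q p" if \<sigma>\<kappa>: "\<sigma> < \<kappa>"
  proof (rule ccontr)
    assume "(\<eta>, \<nu>') \<notin> Q p"
    then have less: "lt I1 \<nu>' \<nu>" using \<nu> \<nu>'(2) by auto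
    \<comment> \<open>Only for \<sigma> < \<kappa> is there a next level set, and with it room for
      the refuting move.\<close>
    obtain z' where z': "z' \<in> nodes t" "lt t z z'" using next_above[OF \<sigma>\<kappa> u(2)] by blast
    have "\<forall>w\<in>D p. lt t w z'" using ends_less[OF p(1,3) zn z'] by blast
    moreover have "{\<nu>'} \<subseteq> nodes I1" using \<nu>'(1) by simp
    ultimately obtain p' where p': "p' \<in> pos" "le p p'" "ends p' z'" "{\<nu>'} \<subseteq> Range (Q p')"
      by (rule play_right[OF p(1) z'(1) _ _ small_singleton])
    note bd' = p'(1) z'(1) ends_le[OF p'(3)]
    obtain \<eta>' where \<eta>': "(\<eta>', \<nu>') \<in> Q p'" using p'(4) by auto
    have "(\<eta>, \<nu>) \<in> Q p'" using le_Q[OF p'(1,2)] \<nu> by blast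
    then have "lt I0 \<eta>' \<eta>" using Q_iff(2)[OF bd' \<eta>'] less by blast
    then have \<eta>'A: "\<eta>' \<in> A" using Q_nodes(1)[OF bd' \<eta>'] \<eta>(2) by (auto simp: preds_def)
    have "f \<eta>' = \<nu>'" using Q_iff(1)[OF bd' \<eta>' Qa[OF \<eta>'A p'(1,2)]] by simp
    then have "\<nu>' \<in> preds I1 \<nu>'" using \<eta>'A \<nu>'(3) by blast
    then show False using tree_irrefl[OF is_tree_I1 \<nu>'(1)] by (simp add: preds_def)
  qed
  moreover have "\<forall>a\<in>A. le (h a) p" using le_trans[OF _ p(2)] u(4) by blast
  ultimately show ?thesis using \<nu>' p(1,3) u(2) by blast
qed

text \<open>For surjectivity at limits. Playing \<nu> shows that \<open>A\<close> is bounded in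
  \<open>I0\<close>, and cutting the answer down gives a node directly above \<open>A\<close>; that
  this node is sent to \<nu> is left to the uniqueness clause for trees.\<close>

lemma limit_preimage:
  assumes lc: "limit_chain f h A \<sigma>" and \<nu>: "\<nu> \<in> nodes I1" "preds I1 \<nu> = f ` A"
  shows "\<exists>\<eta>\<in>nodes I0. preds I0 \<eta> = A"
proof -
  have coh: "\<And>a. a \<in> A \<Longrightarrow> coherent f h a" and lev: "\<And>a. a \<in> A \<Longrightarrow> (level I0 a :: 'o) < \<kappa>"
    and down: "\<And>a. a \<in> A \<Longrightarrow> preds I0 a \<subseteq> A" and \<sigma>: "\<sigma> \<le> \<kappa>"
    using lc by (auto simp: limit_chain_def)
  obtain u z where u: "u \<in> pos" "z \<in> E \<sigma>" "\<forall>w\<in>D u. lt t w z" "\<forall>a\<in>A. le (h a) u"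
    using limit_position[OF lc] by blast
  have zn: "z \<in> nodes t" using E_node[OF u(2) \<sigma>] .
  have "{\<nu>} \<subseteq> nodes I1" using \<nu>(1) by simp
  then obtain p where p: "p \<in> pos" "le u p" "ends p z" "{\<nu>} \<subseteq> Range (Q p)"
    by (rule play_right[OF u(1) zn u(3) _ small_singleton])
  note bd = p(1) zn ends_le[OF p(3)]
  obtain \<eta> where \<eta>: "(\<eta>, \<nu>) \<in> Q p" using p(4) by auto
  have "A \<subseteq> preds I0 \<eta>"
  proof
    fix a assume a: "a \<in> A"
    have "(a, f a) \<in> Q p"
      using coherentD(7)[OF coh[OF a] lev[OF a]] le_Q[OF p(1) le_trans[OF bspec[OF u(4) a] p(2)]] by blast
    moreover have "lt I1 (f a) \<nu>" using a \<nu>(2) by (auto simp: preds_def)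
    ultimately show "a \<in> preds I0 \<eta>"
      using Q_iff(2)[OF bd _ \<eta>] coherentD(1)[OF coh[OF a]] by (simp add: preds_def)
  qed
  then show ?thesis
    using least_node_above[OF is_tree_I0 Q_nodes(1)[OF bd \<eta>], of A] down by blast
qed

definition step_spec :: "'a \<Rightarrow> 'b \<Rightarrow> 'p \<Rightarrow> ('a \<Rightarrow> 'b) \<Rightarrow> ('a \<Rightarrow> 'p) \<Rightarrow> bool" where
  "step_spec \<eta> \<nu> h b k \<longleftrightarrow> bij_betw b (succs I0 \<eta>) (succs I1 \<nu>) \<and>
    (\<forall>c\<in>succs I0 \<eta>. k c \<in> pos \<and> le h (k c) \<and>
       (\<exists>z\<in>E (ord_suc (ord_suc (level I0 \<eta>))). ends (k c) z) \<and> (c, b c) \<in> Q (k c))"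

text \<open>The choice depends on \<eta>, \<nu> and \<open>h\<close> alone. All immediate successors
  of \<eta> thus consult the same bijection, although the recursion treats them one at a
  time.\<close>

definition step :: "'a \<Rightarrow> 'b \<Rightarrow> 'p \<Rightarrow> ('a \<Rightarrow> 'b) \<times> ('a \<Rightarrow> 'p)" where
  "step \<eta> \<nu> h = (SOME bk. step_spec \<eta> \<nu> h (fst bk) (snd bk))"

lemma step:
  assumes "h \<in> pos" "(level I0 \<eta> :: 'o) < \<kappa>" "\<exists>x\<in>E (level I0 \<eta>). ends h x" "(\<eta>, \<nu>) \<in> Q h"
  shows "step_spec \<eta> \<nu> h (fst (step \<eta> \<nu> h)) (snd (step \<eta> \<nu> h))"
proof -
  obtain x where x: "x \<in> E (level I0 \<eta>)" "ends h x" using assms(3) by blast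
  obtain b where b: "bij_betw b (succs I0 \<eta>) (succs I1 \<nu>)"
    and ex: "\<forall>c\<in>succs I0 \<eta>. \<exists>h2\<in>pos. le h h2 \<and>
      (\<exists>z\<in>E (ord_suc (ord_suc (level I0 \<eta>))). ends h2 z) \<and> (c, b c) \<in> Q h2"
    using succs_bijection[OF assms(1) x(2) assms(2) x(1) assms(4)] by (elim exE conjE)
  from ex have "\<forall>c. \<exists>h2. c \<in> succs I0 \<eta> \<longrightarrow> h2 \<in> pos \<and> le h h2 \<and>
      (\<exists>z\<in>E (ord_suc (ord_suc (level I0 \<eta>))). ends h2 z) \<and> (c, b c) \<in> Q h2" by blast
  then obtain k where "\<forall>c. c \<in> succs I0 \<eta> \<longrightarrow> k c \<in> pos \<and> le h (k c) \<and>
      (\<exists>z\<in>E (ord_suc (ord_suc (level I0 \<eta>))). ends (k c) z) \<and> (c, b c) \<in> Q (k c)"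
    by (rule exE[OF choice])
  then have "step_spec \<eta> \<nu> h (fst (b, k)) (snd (b, k))" using b by (simp add: step_spec_def)
  then show ?thesis unfolding step_def by (rule someI)
qed

definition limit_spec :: "'a \<Rightarrow> ('a \<Rightarrow> 'b \<times> 'p) \<Rightarrow> 'b \<times> 'p \<Rightarrow> bool" where
  "limit_spec \<eta> v r \<longleftrightarrow> fst r \<in> nodes I1 \<and> preds I1 (fst r) = (\<lambda>y. fst (v y)) ` preds I0 \<eta> \<and>
    ((level I0 \<eta> :: 'o) < \<kappa> \<longrightarrow> snd r \<in> pos \<and> (\<exists>z\<in>E (level I0 \<eta>). ends (snd r) z) \<and>
       (\<eta>, fst r) \<in> Q (snd r) \<and> (\<forall>y\<in>preds I0 \<eta>. le (snd (v y)) (snd r)))"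

definition pred_node :: "'a \<Rightarrow> 'a" where
  "pred_node \<eta> = (SOME \<eta>\<^sub>0. \<eta>\<^sub>0 \<in> nodes I0 \<and> \<eta> \<in> succs I0 \<eta>\<^sub>0)"

lemma pred_node:
  assumes "\<eta>\<^sub>0 \<in> nodes I0" "\<eta> \<in> succs I0 \<eta>\<^sub>0"
  shows "pred_node \<eta> = \<eta>\<^sub>0"
  unfolding pred_node_def using assms succs_unique[OF is_tree_I0] by (intro some_equality) blast+

definition extend :: "('a \<Rightarrow> 'b \<times> 'p) \<Rightarrow> 'a \<Rightarrow> 'b \<times> 'p" where
  "extend v \<eta> = (if \<eta> \<notin> nodes I0 then undefined
     else if has_immediate_pred I0 \<eta> then
       (let s = step (pred_node \<eta>) (fst (v (pred_node \<eta>))) (snd (v (pred_node \<eta>))) in (fst s \<eta>, snd s \<eta>))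
     else SOME r. limit_spec \<eta> v r)"

lemma extend_local:
  assumes "\<And>y. (y, \<eta>) \<in> tree_less I0 \<Longrightarrow> v y = v' y"
  shows "extend v \<eta> = extend v' \<eta>"
proof (cases "\<eta> \<in> nodes I0")
  case True
  then have eq: "v y = v' y" if "y \<in> preds I0 \<eta>" for y
    using assms that by (auto simp: tree_less_def preds_def)
  have "v (pred_node \<eta>) = v' (pred_node \<eta>)" if im: "has_immediate_pred I0 \<eta>"
  proof -
    obtain \<eta>\<^sub>0 where \<eta>\<^sub>0: "\<eta>\<^sub>0 \<in> nodes I0" "\<eta> \<in> succs I0 \<eta>\<^sub>0"
      using im has_immediate_pred_iff[OF True] by blast
    then have "pred_node \<eta> \<in> preds I0 \<eta>" by (simp add: pred_node preds_def succs_def)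
    then show ?thesis by (rule eq)
  qed
  moreover have "limit_spec \<eta> v = limit_spec \<eta> v'"
    by (simp add: fun_eq_iff limit_spec_def eq cong: image_cong_simp)
  ultimately show ?thesis by (simp add: extend_def)
qed (simp add: extend_def)

text \<open>The recursion makes \<open>f\<close> carry predecessor sets to predecessor sets.
  Injectivity and surjectivity then follow by induction: nodes with an immediate predecessor are
  governed by the bijections between successors, the others by uniqueness of a limit node above its
  predecessors.\<close>

lemma isomorphism_exists:
  "\<exists>f. bij_betw f (nodes I0) (nodes I1) \<and>
     (\<forall>x\<in>nodes I0. \<forall>y\<in>nodes I0. lt I0 x y \<longleftrightarrow> lt I1 (f x) (f y))"
proof -
  note T0 = is_tree_I0 and T1 = is_tree_I1
  have "\<exists>v. \<forall>\<eta>. v \<eta> = extend v \<eta>"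
    by (rule wf_recursion_exists[OF wf_tree_less[OF T0]]) (rule extend_local)
  then obtain v where v: "\<And>\<eta>. v \<eta> = extend v \<eta>" by blast
  define f where "f \<eta> = fst (v \<eta>)" for \<eta>
  define h where "h \<eta> = snd (v \<eta>)" for \<eta>
  have v_succ: "f \<eta> = fst (step \<eta>\<^sub>0 (f \<eta>\<^sub>0) (h \<eta>\<^sub>0)) \<eta>" "h \<eta> = snd (step \<eta>\<^sub>0 (f \<eta>\<^sub>0) (h \<eta>\<^sub>0)) \<eta>"
    if "\<eta>\<^sub>0 \<in> nodes I0" "\<eta> \<in> succs I0 \<eta>\<^sub>0" for \<eta>\<^sub>0 \<eta>
  proof -
    have \<eta>: "\<eta> \<in> nodes I0" using that(2) by (simp add: succs_def)
    have "has_immediate_pred I0 \<eta>" unfolding has_immediate_pred_iff[OF \<eta>] using that by (intro bexI[of _ \<eta>\<^sub>0])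
    with \<eta> have "v \<eta> = (fst (step \<eta>\<^sub>0 (f \<eta>\<^sub>0) (h \<eta>\<^sub>0)) \<eta>, snd (step \<eta>\<^sub>0 (f \<eta>\<^sub>0) (h \<eta>\<^sub>0)) \<eta>)"
      by (subst v) (simp add: extend_def pred_node[OF that] f_def h_def Let_def)
    then show "f \<eta> = fst (step \<eta>\<^sub>0 (f \<eta>\<^sub>0) (h \<eta>\<^sub>0)) \<eta>" "h \<eta> = snd (step \<eta>\<^sub>0 (f \<eta>\<^sub>0) (h \<eta>\<^sub>0)) \<eta>"
      by (simp_all add: f_def[of \<eta>] h_def[of \<eta>])
  qed
  have lev_preds: "(level I0 y :: 'o) < \<kappa>" if "\<eta> \<in> nodes I0" "y \<in> preds I0 \<eta>" for \<eta> y
    by (rule level_preds_less[OF \<kappa> I0 that])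
  have coh: "coherent f h \<eta>" if "\<eta> \<in> nodes I0" for \<eta>
    using that
  proof (induction \<eta> rule: wf_induct_rule[OF wf_tree_less[OF T0]])
    case (1 \<eta>)
    have IH: "coherent f h y" if "y \<in> preds I0 \<eta>" for y
      using 1 that by (auto simp: tree_less_def preds_def)
    \<comment> \<open>The level is computed from the levels of the predecessors, so it is carried
      over with the predecessor sets.\<close>
    have level1: "(level I1 (f \<eta>) :: 'o) = level I0 \<eta>" if p: "preds I1 (f \<eta>) = f ` preds I0 \<eta>" "f \<eta> \<in> nodes I1"
    proof -
      have "(\<forall>y\<in>preds I1 (f \<eta>). ord_suc (ord_suc (level I1 y)) \<le> \<xi>) \<longleftrightarrow>
          (\<forall>y\<in>preds I0 \<eta>. ord_suc (ord_suc (level I0 y)) \<le> \<xi>)" for \<xi> :: 'o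
        using coherentD(4)[OF IH] unfolding p(1) by simp
      then show ?thesis unfolding level_eq[OF T0 1(2)] level_eq[OF T1 p(2)] by (simp only:)
    qed
    show ?case
    proof (cases "has_immediate_pred I0 \<eta>")
      case True
      then obtain \<eta>\<^sub>0 where \<eta>\<^sub>0: "\<eta>\<^sub>0 \<in> nodes I0" "\<eta> \<in> succs I0 \<eta>\<^sub>0"
        using has_immediate_pred_iff[OF 1(2)] by blast
      have pr: "preds I0 \<eta> = insert \<eta>\<^sub>0 (preds I0 \<eta>\<^sub>0)" by (rule preds_succs[OF T0 \<eta>\<^sub>0])
      have in0: "\<eta>\<^sub>0 \<in> preds I0 \<eta>" by (simp add: pr)
      have lev0: "(level I0 \<eta>\<^sub>0 :: 'o) < \<kappa>" by (rule lev_preds[OF 1(2) in0])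
      note c0 = coherentD[OF IH[OF in0]]
      note st = step[OF c0(5)[OF lev0] lev0 c0(6)[OF lev0] c0(7)[OF lev0], unfolded step_spec_def]
      have st': "h \<eta> \<in> pos" "le (h \<eta>\<^sub>0) (h \<eta>)" "\<exists>z\<in>E (ord_suc (ord_suc (level I0 \<eta>\<^sub>0))). ends (h \<eta>) z"
          "(\<eta>, f \<eta>) \<in> Q (h \<eta>)"
        using bspec[OF conjunct2[OF st] \<eta>\<^sub>0(2)] unfolding v_succ[OF \<eta>\<^sub>0, symmetric] by simp_all
      have "f \<eta> \<in> succs I1 (f \<eta>\<^sub>0)"
        using conjunct1[OF st] \<eta>\<^sub>0(2) v_succ(1)[OF \<eta>\<^sub>0] by (auto simp: bij_betw_def)
      then have "f \<eta> \<in> nodes I1" and pf: "preds I1 (f \<eta>) = f ` preds I0 \<eta>"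
        using preds_succs[OF T1 c0(2)] c0(3) by (auto simp: succs_def pr)
      moreover have "le (h y) (h \<eta>)" if "y \<in> preds I0 \<eta>" for y
        using that c0(8)[OF lev0, of y] st'(2) le_trans unfolding pr by blast
      moreover have "(level I0 \<eta> :: 'o) = ord_suc (ord_suc (level I0 \<eta>\<^sub>0))"
        by (rule level_succs[OF \<kappa> I0 \<eta>\<^sub>0])
      ultimately show ?thesis
        using st' 1(2) level1 unfolding coherent_def by simp
    next
      case False
      have nomax: "\<exists>b\<in>preds I0 \<eta>. lt I0 a b" if a: "a \<in> preds I0 \<eta>" for a
      proof (rule ccontr)
        assume "\<not> ?thesis"
        then have "\<eta> \<in> succs I0 a" using a 1(2) by (auto simp: succs_def preds_def)
        then show False using False has_immediate_pred_iff[OF 1(2)] a by (auto simp: preds_def)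
      qed
      have "limit_chain f h (preds I0 \<eta>) (level I0 \<eta>)"
        unfolding limit_chain_def
      proof (intro conjI ballI)
        fix a assume a: "a \<in> preds I0 \<eta>"
        show "coherent f h a" by (rule IH[OF a])
        show "(level I0 a :: 'o) < \<kappa>" by (rule lev_preds[OF 1(2) a])
        show "preds I0 a \<subseteq> preds I0 \<eta>"
          using a tree_trans[OF T0 _ _ 1(2), of _ a] by (auto simp: preds_def)
        show "\<exists>b\<in>preds I0 \<eta>. lt I0 a b" by (rule nomax[OF a])
        show "ord_suc (ord_suc (level I0 a)) \<le> (level I0 \<eta> :: 'o)" by (rule suc_level_le[OF \<kappa> I0 1(2) a])
        show "a = b \<or> lt I0 a b \<or> lt I0 b a" if "b \<in> preds I0 \<eta>" for b
          by (rule tree_linear[OF T0 1(2) a that])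
      next
        show "(level I0 \<eta> :: 'o) \<le> \<kappa>" by (rule level_le[OF \<kappa> I0 1(2)])
        show "(level I0 \<eta> :: 'o) = (LEAST \<xi>. \<forall>a\<in>preds I0 \<eta>. ord_suc (ord_suc (level I0 a)) \<le> \<xi>)"
          by (rule level_eq[OF T0 1(2)])
      qed
      from limit_answer[OF this 1(2) refl]
      obtain \<nu> where \<nu>: "\<nu> \<in> nodes I1" "preds I1 \<nu> = f ` preds I0 \<eta>"
        and ex: "(level I0 \<eta> :: 'o) < \<kappa> \<longrightarrow> (\<exists>p\<in>pos. (\<exists>z\<in>E (level I0 \<eta>). ends p z) \<and> (\<eta>, \<nu>) \<in> Q p \<and>
          (\<forall>a\<in>preds I0 \<eta>. le (h a) p))" by (elim bexE conjE)
      have "\<exists>p. (level I0 \<eta> :: 'o) < \<kappa> \<longrightarrow> p \<in> pos \<and> (\<exists>z\<in>E (level I0 \<eta>). ends p z) \<and> (\<eta>, \<nu>) \<in> Q p \<and>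
          (\<forall>a\<in>preds I0 \<eta>. le (h a) p)" using ex by blast
      then obtain p where "(level I0 \<eta> :: 'o) < \<kappa> \<longrightarrow> p \<in> pos \<and> (\<exists>z\<in>E (level I0 \<eta>). ends p z) \<and>
          (\<eta>, \<nu>) \<in> Q p \<and> (\<forall>a\<in>preds I0 \<eta>. le (h a) p)" by (rule exE)
      then have "limit_spec \<eta> v (\<nu>, p)"
        using \<nu> unfolding limit_spec_def f_def h_def by simp
      then have "limit_spec \<eta> v (SOME r. limit_spec \<eta> v r)" by (rule someI)
      moreover have "v \<eta> = (SOME r. limit_spec \<eta> v r)"
        by (subst v) (simp add: extend_def False 1(2))
      ultimately have "limit_spec \<eta> v (v \<eta>)" by simp
      then have ls: "f \<eta> \<in> nodes I1" "preds I1 (f \<eta>) = f ` preds I0 \<eta>"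
        "(level I0 \<eta> :: 'o) < \<kappa> \<longrightarrow> h \<eta> \<in> pos \<and> (\<exists>z\<in>E (level I0 \<eta>). ends (h \<eta>) z) \<and>
       (\<eta>, f \<eta>) \<in> Q (h \<eta>) \<and> (\<forall>y\<in>preds I0 \<eta>. le (h y) (h \<eta>))"
        unfolding limit_spec_def f_def h_def by simp_all
      show ?thesis unfolding coherent_def using ls 1(2) level1[OF ls(2,1)] by simp
    qed
  qed
  have step_bij: "bij_betw f (succs I0 \<eta>) (succs I1 (f \<eta>))" if "\<eta> \<in> nodes I0" "(level I0 \<eta> :: 'o) < \<kappa>" for \<eta>
  proof -
    note c = coherentD[OF coh[OF that(1)]]
    have "bij_betw (fst (step \<eta> (f \<eta>) (h \<eta>))) (succs I0 \<eta>) (succs I1 (f \<eta>))"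
      using step[OF c(5)[OF that(2)] that(2) c(6)[OF that(2)] c(7)[OF that(2)]] by (simp add: step_spec_def)
    then show ?thesis using v_succ(1)[OF that(1)] by (simp cong: bij_betw_cong)
  qed
  have f_nodes: "f \<eta> \<in> nodes I1" if "\<eta> \<in> nodes I0" for \<eta> by (rule coherentD(2)[OF coh[OF that]])
  have f_preds: "preds I1 (f \<eta>) = f ` preds I0 \<eta>" if "\<eta> \<in> nodes I0" for \<eta> by (rule coherentD(3)[OF coh[OF that]])
  have inj: "\<eta> = \<eta>'" if "\<eta> \<in> nodes I0" "\<eta>' \<in> nodes I0" "f \<eta> = f \<eta>'" for \<eta> \<eta>'
    using that
  proof (induction \<eta> arbitrary: \<eta>' rule: wf_induct_rule[OF wf_tree_less[OF T0]])
    case (1 \<eta>)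
    have IH: "y = y'" if "y \<in> preds I0 \<eta>" "y' \<in> nodes I0" "f y = f y'" for y y'
      using 1(1)[of y y'] that 1(2) by (auto simp: tree_less_def preds_def)
    have im: "f ` preds I0 \<eta> = f ` preds I0 \<eta>'" using f_preds[OF 1(2)] f_preds[OF 1(3)] 1(4) by simp
    have sub: "preds I0 \<zeta> \<subseteq> nodes I0" for \<zeta> by (auto simp: preds_def)
    have eq: "preds I0 \<eta> = preds I0 \<eta>'"
    proof
      show "preds I0 \<eta> \<subseteq> preds I0 \<eta>'"
      proof
        fix y assume y: "y \<in> preds I0 \<eta>"
        then have "f y \<in> f ` preds I0 \<eta>'" using im by blast
        then obtain y' where y': "f y = f y'" "y' \<in> preds I0 \<eta>'" by (rule imageE)
        then show "y \<in> preds I0 \<eta>'" using IH[OF y subsetD[OF sub y'(2)] y'(1)] by simp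
      qed
      show "preds I0 \<eta>' \<subseteq> preds I0 \<eta>"
      proof
        fix y' assume y': "y' \<in> preds I0 \<eta>'"
        then have "f y' \<in> f ` preds I0 \<eta>" using im by blast
        then obtain y where y: "f y' = f y" "y \<in> preds I0 \<eta>" by (rule imageE)
        then show "y' \<in> preds I0 \<eta>" using IH[OF y(2) subsetD[OF sub y'] y(1)[symmetric]] by simp
      qed
    qed
    show ?case
    proof (cases "\<exists>\<eta>\<^sub>0\<in>nodes I0. \<eta> \<in> succs I0 \<eta>\<^sub>0")
      case True
      then obtain \<eta>\<^sub>0 where \<eta>\<^sub>0: "\<eta>\<^sub>0 \<in> nodes I0" "\<eta> \<in> succs I0 \<eta>\<^sub>0" by blast
      then have "\<eta>' \<in> succs I0 \<eta>\<^sub>0"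
        using succs_iff_preds[OF T0 \<eta>\<^sub>0(1)] 1(2,3) eq by simp
      moreover have "(level I0 \<eta>\<^sub>0 :: 'o) < \<kappa>"
        using lev_preds[OF 1(2)] preds_succs[OF T0 \<eta>\<^sub>0] by simp
      ultimately show ?thesis
        using inj_onD[OF bij_betw_imp_inj_on[OF step_bij[OF \<eta>\<^sub>0(1)]] 1(4) \<eta>\<^sub>0(2)] by blast
    next
      case False
      then have "\<not> (\<exists>\<eta>\<^sub>0\<in>nodes I0. \<eta>' \<in> succs I0 \<eta>\<^sub>0)"
        using succs_iff_preds[OF T0] 1(2,3) eq by simp
      then show ?thesis
        using False I0 has_immediate_pred_iff[OF 1(2)] has_immediate_pred_iff[OF 1(3)] eq 1(2,3)
        unfolding bounded_height_tree_def succ_card_tree_def tree_sim_def by blast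
    qed
  qed
  have iff: "lt I0 x y \<longleftrightarrow> lt I1 (f x) (f y)" if xy: "x \<in> nodes I0" "y \<in> nodes I0" for x y
  proof
    assume "lt I0 x y"
    then have "f x \<in> preds I1 (f y)" using f_preds[OF xy(2)] xy(1) by (auto simp: preds_def)
    then show "lt I1 (f x) (f y)" by (simp add: preds_def)
  next
    assume "lt I1 (f x) (f y)"
    then have "f x \<in> f ` preds I0 y" using f_preds[OF xy(2)] f_nodes[OF xy(1)] by (auto simp: preds_def)
    then obtain x' where x': "f x = f x'" "x' \<in> preds I0 y" by (rule imageE)
    then have "x = x'" using inj[OF xy(1)] by (simp add: preds_def)
    then show "lt I0 x y" using x'(2) by (simp add: preds_def)
  qed
  have surj: "\<nu> \<in> f ` nodes I0" if "\<nu> \<in> nodes I1" for \<nu>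
    using that
  proof (induction \<nu> rule: wf_induct_rule[OF wf_tree_less[OF T1]])
    case (1 \<nu>)
    have IH: "b \<in> f ` nodes I0" if "b \<in> preds I1 \<nu>" for b
      using 1 that by (auto simp: tree_less_def preds_def)
    have lev1: "(level I0 a :: 'o) < \<kappa>" if "a \<in> nodes I0" "f a \<in> preds I1 \<nu>" for a
      using level_preds_less[OF \<kappa> I1 1(2) that(2)] coherentD(4)[OF coh[OF that(1)]] by simp
    show ?case
    proof (cases "has_immediate_pred I1 \<nu>")
      case True
      then obtain \<nu>\<^sub>0 where \<nu>\<^sub>0: "\<nu>\<^sub>0 \<in> nodes I1" "\<nu> \<in> succs I1 \<nu>\<^sub>0"
        using has_immediate_pred_iff[OF 1(2)] by blast
      then have p0: "\<nu>\<^sub>0 \<in> preds I1 \<nu>" by (simp add: preds_def succs_def)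
      obtain \<eta>\<^sub>0 where \<eta>\<^sub>0: "\<nu>\<^sub>0 = f \<eta>\<^sub>0" "\<eta>\<^sub>0 \<in> nodes I0" using IH[OF p0] by (rule imageE)
      have "\<nu> \<in> f ` succs I0 \<eta>\<^sub>0"
        using bij_betw_imp_surj_on[OF step_bij[OF \<eta>\<^sub>0(2) lev1[OF \<eta>\<^sub>0(2)]]] \<nu>\<^sub>0(2) p0 \<eta>\<^sub>0(1) by simp
      then show ?thesis by (auto simp: succs_def)
    next
      case False
      \<comment> \<open>The predecessors of the node sought. The order properties of the
        predecessors of \<nu> are pulled back along \<open>f\<close>, which is already known to be
        injective and to preserve order in both directions.\<close>
      define A where "A = {a \<in> nodes I0. f a \<in> preds I1 \<nu>}"
      have fA: "preds I1 \<nu> = f ` A" using IH by (auto simp: A_def)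
      have "limit_chain f h A (level I1 \<nu>)"
        unfolding limit_chain_def
      proof (intro conjI ballI)
        fix a assume a: "a \<in> A"
        then have an: "a \<in> nodes I0" "f a \<in> nodes I1" "lt I1 (f a) \<nu>" by (auto simp: A_def preds_def)
        show "coherent f h a" by (rule coh[OF an(1)])
        show "(level I0 a :: 'o) < \<kappa>" using a lev1 by (simp add: A_def)
        show "preds I0 a \<subseteq> A"
        proof
          fix y assume y: "y \<in> preds I0 a"
          then have yn: "y \<in> nodes I0" "lt I1 (f y) (f a)" using iff an by (auto simp: preds_def)
          then show "y \<in> A"
            using tree_trans[OF T1 f_nodes[OF yn(1)] an(2) 1(2) yn(2) an(3)] f_nodes[OF yn(1)]
            by (simp add: A_def preds_def)
        qed
        show "a = b \<or> lt I0 a b \<or> lt I0 b a" if b: "b \<in> A" for b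
          using tree_linear[OF T1 1(2), of "f a" "f b"] a b inj[of a b] iff[of a b] iff[of b a]
          by (auto simp: A_def)
        show "\<exists>b\<in>A. lt I0 a b"
        proof (rule ccontr)
          assume n: "\<not> ?thesis"
          have "\<nu> \<in> succs I1 (f a)"
            unfolding succs_def
          proof (intro CollectI conjI notI)
            assume "\<exists>z\<in>nodes I1. lt I1 (f a) z \<and> lt I1 z \<nu>"
            then obtain z where z: "z \<in> preds I1 \<nu>" "lt I1 (f a) z" by (auto simp: preds_def)
            then obtain b where "b \<in> A" "z = f b" using fA by blast
            then show False using n z(2) iff[OF an(1), of b] by (auto simp: A_def)
          qed (use 1(2) an in auto)
          then show False using False has_immediate_pred_iff[OF 1(2)] an(2) by blast
        qed
        show "ord_suc (ord_suc (level I0 a)) \<le> (level I1 \<nu> :: 'o)"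
          using suc_level_le[OF \<kappa> I1 1(2), of "f a"] coherentD(4)[OF coh[OF an(1)]] a by (simp add: A_def)
      next
        show "(level I1 \<nu> :: 'o) \<le> \<kappa>" by (rule level_le[OF \<kappa> I1 1(2)])
        have "(\<forall>y\<in>preds I1 \<nu>. ord_suc (ord_suc (level I1 y)) \<le> \<xi>) \<longleftrightarrow>
            (\<forall>a\<in>A. ord_suc (ord_suc (level I0 a)) \<le> \<xi>)" for \<xi> :: 'o
          using coherentD(4)[OF coh] unfolding fA by (auto simp: A_def)
        then show "(level I1 \<nu> :: 'o) = (LEAST \<xi>. \<forall>a\<in>A. ord_suc (ord_suc (level I0 a)) \<le> \<xi>)"
          unfolding level_eq[OF T1 1(2)] by (simp only:)
      qed
      from limit_preimage[OF this 1(2) fA] obtain \<eta> where \<eta>: "\<eta> \<in> nodes I0" "preds I0 \<eta> = A" by blast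
      have eq: "preds I1 (f \<eta>) = preds I1 \<nu>" using f_preds[OF \<eta>(1)] \<eta>(2) fA by simp
      \<comment> \<open>Having an immediate predecessor is decided by the predecessor set, which
        \<nu> and \<open>f \<eta>\<close> share; the last clause of \<open>succ_card_tree\<close>
        then identifies them.\<close>
      have "\<not> has_immediate_pred I1 (f \<eta>)"
        using False has_immediate_pred_iff[OF 1(2)] has_immediate_pred_iff[OF f_nodes[OF \<eta>(1)]]
          succs_iff_preds[OF T1 _ 1(2)] succs_iff_preds[OF T1 _ f_nodes[OF \<eta>(1)]] eq by simp
      then have "f \<eta> = \<nu>"
        using False I1 eq 1(2) f_nodes[OF \<eta>(1)]
        unfolding bounded_height_tree_def succ_card_tree_def tree_sim_def by blast
      then show ?thesis using \<eta>(1) by blast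
    qed
  qed
  have "bij_betw f (nodes I0) (nodes I1)"
    unfolding bij_betw_def using inj f_nodes surj by (auto intro!: inj_onI)
  then show ?thesis using iff by blast
qed

end

section \<open>Positions of the Ehrenfeucht-Fraisse game\<close>

lemma tree_structure_simps [simp]:
  "univ (tree_structure T) = nodes T"
  "interp (tree_structure T) R xs \<longleftrightarrow> (\<exists>x\<in>nodes T. \<exists>y\<in>nodes T. xs = [x, y] \<and> lt T x y)"
  by (simp_all add: tree_structure_def)

text \<open>The order is recovered by evaluating the relation symbol on lists of two pairs, and the
  equality clause from single-valuedness in both directions.\<close>

lemma partial_iso_tree:
  assumes "partial_iso (tree_structure I0) (tree_structure I1) p"
  shows "p \<subseteq> nodes I0 \<times> nodes I1 \<and>
    (\<forall>(a, b)\<in>p. \<forall>(a', b')\<in>p. (a = a' \<longleftrightarrow> b = b') \<and> (lt I0 a a' \<longleftrightarrow> lt I1 b b'))"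
proof (intro conjI ballI, goal_cases)
  case 1
  then show ?case using assms by (simp add: partial_iso_def)
next
  case (2 x)
  note sv = assms[unfolded partial_iso_def]
  have "(a = a' \<longleftrightarrow> b = b') \<and> (lt I0 a a' \<longleftrightarrow> lt I1 b b')" if ab: "(a, b) \<in> p" "(a', b') \<in> p" for a b a' b'
  proof (intro conjI)
    have "single_valued p" "single_valued (p\<inverse>)" using sv by auto
    then show "a = a' \<longleftrightarrow> b = b'" using ab by (auto simp: single_valued_def)
    have "p \<subseteq> nodes I0 \<times> nodes I1" using sv by simp
    then have n: "a \<in> nodes I0" "a' \<in> nodes I0" "b \<in> nodes I1" "b' \<in> nodes I1" using ab by auto
    have "set [(a, b), (a', b')] \<subseteq> p" using ab by simp
    then have "interp (tree_structure I0) Less_Symbol (map fst [(a, b), (a', b')]) =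
        interp (tree_structure I1) Less_Symbol (map snd [(a, b), (a', b')])" using sv by blast
    then show "lt I0 a a' \<longleftrightarrow> lt I1 b b'" using n by simp
  qed
  then show ?case using 2 by auto
qed

lemma partial_isomorphism_subset:
  assumes "T \<subseteq> N \<times> M \<and> (\<forall>(a, b)\<in>T. \<forall>(a', b')\<in>T. R a b a' b')" "S \<subseteq> T"
  shows "S \<subseteq> N \<times> M \<and> (\<forall>(a, b)\<in>S. \<forall>(a', b')\<in>S. R a b a' b')"
  using assms by fast

text \<open>Inclusion alone would not do: a new move inserted below an old one would change the
  history that the strategy saw there, and hence its answer.\<close>

definition end_ext :: "'t tree \<Rightarrow> ('t, 'o, 'a, 'b) history \<Rightarrow> ('t, 'o, 'a, 'b) history \<Rightarrow> bool" where
  "end_ext t h h' \<longleftrightarrow> h \<subseteq>\<^sub>m h' \<and> (\<forall>x\<in>dom h. \<forall>y\<in>dom h' - dom h. lt t x y)"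

text \<open>In contrast to \<open>legal_history\<close>, no last move is demanded, so that positions
  are closed under unions of chains.\<close>

definition pre_history :: "'o::wellorder \<Rightarrow> 't tree \<Rightarrow> ('r, 'a) rel_structure \<Rightarrow>
    ('r, 'b) rel_structure \<Rightarrow> ('t, 'o, 'a, 'b) history set" where
  "pre_history lam t A B = {h. dom h \<subseteq> nodes t \<and> (\<forall>x\<in>dom h. \<forall>y\<in>dom h. x = y \<or> lt t x y \<or> lt t y x) \<and>
     (\<forall>m\<in>ran h. legal_move lam A B m)}"

text \<open>The move is a function of the set played. Plays that use equal sets at the same nodes
  are then literally equal there, as is required for one to extend the other.\<close>

definition play_set_left :: "'o::wellorder \<Rightarrow> 'a set \<Rightarrow> ('o, 'a, 'b) move" where
  "play_set_left lam X = (SOME m. \<exists>l a. m = In_Left l a \<and> l < lam \<and> a \<in> {..<l} \<rightarrow>\<^sub>E X \<and> a ` {..<l} = X)"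

definition play_set_right :: "'o::wellorder \<Rightarrow> 'b set \<Rightarrow> ('o, 'a, 'b) move" where
  "play_set_right lam X = (SOME m. \<exists>l b. m = In_Right l b \<and> l < lam \<and> b \<in> {..<l} \<rightarrow>\<^sub>E X \<and> b ` {..<l} = X)"

definition extend_history :: "('t \<Rightarrow> ('o, 'a, 'b) move) \<Rightarrow> ('t, 'o, 'a, 'b) history \<Rightarrow> 't set \<Rightarrow>
    ('t, 'o, 'a, 'b) history" where
  "extend_history m h K = (\<lambda>w. if w \<in> K then Some (m w) else h w)"

lemma play_set_left:
  fixes lam :: "'o::wellorder"
  assumes "regular_cardinal lam" "|X| <o |{..<lam}|"
  shows "\<exists>l a. (play_set_left lam X :: ('o, 'a, 'b) move) = In_Left l a \<and> l < lam \<and>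
    a \<in> {..<l} \<rightarrow>\<^sub>E X \<and> a ` {..<l} = X"
proof -
  have "\<exists>m :: ('o, 'a, 'b) move. \<exists>l a. m = In_Left l a \<and> l < lam \<and> a \<in> {..<l} \<rightarrow>\<^sub>E X \<and> a ` {..<l} = X"
    using small_enum[OF assms] by blast
  then show ?thesis unfolding play_set_left_def by (rule someI_ex)
qed

lemma play_set_right:
  fixes lam :: "'o::wellorder"
  assumes "regular_cardinal lam" "|X| <o |{..<lam}|"
  shows "\<exists>l b. (play_set_right lam X :: ('o, 'a, 'b) move) = In_Right l b \<and> l < lam \<and>
    b \<in> {..<l} \<rightarrow>\<^sub>E X \<and> b ` {..<l} = X"
proof -
  have "\<exists>m :: ('o, 'a, 'b) move. \<exists>l b. m = In_Right l b \<and> l < lam \<and> b \<in> {..<l} \<rightarrow>\<^sub>E X \<and> b ` {..<l} = X"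
    using small_enum[OF assms] by blast
  then show ?thesis unfolding play_set_right_def by (rule someI_ex)
qed

lemma end_ext_dom: "end_ext t h h' \<Longrightarrow> dom h \<subseteq> dom h'"
  unfolding end_ext_def by (elim conjE) (rule map_le_implies_dom_le)

lemma end_ext_trans:
  assumes "end_ext t h h'" "end_ext t h' h''"
  shows "end_ext t h h''"
  unfolding end_ext_def
proof (intro conjI ballI)
  show "h \<subseteq>\<^sub>m h''" using assms by (auto simp: end_ext_def intro: map_le_trans)
  fix x y assume x: "x \<in> dom h" and y: "y \<in> dom h'' - dom h"
  have "x \<in> dom h'" using x end_ext_dom[OF assms(1)] by (rule rev_subsetD)
  then show "lt t x y" using assms x y by (cases "y \<in> dom h'") (auto simp: end_ext_def)
qed

text \<open>A new node lies above every old one and so cannot be below \<open>x\<close>; the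
  strategy sees the same history at \<open>x\<close> as before.\<close>

lemma history_upto_end_ext:
  assumes t: "is_tree t" and h': "dom h' \<subseteq> nodes t" and ext: "end_ext t h h'" and x: "x \<in> dom h"
  shows "history_upto t h' x = history_upto t h x" "h' x = h x"
proof -
  have le: "h \<subseteq>\<^sub>m h'" using ext by (simp add: end_ext_def)
  then show "h' x = h x" using x by (auto simp: map_le_def)
  show "history_upto t h' x = history_upto t h x"
  proof
    fix y
    show "history_upto t h' x y = history_upto t h x y"
    proof (cases "y = x \<or> lt t y x")
      case True
      have "h' y = h y"
      proof (cases "y \<in> dom h")
        case True
        then show ?thesis using le by (auto simp: map_le_def)
      next
        case False
        have "y \<notin> dom h'"
        proof
          assume y: "y \<in> dom h'"
          then have xy: "lt t x y" using ext x False by (auto simp: end_ext_def)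
          have n: "x \<in> nodes t" "y \<in> nodes t" using x y h' map_le_implies_dom_le[OF le] by auto
          then show False using \<open>y = x \<or> lt t y x\<close> xy tree_irrefl[OF t n(1)] tree_trans[OF t n(1) n(2) n(1) xy] by auto
        qed
        then show ?thesis using False by (auto simp: domIff)
      qed
      then show ?thesis by (simp add: history_upto_def restrict_map_def)
    qed (simp add: history_upto_def restrict_map_def)
  qed
qed

lemma round_pairs_end_ext:
  assumes "is_tree t" "dom h' \<subseteq> nodes t" "end_ext t h h'" "x \<in> dom h"
  shows "round_pairs sa sb t h' x = round_pairs sa sb t h x"
  unfolding round_pairs_def history_upto_end_ext[OF assms] by (rule refl)

text \<open>A bounded position can be prolonged by an empty move at the bound, which makes it a history
  with a last move.\<close>

lemma game_pre_history:
  fixes lam \<kappa> :: "'o::wellorder" and I0 :: "'a tree" and I1 :: "'b tree" and t :: "'t tree"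
  assumes lt: "large_tree lam \<kappa> t e E"
    and I0: "bounded_height_tree lam \<kappa> I0" and I1: "bounded_height_tree lam \<kappa> I1"
    and strat: "\<And>h. legal_history lam t (tree_structure I0) (tree_structure I1) h \<Longrightarrow>
      partial_iso (tree_structure I0) (tree_structure I1) (\<Union>x\<in>dom h. round_pairs sa sb t h x)"
  shows "game lam \<kappa> t e E I0 I1 (pre_history lam t (tree_structure I0) (tree_structure I1)) dom
    (\<lambda>h h'. end_ext t h h') (\<lambda>h. \<Union>x\<in>dom h. round_pairs sa sb t h x)
    (\<lambda>h K m. extend_history (\<lambda>w. play_set_left lam (m w)) h K)
    (\<lambda>h K m. extend_history (\<lambda>w. play_set_right lam (m w)) h K)"
proof -
  interpret large_tree lam \<kappa> t e E by (rule lt)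
  let ?A = "tree_structure I0" and ?B = "tree_structure I1"
  let ?pos = "pre_history lam t ?A ?B"
  let ?Q = "\<lambda>h. \<Union>x\<in>dom h. round_pairs sa sb t h x"
  have nodesD: "dom h \<subseteq> nodes t" if "h \<in> ?pos" for h using that by (simp add: pre_history_def)
  have Q_mono: "?Q h \<subseteq> ?Q h'" if h': "h' \<in> ?pos" and ext: "end_ext t h h'" for h h'
  proof
    fix c assume "c \<in> ?Q h"
    then obtain x where x: "x \<in> dom h" "c \<in> round_pairs sa sb t h x" by blast
    have "x \<in> dom h'" using x(1) end_ext_dom[OF ext] by (rule rev_subsetD)
    moreover have "c \<in> round_pairs sa sb t h' x"
      using x round_pairs_end_ext[OF tree nodesD[OF h'] ext x(1)] by simp
    ultimately show "c \<in> ?Q h'" by blast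
  qed
  have dom_ext: "dom (extend_history m h K) = dom h \<union> K" for m :: "'t \<Rightarrow> ('o, 'a, 'b) move" and h K
    by (auto simp: extend_history_def split: if_splits)
  have ext_pos: "extend_history m h K \<in> ?pos" and ext_le: "end_ext t h (extend_history m h K)"
    if h: "h \<in> ?pos" and K: "K \<subseteq> nodes t" "\<forall>v\<in>K. \<forall>w\<in>K. v = w \<or> lt t v w \<or> lt t w v"
      "\<forall>w\<in>dom h. \<forall>v\<in>K. lt t w v" and m: "\<forall>v\<in>K. legal_move lam ?A ?B (m v)"
    for h K and m :: "'t \<Rightarrow> ('o, 'a, 'b) move"
  proof -
    have disj: "w \<notin> K" if "w \<in> dom h" for w
      using that K(3) subsetD[OF nodesD[OF h] that] tree_irrefl[OF tree, of w] by blast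
    have "ran (extend_history m h K) \<subseteq> ran h \<union> m ` K"
      by (auto simp: ran_def extend_history_def split: if_splits)
    then have "\<forall>m\<in>ran (extend_history m h K). legal_move lam ?A ?B m"
      using m h by (auto simp: pre_history_def)
    moreover have "\<forall>x\<in>dom h \<union> K. \<forall>y\<in>dom h \<union> K. x = y \<or> lt t x y \<or> lt t y x"
      using K(2,3) h unfolding pre_history_def by blast
    ultimately show "extend_history m h K \<in> ?pos"
      using K(1) nodesD[OF h] by (simp add: pre_history_def dom_ext)
    show "end_ext t h (extend_history m h K)"
      using K(3) disj unfolding end_ext_def dom_ext by (auto simp: map_le_def extend_history_def)
  qed
  have ext_ext: "end_ext t (extend_history m' h K') (extend_history m h K)"
    if h: "h \<in> ?pos" and K: "K \<subseteq> nodes t" "\<forall>v\<in>K. \<forall>w\<in>K. v = w \<or> lt t v w \<or> lt t w v"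
      "\<forall>w\<in>dom h. \<forall>v\<in>K. lt t w v" "K' \<subseteq> K" "\<forall>v\<in>K. \<forall>w\<in>K'. lt t v w \<longrightarrow> v \<in> K'"
      and m: "\<forall>v\<in>K'. m v = m' v"
    for h K K' and m m' :: "'t \<Rightarrow> ('o, 'a, 'b) move"
  proof -
    have disj: "w \<notin> K" if "w \<in> dom h" for w
      using that K(3) subsetD[OF nodesD[OF h] that] tree_irrefl[OF tree, of w] by blast
    have "extend_history m' h K' a = extend_history m h K a" if "a \<in> dom h \<union> K'" for a
      using that K(4) m disj[of a] by (auto simp: extend_history_def)
    then have "extend_history m' h K' \<subseteq>\<^sub>m extend_history m h K"
      unfolding map_le_def dom_ext by blast
    moreover have "lt t x y" if x: "x \<in> dom h \<union> K'" and y: "y \<in> K" "y \<notin> K'" for x y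
      using x
    proof
      assume "x \<in> dom h" then show ?thesis using K(3) y(1) by blast
    next
      assume "x \<in> K'"
      then show ?thesis
        using bspec[OF bspec[OF K(2) subsetD[OF K(4)]] y(1), of x] K(5) y by blast
    qed
    ultimately show ?thesis unfolding end_ext_def dom_ext by blast
  qed
  have legal_left: "legal_move lam ?A ?B (play_set_left lam X)"
    if "X \<subseteq> nodes I0 \<and> small X" for X
    using play_set_left[OF lam conjunct2[OF that], where ?'b = 'b] that by (auto simp: PiE_iff image_subset_iff)
  have legal_right: "legal_move lam ?A ?B (play_set_right lam X)"
    if "X \<subseteq> nodes I1 \<and> small X" for X
    using play_set_right[OF lam conjunct2[OF that], where ?'a = 'a] that by (auto simp: PiE_iff image_subset_iff)
  show ?thesis
  proof unfold_locales
    show "bounded_height_tree lam \<kappa> I0" "bounded_height_tree lam \<kappa> I1" by fact+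
    show "dom p \<subseteq> nodes t" if "p \<in> ?pos" for p using nodesD[OF that] .
    show "end_ext t p p" for p by (simp add: end_ext_def)
    show "end_ext t p p''" if "end_ext t p p'" "end_ext t p' p''" for p p' p'' :: "('t, 'o, 'a, 'b) history"
      by (rule end_ext_trans[OF that])
    show "?Q p \<subseteq> ?Q p'" if "p' \<in> ?pos" "end_ext t p p'" for p p' by (rule Q_mono[OF that])
    show "dom p \<subseteq> dom p'" if "end_ext t p p'" for p p' :: "('t, 'o, 'a, 'b) history"
      by (rule end_ext_dom[OF that])
  next
    fix p K and m :: "'t \<Rightarrow> 'a set"
    assume p: "p \<in> ?pos" "K \<subseteq> nodes t" "\<forall>v\<in>K. \<forall>w\<in>K. v = w \<or> lt t v w \<or> lt t w v"
      "\<forall>w\<in>dom p. \<forall>v\<in>K. lt t w v" and m: "\<forall>v\<in>K. m v \<subseteq> nodes I0 \<and> small (m v)"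
    let ?h = "extend_history (\<lambda>w. play_set_left lam (m w)) p K"
    have "m v \<subseteq> Domain (?Q ?h)" if v: "v \<in> K" for v
    proof -
      have sm: "small (m v)" using m v by blast
      obtain l a where la: "(play_set_left lam (m v) :: ('o, 'a, 'b) move) = In_Left l a" "a ` {..<l} = m v"
        using play_set_left[OF lam sm, where ?'b = 'b] by blast
      have "m v \<subseteq> Domain (round_pairs sa sb t ?h v)"
        unfolding la(2)[symmetric] using la(1) v by (auto simp: round_pairs_def extend_history_def)
      moreover have "v \<in> dom ?h" using v by (simp add: dom_ext)
      ultimately show ?thesis by blast
    qed
    then show "?h \<in> ?pos \<and> end_ext t p ?h \<and> dom ?h = dom p \<union> K \<and> (\<forall>v\<in>K. m v \<subseteq> Domain (?Q ?h))"
      using ext_pos[OF p, of "\<lambda>w. play_set_left lam (m w)"] ext_le[OF p, of "\<lambda>w. play_set_left lam (m w)"]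
        legal_left m dom_ext by simp
  next
    fix p K and m :: "'t \<Rightarrow> 'b set"
    assume p: "p \<in> ?pos" "K \<subseteq> nodes t" "\<forall>v\<in>K. \<forall>w\<in>K. v = w \<or> lt t v w \<or> lt t w v"
      "\<forall>w\<in>dom p. \<forall>v\<in>K. lt t w v" and m: "\<forall>v\<in>K. m v \<subseteq> nodes I1 \<and> small (m v)"
    let ?h = "extend_history (\<lambda>w. play_set_right lam (m w)) p K"
    have "m v \<subseteq> Range (?Q ?h)" if v: "v \<in> K" for v
    proof -
      have sm: "small (m v)" using m v by blast
      obtain l b where lb: "(play_set_right lam (m v) :: ('o, 'a, 'b) move) = In_Right l b" "b ` {..<l} = m v"
        using play_set_right[OF lam sm, where ?'a = 'a] by blast
      have "m v \<subseteq> Range (round_pairs sa sb t ?h v)"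
        unfolding lb(2)[symmetric] using lb(1) v by (auto simp: round_pairs_def extend_history_def)
      moreover have "v \<in> dom ?h" using v by (simp add: dom_ext)
      ultimately show ?thesis by blast
    qed
    then show "?h \<in> ?pos \<and> end_ext t p ?h \<and> dom ?h = dom p \<union> K \<and> (\<forall>v\<in>K. m v \<subseteq> Range (?Q ?h))"
      using ext_pos[OF p, of "\<lambda>w. play_set_right lam (m w)"] ext_le[OF p, of "\<lambda>w. play_set_right lam (m w)"]
        legal_right m dom_ext by simp
  next
    fix H :: "('t, 'o, 'a, 'b) history set"
    assume H: "H \<subseteq> ?pos" and chain: "\<forall>p\<in>H. \<forall>p'\<in>H. end_ext t p p' \<or> end_ext t p' p"
    \<comment> \<open>The pointwise union of the chain. Its members agree wherever two of them are
      defined, so the choice of \<open>p\<close> has no influence on the value.\<close>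
    define u where "u x = (if \<exists>p\<in>H. x \<in> dom p then (SOME p. p \<in> H \<and> x \<in> dom p) x else None)" for x
    have eq: "p x = p' x" if "p \<in> H" "p' \<in> H" "x \<in> dom p" "x \<in> dom p'" for p p' x
    proof -
      have "p \<subseteq>\<^sub>m p' \<or> p' \<subseteq>\<^sub>m p" using chain that(1,2) unfolding end_ext_def by blast
      then show ?thesis
      proof
        assume "p \<subseteq>\<^sub>m p'"
        then show ?thesis unfolding map_le_def by (rule bspec[OF _ that(3)])
      next
        assume "p' \<subseteq>\<^sub>m p"
        then show ?thesis unfolding map_le_def by (rule bspec[OF _ that(4), THEN sym])
      qed
    qed
    have u: "u x = p x" if p: "p \<in> H" "x \<in> dom p" for p x
    proof -
      have "(SOME p. p \<in> H \<and> x \<in> dom p) \<in> H \<and> x \<in> dom (SOME p. p \<in> H \<and> x \<in> dom p)"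
        by (rule someI[of _ p]) (use p in simp)
      then have "(SOME p. p \<in> H \<and> x \<in> dom p) x = p x" using eq p by blast
      moreover have "\<exists>p\<in>H. x \<in> dom p" using p by blast
      ultimately show ?thesis unfolding u_def by simp
    qed
    have dom_u: "dom u = \<Union> (dom ` H)"
    proof
      show "dom u \<subseteq> \<Union> (dom ` H)" by (auto simp: u_def split: if_splits)
      show "\<Union> (dom ` H) \<subseteq> dom u"
      proof
        fix x assume "x \<in> \<Union> (dom ` H)"
        then obtain p where "p \<in> H" "x \<in> dom p" by blast
        then show "x \<in> dom u" using u[of p x] by (simp add: domIff)
      qed
    qed
    have le_u: "end_ext t p u" if p: "p \<in> H" for p
      unfolding end_ext_def
    proof (intro conjI ballI)
      show "p \<subseteq>\<^sub>m u" using u[OF p] by (simp add: map_le_def)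
      fix x y assume x: "x \<in> dom p" and y: "y \<in> dom u - dom p"
      then obtain p' where p': "p' \<in> H" "y \<in> dom p'" unfolding dom_u by blast
      have "\<not> end_ext t p' p" using p' y end_ext_dom[of t p' p] by blast
      then have "end_ext t p p'" using chain p p'(1) by blast
      then show "lt t x y" using x y p'(2) by (simp add: end_ext_def)
    qed
    have "u \<in> ?pos"
      unfolding pre_history_def
    proof (intro CollectI conjI ballI)
      show "dom u \<subseteq> nodes t" unfolding dom_u using H nodesD by blast
      fix x y assume "x \<in> dom u" "y \<in> dom u"
      then obtain p p' where p: "p \<in> H" "x \<in> dom p" "p' \<in> H" "y \<in> dom p'" unfolding dom_u by blast
      have "dom p \<subseteq> dom p' \<or> dom p' \<subseteq> dom p"
        using chain p(1,3) end_ext_dom[of t p p'] end_ext_dom[of t p' p] by blast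
      then have "\<exists>p\<in>H. x \<in> dom p \<and> y \<in> dom p" using p by blast
      then show "x = y \<or> lt t x y \<or> lt t y x" using H unfolding pre_history_def by blast
    next
      fix m assume "m \<in> ran u"
      then obtain x where x: "u x = Some m" by (auto simp: ran_def)
      then have "x \<in> dom u" by blast
      then obtain p where p: "p \<in> H" "x \<in> dom p" unfolding dom_u by blast
      then have "m \<in> ran p" using u[OF p] x by (auto simp: ran_def)
      then show "legal_move lam ?A ?B m" using H p(1) unfolding pre_history_def by blast
    qed
    then show "\<exists>u\<in>?pos. (\<forall>p\<in>H. end_ext t p u) \<and> dom u = \<Union> (dom ` H)"
      using le_u dom_u by blast
  next
    fix p z assume p: "p \<in> ?pos" and z: "z \<in> nodes t" "\<forall>w\<in>dom p. w = z \<or> lt t w z"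
    have legal: "legal_history lam t ?A ?B h" if h: "h \<in> ?pos" "z \<in> dom h" "\<forall>w\<in>dom h. w = z \<or> lt t w z" for h
      using h unfolding legal_history_def pre_history_def pred_on.chain_def by blast
    have "\<exists>h\<in>?pos. end_ext t p h \<and> z \<in> dom h \<and> (\<forall>w\<in>dom h. w = z \<or> lt t w z)"
    proof (cases "z \<in> dom p")
      case True
      then show ?thesis using p z by (intro bexI[of _ p]) (auto simp: end_ext_def)
    next
      case False
      let ?h = "extend_history (\<lambda>_. play_set_left lam {}) p {z}"
      have "\<forall>w\<in>dom p. \<forall>v\<in>{z}. lt t w v" using z False by auto
      moreover have "\<forall>v\<in>{z}. legal_move lam ?A ?B (play_set_left lam {})" using legal_left[of "{}"] by simp
      ultimately have "?h \<in> ?pos" "end_ext t p ?h"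
        using ext_pos[OF p, of "{z}" "\<lambda>_. play_set_left lam {}"] ext_le[OF p, of "{z}" "\<lambda>_. play_set_left lam {}"] z(1)
        by auto
      moreover have "dom ?h = insert z (dom p)" by (simp add: dom_ext)
      ultimately show ?thesis using z by (intro bexI[of _ ?h]) auto
    qed
    then obtain h where h: "h \<in> ?pos" "end_ext t p h" "z \<in> dom h" "\<forall>w\<in>dom h. w = z \<or> lt t w z" by blast
    have "?Q p \<subseteq> ?Q h" by (rule Q_mono[OF h(1,2)])
    with partial_iso_tree[OF strat[OF legal[OF h(1,3,4)]]]
    show "?Q p \<subseteq> nodes I0 \<times> nodes I1 \<and>
      (\<forall>(a, b)\<in>?Q p. \<forall>(a', b')\<in>?Q p. (a = a' \<longleftrightarrow> b = b') \<and> (lt I0 a a' \<longleftrightarrow> lt I1 b b'))"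
      by (rule partial_isomorphism_subset)
  qed (rule ext_ext; simp)+
qed

lemma large_treeI:
  fixes lam \<kappa> :: "'o::wellorder" and t :: "'t tree"
  assumes "regular_cardinal lam" and "regular_cardinal \<kappa>" and "\<kappa> < lam"
    and "is_tree t" and "tree_enumeration lam t e" and "large lam \<kappa> t e"
  shows "\<exists>E. large_tree lam \<kappa> t e E"
  using assms(6) unfolding large_def Let_def
proof (elim exE conjE, goal_cases)
  case (1 E)
  then show ?case
    by (intro exI[of _ E], unfold_locales) (use assms(1-5) in \<open>simp_all\<close>)
qed

text \<open>\<exists> answers along the isomorphism or its inverse, whatever has happened before. A
  strategy is given only the history, so it finds the current move as the one at the last
  node.\<close>

lemma isomorphic_EF_equiv:
  fixes lam :: "'o::wellorder" and t :: "'t tree"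
    and A :: "('r, 'a) rel_structure" and B :: "('r, 'b) rel_structure"
  assumes t: "is_tree t" and iso: "isomorphic A B"
  shows "EF_equiv lam t A B"
proof -
  obtain f where f: "bij_betw f (univ A) (univ B)"
    and int: "\<And>R xs. set xs \<subseteq> univ A \<Longrightarrow> interp A R xs = interp B R (map f xs)"
    using iso by (auto simp: isomorphic_def)
  define g where "g = inv_into (univ A) f"
  define last where "last h = (THE x. x \<in> dom h \<and> (\<forall>y\<in>dom h. y = x \<or> lt t y x))" for h :: "('t, 'o, 'a, 'b) history"
  \<comment> \<open>The value is left unspecified unless the current move was made in the second
    structure, the only situation in which \<open>sa\<close> is consulted; \<open>sb\<close> is
    treated likewise.\<close>
  define sa where "sa h \<beta> = (case h (last h) of Some (In_Right l b) \<Rightarrow> g (b \<beta>))" for h :: "('t, 'o, 'a, 'b) history" and \<beta>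
  define sb where "sb h \<beta> = (case h (last h) of Some (In_Left l a) \<Rightarrow> f (a \<beta>))" for h :: "('t, 'o, 'a, 'b) history" and \<beta>
  have g: "g b \<in> univ A" "f (g b) = b" if "b \<in> univ B" for b
    using that f by (auto simp: g_def bij_betw_def inv_into_into f_inv_into_f)
  have "partial_iso A B (\<Union>x\<in>dom h. round_pairs sa sb t h x)" if h: "legal_history lam t A B h" for h
  proof -
    have dn: "dom h \<subseteq> nodes t" and legal: "\<And>m. m \<in> ran h \<Longrightarrow> legal_move lam A B m"
      using h by (auto simp: legal_history_def pred_on.chain_def)
    have upto: "history_upto t h x (last (history_upto t h x)) = h x" if x: "x \<in> dom h" for x
    proof -
      have xn: "x \<in> nodes t" using x dn by blast
      have "last (history_upto t h x) = x"
        unfolding last_def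
      proof (rule the_equality)
        show "x \<in> dom (history_upto t h x) \<and> (\<forall>y\<in>dom (history_upto t h x). y = x \<or> lt t y x)"
          using x by (auto simp: history_upto_def)
        fix y assume y: "y \<in> dom (history_upto t h x) \<and> (\<forall>w\<in>dom (history_upto t h x). w = y \<or> lt t w y)"
        have "x \<in> dom (history_upto t h x)" using x by (auto simp: history_upto_def)
        then have yx: "y = x \<or> lt t y x" "x = y \<or> lt t x y" "y \<in> nodes t"
          using y dn by (auto simp: history_upto_def)
        then show "y = x" using tree_irrefl[OF t xn] tree_trans[OF t xn yx(3) xn] by auto
      qed
      then show ?thesis by (simp add: history_upto_def)
    qed
    have pairs: "c \<in> univ A \<and> d = f c" if "(c, d) \<in> round_pairs sa sb t h x" "x \<in> dom h" for c d x
    proof (cases "h x")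
      case None
      then show ?thesis using that by auto
    next
      case (Some m)
      have m: "legal_move lam A B m" using Some by (intro legal ranI)
      show ?thesis
      proof (cases m)
        case (In_Left l a)
        then show ?thesis
          using that(1) m upto[OF that(2)] Some by (auto simp: round_pairs_def sb_def PiE_iff)
      next
        case (In_Right l b)
        then show ?thesis
          using that(1) m upto[OF that(2)] Some g by (auto simp: round_pairs_def sa_def PiE_iff)
      qed
    qed
    let ?p = "\<Union>x\<in>dom h. round_pairs sa sb t h x"
    have p: "c \<in> univ A" "d = f c" if "(c, d) \<in> ?p" for c d
      using that pairs by blast+
    show ?thesis
      unfolding partial_iso_def
    proof (intro conjI allI impI)
      show "?p \<subseteq> univ A \<times> univ B"
      proof
        fix c assume c: "c \<in> ?p"
        obtain a b where ab: "c = (a, b)" by force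
        have "a \<in> univ A" "b = f a" using p[of a b] c unfolding ab by blast+
        then show "c \<in> univ A \<times> univ B" using bij_betw_imp_surj_on[OF f] ab by blast
      qed
      show "single_valued ?p" using p(2) unfolding single_valued_def by blast
      show "single_valued (?p\<inverse>)"
        using p inj_onD[OF bij_betw_imp_inj_on[OF f]] unfolding single_valued_def converse_iff by metis
      fix R ps assume ps: "set ps \<subseteq> ?p"
      have ps': "fst c \<in> univ A" "snd c = f (fst c)" if "c \<in> set ps" for c
        using p[of "fst c" "snd c"] subsetD[OF ps that] by simp_all
      have snd_ps: "map snd ps = map f (map fst ps)" using ps'(2) by simp
      have "set (map fst ps) \<subseteq> univ A" using ps'(1) by auto
      then show "interp A R (map fst ps) = interp B R (map snd ps)" unfolding snd_ps by (rule int)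
    qed
  qed
  then show ?thesis unfolding EF_equiv_def by blast
qed

theorem theorem4p4:
  fixes lam \<kappa> :: "'o::wellorder"
    and I\<^sub>0 :: "'a tree" and I\<^sub>1 :: "'b tree"
    and t :: "'t tree" and e :: "'o \<Rightarrow> 't"
  assumes "regular_cardinal lam" and "regular_cardinal \<kappa>" and "\<kappa> < lam"
    and "bounded_height_tree lam \<kappa> I\<^sub>0" and "bounded_height_tree lam \<kappa> I\<^sub>1"
    and "short_branch_tree lam t" and "|nodes t| =o |{..<lam}|"
    and "tree_enumeration lam t e" and "large lam \<kappa> t e"
  shows "EF_equiv lam t (tree_structure I\<^sub>0) (tree_structure I\<^sub>1) \<longleftrightarrow>
    isomorphic (tree_structure I\<^sub>0) (tree_structure I\<^sub>1)"
proof
  have t: "is_tree t" using assms(6) by (simp add: short_branch_tree_def succ_card_tree_def)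
  show "EF_equiv lam t (tree_structure I\<^sub>0) (tree_structure I\<^sub>1)"
    if "isomorphic (tree_structure I\<^sub>0) (tree_structure I\<^sub>1)"
    by (rule isomorphic_EF_equiv[OF t that])
  assume "EF_equiv lam t (tree_structure I\<^sub>0) (tree_structure I\<^sub>1)"
  then obtain sa sb where "\<forall>h. legal_history lam t (tree_structure I\<^sub>0) (tree_structure I\<^sub>1) h \<longrightarrow>
      partial_iso (tree_structure I\<^sub>0) (tree_structure I\<^sub>1) (\<Union>x\<in>dom h. round_pairs sa sb t h x)"
    unfolding EF_equiv_def by (elim exE)
  note strat = this[rule_format]
  obtain E where E: "large_tree lam \<kappa> t e E"
    using large_treeI[OF assms(1-3) t assms(8,9)] by (rule exE)
  note G = game_pre_history[OF E assms(4,5) strat]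
  obtain f where f: "bij_betw f (nodes I\<^sub>0) (nodes I\<^sub>1)"
    and iff: "\<And>x y. x \<in> nodes I\<^sub>0 \<Longrightarrow> y \<in> nodes I\<^sub>0 \<Longrightarrow> lt I\<^sub>0 x y \<longleftrightarrow> lt I\<^sub>1 (f x) (f y)"
    using game.isomorphism_exists[OF G] by blast
  show "isomorphic (tree_structure I\<^sub>0) (tree_structure I\<^sub>1)"
    unfolding isomorphic_def tree_structure_simps
  proof (intro exI[of _ f] conjI allI impI)
    fix R xs assume xs: "set xs \<subseteq> nodes I\<^sub>0"
    have fn: "f x \<in> nodes I\<^sub>1" if "x \<in> nodes I\<^sub>0" for x using f that by (auto simp: bij_betw_def)
    show "(\<exists>x\<in>nodes I\<^sub>0. \<exists>y\<in>nodes I\<^sub>0. xs = [x, y] \<and> lt I\<^sub>0 x y) =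
        (\<exists>x\<in>nodes I\<^sub>1. \<exists>y\<in>nodes I\<^sub>1. map f xs = [x, y] \<and> lt I\<^sub>1 x y)"
      using xs fn iff by (auto simp: map_eq_Cons_conv)
  qed (rule f)
qed

end
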